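(* There exists a polynomial-time randomized non-preemptive online algorithm for minimizing total flow time on $m$ identical machines that is $O(\sqrt{n/m})$-competitive against the optimal offline preemptive schedule; that is, for every instance $J$ with $n$ jobs, $\mathbb{E}[F(\mathrm{ALG}(J))]\le O(\sqrt{n/m})\cdot\mathrm{OPT}(J)$.
   Context: Online scheduling of $n$ jobs on $m$ identical machines. Each job $j$ has a release time $r_j\ge 0$ and a processing time $p_j>0$; the job becomes known to the algorithm only at time $r_j$, and $n$ and $m$ are known to the algorithm in advance. Each machine processes at most one job at a time. In the non-preemptive model, a job once started on a machine runs without interruption until it completes. The flow time of job $j$ is $C_j-r_j$ and $F(\cdot)$ is the total flow time. $\mathrm{OPT}(J)$ is the minimum total flow time over all offline preemptive schedules without migration (a job may be interrupted and later resumed on the same machine without losing processed work). A randomized algorithm is $\Gamma$-competitive if its expected total flow time is at most $\Gamma\cdot\mathrm{OPT}(J)$ for every instance $J$.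
   Formalization: The ratio O(√(n/m)) is replaced by O(max(1, √(n/m))): it is unchanged for n ≥ m, while for n much smaller than m the stated ratio would fall below 1, which no algorithm can achieve (e.g. one job on many machines). *)

theory Defs
  imports
    "HOL-Probability.Probability"
    "HOL-Computational_Algebra.Polynomial"
begin

section \<open>Instances\<close>

text \<open>
  Jobs are named \<open>0, \<dots>, n - 1\<close> and machines \<open>0, \<dots>, m - 1\<close>. The order of the names
  is arbitrary; in particular it need not be the order of release.
\<close>

record problem =
  num_jobs :: nat
  num_machines :: nat
  release :: "nat \<Rightarrow> real"
  proc :: "nat \<Rightarrow> real"

definition valid_problem :: "problem \<Rightarrow> bool" where
  "valid_problem J \<longleftrightarrow> 1 \<le> num_machines J \<and>
     (\<forall>j<num_jobs J. 0 \<le> release J j \<and> 0 < proc J j)"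


section \<open>Offline preemptive schedules without migration\<close>

text \<open>
  \<open>M j\<close> is the machine of job \<open>j\<close>. A pair \<open>(a, b)\<close> in \<open>P j\<close> means that
  \<open>j\<close> is processed on this machine during the whole time interval from \<open>a\<close> to \<open>b\<close>.
\<close>

definition preemptive_schedule ::
    "problem \<Rightarrow> (nat \<Rightarrow> nat) \<Rightarrow> (nat \<Rightarrow> (real \<times> real) set) \<Rightarrow> bool" where
  "preemptive_schedule J M P \<longleftrightarrow>
     (\<forall>j<num_jobs J. M j < num_machines J \<and> finite (P j) \<and>
        (\<forall>(a, b)\<in>P j. release J j \<le> a \<and> a < b) \<and>
        (\<Sum>(a, b)\<in>P j. b - a) = proc J j) \<and>
     (\<forall>j<num_jobs J. \<forall>k<num_jobs J. \<forall>(a, b)\<in>P j. \<forall>(c, d)\<in>P k.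
        M j = M k \<and> (j, a, b) \<noteq> (k, c, d) \<longrightarrow> b \<le> c \<or> d \<le> a)"

definition preemptive_flow :: "problem \<Rightarrow> (nat \<Rightarrow> (real \<times> real) set) \<Rightarrow> real" where
  "preemptive_flow J P = (\<Sum>j<num_jobs J. Max (snd ` P j) - release J j)"

definition OPT :: "problem \<Rightarrow> real" where
  "OPT J = Inf {preemptive_flow J P | M P. preemptive_schedule J M P}"


section \<open>Non-preemptive schedules\<close>

text \<open>
  \<open>S j = Some (i, t)\<close> means that job \<open>j\<close> is started on machine \<open>i\<close> at time \<open>t\<close> and
  hence occupies this machine from \<open>t\<close> to \<open>t + proc J j\<close>.
\<close>

type_synonym nonpreemptive = "nat \<rightharpoonup> nat \<times> real"

definition nonpreemptive_schedule :: "problem \<Rightarrow> nonpreemptive \<Rightarrow> bool" where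
  "nonpreemptive_schedule J S \<longleftrightarrow>
     dom S = {..<num_jobs J} \<and>
     (\<forall>j i t. S j = Some (i, t) \<longrightarrow> i < num_machines J \<and> release J j \<le> t) \<and>
     (\<forall>j k i t u. j \<noteq> k \<and> S j = Some (i, t) \<and> S k = Some (i, u) \<longrightarrow>
        t + proc J j \<le> u \<or> u + proc J k \<le> t)"

definition nonpreemptive_flow :: "problem \<Rightarrow> nonpreemptive \<Rightarrow> real" where
  "nonpreemptive_flow J S =
     (\<Sum>j<num_jobs J. snd (the (S j)) + proc J j - release J j)"


section \<open>Randomized online algorithms as programs\<close>

text \<open>
  An algorithm is one program of a random access machine with natural number and real
  arrays, fair coin flips, and a clock; a scalar is an array used at index 0 only. The
  program does not depend on \<open>n\<close> and \<open>m\<close>, but may read them.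

  There is no arbitrary real constant (it could hide unbounded advice) and no unit-cost
  multiplication or rounding of reals. With rational inputs over a common denominator,
  addition, subtraction and halving lengthen numbers by at most one bit per operation, so
  polynomially many steps of this machine are polynomial time in the bit model too.
\<close>

datatype iexp =
    NumJobs
  | NumMachines
  | IConst nat
  | IVar string iexp
  | IAdd iexp iexp
  | ISub iexp iexp

datatype rexp =
    Clock
  | Release iexp
  | Proc iexp
  | RNat iexp
  | RVar string iexp
  | RAdd rexp rexp
  | RSub rexp rexp
  | RHalf rexp

datatype bexp =
    Released iexp
  | ILess iexp iexp
  | RLess rexp rexp
  | BNot bexp
  | BAnd bexp bexp

datatype com =
    Skip
  | IAssign string iexp iexp
  | RAssign string iexp rexp
  | Flip string iexp
  | Start iexp iexp
  | WaitRelease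
  | WaitUntil rexp
  | Seq com com
  | Cond bexp com com
  | While bexp com

record state =
  ivar :: "string \<Rightarrow> nat \<Rightarrow> nat"
  rvar :: "string \<Rightarrow> nat \<Rightarrow> real"
  clock :: real
  started :: nonpreemptive
  coins :: "bool list"

definition init :: "bool list \<Rightarrow> state" where
  "init w = \<lparr>ivar = \<lambda>_ _. 0, rvar = \<lambda>_ _. 0, clock = 0, started = Map.empty, coins = w\<rparr>"

text \<open>The program sees the data of a job only from its release time on.\<close>

definition visible :: "problem \<Rightarrow> real \<Rightarrow> nat \<Rightarrow> bool" where
  "visible J t j \<longleftrightarrow> j < num_jobs J \<and> release J j \<le> t"

fun ival :: "problem \<Rightarrow> iexp \<Rightarrow> state \<Rightarrow> nat" where
  "ival J NumJobs s = num_jobs J"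
| "ival J NumMachines s = num_machines J"
| "ival J (IConst k) s = k"
| "ival J (IVar x e) s = ivar s x (ival J e s)"
| "ival J (IAdd e f) s = ival J e s + ival J f s"
| "ival J (ISub e f) s = ival J e s - ival J f s"

fun rval :: "problem \<Rightarrow> rexp \<Rightarrow> state \<Rightarrow> real" where
  "rval J Clock s = clock s"
| "rval J (Release e) s =
     (if visible J (clock s) (ival J e s) then release J (ival J e s) else 0)"
| "rval J (Proc e) s =
     (if visible J (clock s) (ival J e s) then proc J (ival J e s) else 0)"
| "rval J (RNat e) s = real (ival J e s)"
| "rval J (RVar x e) s = rvar s x (ival J e s)"
| "rval J (RAdd e f) s = rval J e s + rval J f s"
| "rval J (RSub e f) s = rval J e s - rval J f s"
| "rval J (RHalf e) s = rval J e s / 2"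

fun bval :: "problem \<Rightarrow> bexp \<Rightarrow> state \<Rightarrow> bool" where
  "bval J (Released e) s = visible J (clock s) (ival J e s)"
| "bval J (ILess e f) s = (ival J e s < ival J f s)"
| "bval J (RLess e f) s = (rval J e s < rval J f s)"
| "bval J (BNot b) s = (\<not> bval J b s)"
| "bval J (BAnd b c) s = (bval J b s \<and> bval J c s)"

definition set_ivar :: "string \<Rightarrow> nat \<Rightarrow> nat \<Rightarrow> state \<Rightarrow> state" where
  "set_ivar x k v s = s\<lparr>ivar := (ivar s)(x := (ivar s x)(k := v))\<rparr>"

definition set_rvar :: "string \<Rightarrow> nat \<Rightarrow> real \<Rightarrow> state \<Rightarrow> state" where
  "set_rvar x k v s = s\<lparr>rvar := (rvar s)(x := (rvar s x)(k := v))\<rparr>"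

definition future_releases :: "problem \<Rightarrow> real \<Rightarrow> real set" where
  "future_releases J t = release J ` {j. j < num_jobs J \<and> t < release J j}"

definition next_release :: "problem \<Rightarrow> real \<Rightarrow> real" where
  "next_release J t = (if future_releases J t = {} then t else Min (future_releases J t))"

text \<open>Waiting for time \<open>u\<close> is interrupted by every release, so that the program can react.\<close>

definition wait_until :: "problem \<Rightarrow> real \<Rightarrow> real \<Rightarrow> real" where
  "wait_until J t u = Min (insert (max t u) (future_releases J t))"

text \<open>
  \<open>big_step J c s t s'\<close>: on instance \<open>J\<close>, command \<open>c\<close> terminates from state \<open>s\<close> in
  state \<open>s'\<close> after \<open>t\<close> elementary steps. Every expression is charged unit cost, which is
  right up to a factor depending only on the program. Only the two wait commands advance the
  clock; computation takes no scheduling time. A job can be started only once, at the current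
  time and irrevocably; whether all starts are legal is judged by
  \<^const>\<open>nonpreemptive_schedule\<close> on the final schedule.
\<close>

inductive big_step :: "problem \<Rightarrow> com \<Rightarrow> state \<Rightarrow> nat \<Rightarrow> state \<Rightarrow> bool" for J where
  Skip: "big_step J Skip s 1 s"
| IAssign: "big_step J (IAssign x e f) s 1 (set_ivar x (ival J e s) (ival J f s) s)"
| RAssign: "big_step J (RAssign x e f) s 1 (set_rvar x (ival J e s) (rval J f s) s)"
| Flip: "coins s = w # ws \<Longrightarrow>
    big_step J (Flip x e) s 1 (set_ivar x (ival J e s) (of_bool w) (s\<lparr>coins := ws\<rparr>))"
| Start: "started s (ival J e s) = None \<Longrightarrow>
    big_step J (Start e f) s 1
      (s\<lparr>started := (started s)(ival J e s \<mapsto> (ival J f s, clock s))\<rparr>)"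
| WaitRelease: "big_step J WaitRelease s 1 (s\<lparr>clock := next_release J (clock s)\<rparr>)"
| WaitUntil: "big_step J (WaitUntil e) s 1
    (s\<lparr>clock := wait_until J (clock s) (rval J e s)\<rparr>)"
| Seq: "big_step J c s t s' \<Longrightarrow> big_step J d s' u s'' \<Longrightarrow>
    big_step J (Seq c d) s (t + u) s''"
| CondTrue: "bval J b s \<Longrightarrow> big_step J c s t s' \<Longrightarrow>
    big_step J (Cond b c d) s (1 + t) s'"
| CondFalse: "\<not> bval J b s \<Longrightarrow> big_step J d s t s' \<Longrightarrow>
    big_step J (Cond b c d) s (1 + t) s'"
| WhileFalse: "\<not> bval J b s \<Longrightarrow> big_step J (While b c) s 1 s"
| WhileTrue: "bval J b s \<Longrightarrow> big_step J c s t s' \<Longrightarrow>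
    big_step J (While b c) s' u s'' \<Longrightarrow>
    big_step J (While b c) s (1 + t + u) s''"

lemma big_step_deterministic:
  "big_step J c s t s' \<Longrightarrow> big_step J c s u s'' \<Longrightarrow> t = u \<and> s' = s''"
proof (induction arbitrary: u s'' rule: big_step.induct)
  case (Seq c s t s' d u s'')
  from Seq.prems show ?case by (cases rule: big_step.cases) (use Seq.IH in blast)+
next
  case (WhileTrue b s c t s' u s'')
  from WhileTrue.prems show ?case
    by (cases rule: big_step.cases) (use WhileTrue.IH WhileTrue.hyps in blast)+
qed (erule big_step.cases; force)+

text \<open>
  The schedule produced on the random bits \<open>w\<close>. By determinism it is unique; it is
  meaningful only if the program terminates.
\<close>

definition schedule_of :: "com \<Rightarrow> problem \<Rightarrow> bool list \<Rightarrow> nonpreemptive" where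
  "schedule_of A J w = started (THE s. \<exists>t. big_step J A (init w) t s)"

text \<open>
  Time bound \<open>T n\<close>: on every valid instance with \<open>n\<close> jobs and for every outcome of the
  coins, the program halts after at most \<open>T n\<close> steps in total. As each coin flip takes a
  step, \<open>T n\<close> random bits are always enough.
\<close>

definition runs_in_time :: "com \<Rightarrow> (nat \<Rightarrow> nat) \<Rightarrow> bool" where
  "runs_in_time A T \<longleftrightarrow>
     (\<forall>J w. valid_problem J \<and> length w = T (num_jobs J) \<longrightarrow>
        (\<exists>t s. big_step J A (init w) t s \<and> t \<le> T (num_jobs J)))"

definition nonpreemptive_algorithm :: "com \<Rightarrow> (nat \<Rightarrow> nat) \<Rightarrow> bool" where
  "nonpreemptive_algorithm A T \<longleftrightarrow>
     (\<forall>J w. valid_problem J \<and> length w = T (num_jobs J) \<longrightarrow>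
        nonpreemptive_schedule J (schedule_of A J w))"

definition random_bits :: "nat \<Rightarrow> bool list pmf" where
  "random_bits k = pmf_of_set {w. length w = k}"

definition expected_flow :: "com \<Rightarrow> (nat \<Rightarrow> nat) \<Rightarrow> problem \<Rightarrow> real" where
  "expected_flow A T J =
     measure_pmf.expectation (random_bits (T (num_jobs J)))
       (\<lambda>w. nonpreemptive_flow J (schedule_of A J w))"

definition competitive :: "com \<Rightarrow> (nat \<Rightarrow> nat) \<Rightarrow> (nat \<Rightarrow> nat \<Rightarrow> real) \<Rightarrow> bool" where
  "competitive A T \<Gamma> \<longleftrightarrow>
     (\<forall>J. valid_problem J \<longrightarrow>
        expected_flow A T J \<le> \<Gamma> (num_jobs J) (num_machines J) * OPT J)"

end

(* Let k be the least power of two with n <= m k^2, where m is capped at n. The m k largest jobs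
   released so far sit in slots, k per machine. A job j that finds no free slot evicts the smallest
   job y among the slots and itself; y gets the deadline r_j + k p_y, and idle machines run the
   evicted jobs in order of their deadlines. A slot job l counts down R_l periods of length p_l,
   with R_l uniform in {0, ..., k - 1}, and then claims its machine. Countdowns pause while the
   machine is blocked by an earlier claim, for four times the size of the claiming job, and while
   a fluid copy of the evicted volume is processed at a rate hm between m / 2 and m.

   As p_y <= p_j, the optimum has processed p_y units of j by time r_j + k p_y, or the flow time
   of j is at least k p_y. So the volume of evicted jobs due in an interval exceeds the capacity
   of m machines by at most OPT / k. An evicted job is therefore late only by O(OPT / k) / m plus
   1 / m times the size of the slot jobs l that fire within O(p_l) of its deadline, measured in
   time during which the fluid is idle. Fixing all random numbers except R_l, distinct values of
   R_l let l fire at times that differ by multiples of p_l, so this event has probability O(1 / k).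
   Summed over n jobs, the expected lateness is O(n / (m k)) OPT = O(k) OPT, and the slot jobs wait
   O(k) times the total processing time, which is at most OPT. *)

theory Submission imports Defs begin


section \<open>A program logic with running times\<close>

text \<open>A job keeps its slot after it fires or starts, and its later eviction feeds the fluid
  all the same. Slots, evictions, deadlines and the fluid are therefore functions of the instance,
  not of the random numbers, and when R_l is resampled the idle time that belongs to a deadline is a
  fixed target.

  The fluid reserves capacity for the queue. The evicted volume due in an interval plus
  \<open>hm\<close> times the idle time of the fluid exceeds the capacity of the machines by at most
  OPT / k, so slot jobs may use half of the machines during idle time. The factor four keeps them
  within this half: a firing job of size p meets at most p of unfinished work on its machine, and
  these 2 p are half of the blocking of 4 p.

  The parameters are powers of two because the machine can only add, subtract and halve: k p_y
  arises by doubling, p_y / hm by halving, and a uniform R_l is a block of coins. Rounding costs at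
  most a factor of two in each of them.\<close>

text \<open>Every loop is charged for \<open>N\<close> iterations, which makes the cost a polynomial in \<open>N\<close>.\<close>

fun cost :: "nat \<Rightarrow> com \<Rightarrow> nat" where
  "cost N (Seq c d) = cost N c + cost N d"
| "cost N (Cond b c d) = 1 + cost N c + cost N d"
| "cost N (While b c) = 1 + N * (1 + cost N c)"
| "cost N _ = 1"

text \<open>The existential form suffices because runs are deterministic; it makes termination and
  the time bound part of every triple.\<close>

definition tri :: "problem \<Rightarrow> nat \<Rightarrow> com \<Rightarrow> state \<Rightarrow> (state \<Rightarrow> bool) \<Rightarrow> bool" where
  "tri J N c s Q \<longleftrightarrow> (\<exists>t s'. big_step J c s t s' \<and> t \<le> cost N c \<and> Q s')"

lemma tri_mono: "tri J N c s Q \<Longrightarrow> (\<And>s'. Q s' \<Longrightarrow> Q' s') \<Longrightarrow> tri J N c s Q'"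
  unfolding tri_def by blast

lemma tri_Skip: "Q s \<Longrightarrow> tri J N Skip s Q"
  unfolding tri_def using big_step.Skip by fastforce

lemma tri_IAssign:
  "Q (set_ivar x (ival J e s) (ival J f s) s) \<Longrightarrow> tri J N (IAssign x e f) s Q"
  unfolding tri_def using big_step.IAssign by fastforce

lemma tri_RAssign:
  "Q (set_rvar x (ival J e s) (rval J f s) s) \<Longrightarrow> tri J N (RAssign x e f) s Q"
  unfolding tri_def using big_step.RAssign by fastforce

lemma tri_Flip:
  "coins s = w # ws \<Longrightarrow> Q (set_ivar x (ival J e s) (of_bool w) (s\<lparr>coins := ws\<rparr>)) \<Longrightarrow>
    tri J N (Flip x e) s Q"
  unfolding tri_def using big_step.Flip by fastforce

lemma tri_Start:
  "started s (ival J e s) = None \<Longrightarrow>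
    Q (s\<lparr>started := (started s)(ival J e s \<mapsto> (ival J f s, clock s))\<rparr>) \<Longrightarrow>
    tri J N (Start e f) s Q"
  unfolding tri_def by (intro exI conjI, erule big_step.Start) auto

lemma tri_WaitRelease:
  "Q (s\<lparr>clock := next_release J (clock s)\<rparr>) \<Longrightarrow> tri J N WaitRelease s Q"
  unfolding tri_def using big_step.WaitRelease by fastforce

lemma tri_WaitUntil:
  "Q (s\<lparr>clock := wait_until J (clock s) (rval J e s)\<rparr>) \<Longrightarrow> tri J N (WaitUntil e) s Q"
  unfolding tri_def using big_step.WaitUntil by fastforce

lemma tri_Seq: "tri J N c s (\<lambda>s'. tri J N d s' Q) \<Longrightarrow> tri J N (Seq c d) s Q"
  unfolding tri_def by (fastforce intro: big_step.Seq add_mono)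

lemma tri_Cond:
  assumes "bval J b s \<Longrightarrow> tri J N c s Q" "\<not> bval J b s \<Longrightarrow> tri J N d s Q"
  shows "tri J N (Cond b c d) s Q"
proof (cases "bval J b s")
  case True
  with assms(1) obtain t s' where "big_step J c s t s'" "t \<le> cost N c" "Q s'"
    unfolding tri_def by blast
  with True show ?thesis unfolding tri_def
    by (intro exI[of _ "1 + t"] exI[of _ s']) (use big_step.CondTrue in auto)
next
  case False
  with assms(2) obtain t s' where "big_step J d s t s'" "t \<le> cost N d" "Q s'"
    unfolding tri_def by blast
  with False show ?thesis unfolding tri_def
    by (intro exI[of _ "1 + t"] exI[of _ s']) (use big_step.CondFalse in auto)
qed

text \<open>The induction proves the sharper bound with \<open>\<mu> s\<close> in place of
  \<open>N\<close>, since \<open>\<mu>\<close> shrinks along the loop while \<open>N\<close> is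
  fixed.\<close>

lemma tri_While:
  assumes "I s" "\<mu> s \<le> N"
    and step: "\<And>s. I s \<Longrightarrow> bval J b s \<Longrightarrow> tri J N c s (\<lambda>s'. I s' \<and> \<mu> s' < (\<mu> s :: nat))"
    and fin: "\<And>s. I s \<Longrightarrow> \<not> bval J b s \<Longrightarrow> Q s"
  shows "tri J N (While b c) s Q"
proof -
  have "\<exists>t s'. big_step J (While b c) s t s' \<and> t \<le> 1 + \<mu> s * (1 + cost N c) \<and> Q s'"
    using assms(1)
  proof (induction "\<mu> s" arbitrary: s rule: less_induct)
    case less
    show ?case
    proof (cases "bval J b s")
      case False
      with less.prems show ?thesis using fin big_step.WhileFalse
        by (intro exI[of _ 1] exI[of _ s]) auto
    next
      case True
      obtain t s' where 1: "big_step J c s t s'" "t \<le> cost N c" "I s'" "\<mu> s' < \<mu> s"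
        using step[OF less.prems True] unfolding tri_def by blast
      obtain u s'' where 2: "big_step J (While b c) s' u s''"
        "u \<le> 1 + \<mu> s' * (1 + cost N c)" "Q s''"
        using less.hyps[OF 1(4,3)] by blast
      have "1 + t + u \<le> 1 + (\<mu> s' + 1) * (1 + cost N c)"
        using 1(2) 2(2) by simp
      also have "\<dots> \<le> 1 + \<mu> s * (1 + cost N c)"
        using 1(4) by (intro add_left_mono mult_right_mono) auto
      finally show ?thesis
        using big_step.WhileTrue[OF True 1(1) 2(1)] 2(3) by blast
    qed
  qed
  then obtain t s' where *: "big_step J (While b c) s t s'" "Q s'"
    and t: "t \<le> 1 + \<mu> s * (1 + cost N c)"
    by blast
  have "t \<le> cost N (While b c)"
    using order.trans[OF t add_left_mono[OF mult_right_mono[OF assms(2)]]] by simp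
  with * show ?thesis unfolding tri_def by blast
qed

abbreviation iscal :: "string \<Rightarrow> iexp" where "iscal x \<equiv> IVar x (IConst 0)"
abbreviation rscal :: "string \<Rightarrow> rexp" where "rscal x \<equiv> RVar x (IConst 0)"
abbreviation iset :: "string \<Rightarrow> iexp \<Rightarrow> com" where "iset x e \<equiv> IAssign x (IConst 0) e"
abbreviation rset :: "string \<Rightarrow> rexp \<Rightarrow> com" where "rset x e \<equiv> RAssign x (IConst 0) e"
abbreviation IEq :: "iexp \<Rightarrow> iexp \<Rightarrow> bexp" where
  "IEq a b \<equiv> BAnd (BNot (ILess a b)) (BNot (ILess b a))"
abbreviation RLe :: "rexp \<Rightarrow> rexp \<Rightarrow> bexp" where "RLe a b \<equiv> BNot (RLess b a)"

definition For :: "string \<Rightarrow> iexp \<Rightarrow> com \<Rightarrow> com" where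
  "For x e c = Seq (iset x (IConst 0))
     (While (ILess (iscal x) e) (Seq c (iset x (IAdd (iscal x) (IConst 1)))))"

text \<open>The bound \<open>e\<close> is evaluated again in each iteration, so the invariant has to
  determine its value. The body must leave the counter as it found it, which is why nested loops use
  different counters.\<close>

lemma tri_For:
  assumes "b \<le> N"
    and bound: "\<And>i s. I i s \<Longrightarrow> ival J e s = b"
    and step: "\<And>i s. I i s \<Longrightarrow> ivar s x 0 = i \<Longrightarrow> i < b \<Longrightarrow>
      tri J N c s (\<lambda>s'. ivar s' x 0 = i \<and> I (Suc i) (set_ivar x 0 (Suc i) s'))"
    and init: "I 0 (set_ivar x 0 0 s)"
    and fin: "\<And>s. I b s \<Longrightarrow> Q s"
  shows "tri J N (For x e c) s Q"
  unfolding For_def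
proof (rule tri_Seq, rule tri_IAssign, simp only: ival.simps)
  have [simp]: "ivar (set_ivar x 0 v s) x 0 = v" for v s by (simp add: set_ivar_def)
  show "tri J N (While (ILess (iscal x) e) (Seq c (iset x (IAdd (iscal x) (IConst 1)))))
     (set_ivar x 0 0 s) Q"
  proof (rule tri_While[where I = "\<lambda>s. I (ivar s x 0) s \<and> ivar s x 0 \<le> b"
        and \<mu> = "\<lambda>s. b - ivar s x 0"])
    fix s assume *: "I (ivar s x 0) s \<and> ivar s x 0 \<le> b" "bval J (ILess (iscal x) e) s"
    hence lt: "ivar s x 0 < b" using bound by fastforce
    show "tri J N (Seq c (iset x (IAdd (iscal x) (IConst 1)))) s
       (\<lambda>s'. (I (ivar s' x 0) s' \<and> ivar s' x 0 \<le> b) \<and> b - ivar s' x 0 < b - ivar s x 0)"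
      by (rule tri_Seq, rule tri_mono[OF step[of "ivar s x 0"]])
        (use * lt in \<open>auto intro!: tri_IAssign\<close>)
  next
    fix s assume *: "I (ivar s x 0) s \<and> ivar s x 0 \<le> b" "\<not> bval J (ILess (iscal x) e) s"
    hence "ivar s x 0 = b" using bound by fastforce
    with * fin show "Q s" by metis
  qed (use init assms(1) in auto)
qed

lemma sel_set [simp]:
  "ivar (set_ivar x i v s) y = (if y = x then (ivar s x)(i := v) else ivar s y)"
  "rvar (set_ivar x i v s) = rvar s" "clock (set_ivar x i v s) = clock s"
  "started (set_ivar x i v s) = started s" "coins (set_ivar x i v s) = coins s"
  "rvar (set_rvar x i a s) y = (if y = x then (rvar s x)(i := a) else rvar s y)"
  "ivar (set_rvar x i a s) = ivar s" "clock (set_rvar x i a s) = clock s"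
  "started (set_rvar x i a s) = started s" "coins (set_rvar x i a s) = coins s"
  by (auto simp: set_ivar_def set_rvar_def)

fun cost_poly :: "com \<Rightarrow> nat poly" where
  "cost_poly (Seq c d) = cost_poly c + cost_poly d"
| "cost_poly (Cond b c d) = 1 + cost_poly c + cost_poly d"
| "cost_poly (While b c) = 1 + [:0, 1:] * (1 + cost_poly c)"
| "cost_poly _ = 1"

lemma poly_cost_poly: "poly (cost_poly c) N = cost N c"
  by (induction c) auto


section \<open>The evicting slots\<close>

text \<open>
  \<open>ins\<close> are the jobs in the slots and \<open>mc\<close> their machines. The slots are filled in rows:
  \<open>ur\<close> rows are full, and the next one has \<open>um\<close> jobs. The fluid is busy until \<open>fl\<close>, its
  total volume is \<open>sm\<close>. The arrival of \<open>j\<close> evicts \<open>en j\<close>; \<open>ky\<close> is the deadline.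
\<close>

record dconf =
  ins :: "nat set"
  mc :: "nat \<Rightarrow> nat"
  ur :: nat
  um :: nat
  fl :: real
  sm :: real
  en :: "nat \<Rightarrow> nat option"
  ky :: "nat \<Rightarrow> real"

lemma fold_argmin:
  fixes p :: "nat \<Rightarrow> real" and A :: "nat set"
  defines "g \<equiv> \<lambda>l y. if l \<in> A \<and> p l < p y then l else y"
  shows "(fold g xs j = j \<or> fold g xs j \<in> set xs \<inter> A) \<and> p (fold g xs j) \<le> p j \<and>
    (\<forall>l\<in>set xs \<inter> A. p (fold g xs j) \<le> p l)"
proof (induction xs arbitrary: j)
  case (Cons a xs)
  show ?case using Cons[of j] Cons[of a] by (auto simp: g_def)
qed simp

lemma sum_upd:
  fixes f g :: "'a \<Rightarrow> real"
  assumes "finite A" "a \<in> A" "\<And>x. x \<in> A \<Longrightarrow> x \<noteq> a \<Longrightarrow> g x = f x"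
  shows "sum g A = sum f A - f a + g a"
proof -
  have "sum g A = g a + sum g (A - {a})" "sum f A = f a + sum f (A - {a})"
    using assms by (auto simp: sum.remove)
  moreover have "sum g (A - {a}) = sum f (A - {a})"
    using assms by (intro sum.cong) auto
  ultimately show ?thesis by simp
qed

text \<open>Here \<open>hm\<close> is any number within a factor of two below the number of usable
  machines. Powers of two enter with the program, and the relation between \<open>n\<close> and
  \<open>m * k ^ 2\<close> in the final average.\<close>

locale flow =
  fixes J :: problem and k hm :: nat
  assumes valid: "valid_problem J" and n_pos: "0 < num_jobs J" and k_pos: "0 < k"
    and hm: "hm \<le> min (num_jobs J) (num_machines J)" "min (num_jobs J) (num_machines J) < 2 * hm"
begin

abbreviation "n \<equiv> num_jobs J"
definition m :: nat where "m = min n (num_machines J)"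
abbreviation "r \<equiv> release J"
abbreviation "p \<equiv> proc J"

definition P :: real where "P = (\<Sum>j<n. p j)"

lemma p_pos: "j < n \<Longrightarrow> 0 < p j" and r_nonneg: "j < n \<Longrightarrow> 0 \<le> r j"
  using valid by (auto simp: valid_problem_def)

lemma m_pos: "0 < m"
  using valid n_pos by (auto simp: valid_problem_def m_def)

lemma m_le_n: "m \<le> n" by (simp add: m_def)

lemma hm_pos: "0 < hm" and hm_le: "hm \<le> m" and m_less: "m < 2 * hm"
  using hm by (auto simp: m_def)

lemma P_nonneg: "0 \<le> P"
  unfolding P_def by (intro sum_nonneg) (auto dest: p_pos intro: less_imp_le)

definition dmin :: "dconf \<Rightarrow> nat \<Rightarrow> nat" where
  "dmin d j = fold (\<lambda>l y. if l \<in> ins d \<and> p l < p y then l else y) [0..<n] j"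

text \<open>The newcomer takes over the machine of the evicted job, so every machine keeps
  \<open>k\<close> slots. Whether the evicted job has already been started is not asked; this keeps
  \<open>dconf\<close> independent of the random numbers.\<close>

definition dins :: "nat \<Rightarrow> dconf \<Rightarrow> dconf" where
  "dins j d =
    (if ur d < k
     then d\<lparr>ins := insert j (ins d), mc := (mc d)(j := um d),
            ur := (if Suc (um d) = m then Suc (ur d) else ur d),
            um := (if Suc (um d) = m then 0 else Suc (um d))\<rparr>
     else let y = dmin d j in
       d\<lparr>ins := insert j (ins d) - {y}, mc := (mc d)(j := mc d y),
         fl := max (fl d) (r j) + p y / hm, sm := sm d + p y,
         en := (en d)(j := Some y), ky := (ky d)(y := r j + k * p y)\<rparr>)"

definition d0 :: dconf where
  "d0 = \<lparr>ins = {}, mc = \<lambda>_. 0, ur = 0, um = 0, fl = 0, sm = 0, en = \<lambda>_. None, ky = \<lambda>_. 0\<rparr>"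

definition esz :: "nat option \<Rightarrow> real" where
  "esz v = (case v of None \<Rightarrow> 0 | Some x \<Rightarrow> p x)"

text \<open>\<open>X\<close> is the set of jobs that have arrived. A row is filled machine by
  machine, so the first \<open>um\<close> machines are one slot ahead of the others.\<close>

definition dinv :: "nat set \<Rightarrow> dconf \<Rightarrow> bool" where
  "dinv X d \<longleftrightarrow> ins d \<subseteq> X \<and> X \<subseteq> {..<n} \<and> (\<forall>l\<in>ins d. mc d l < m) \<and> um d < m \<and> ur d \<le> k \<and>
     (ur d = k \<longrightarrow> um d = 0) \<and>
     (\<forall>i<m. card {l \<in> ins d. mc d l = i} = ur d + (if i < um d then 1 else 0)) \<and>
     (\<forall>x\<in>X - ins d. ur d = k \<and> (\<forall>l\<in>ins d. p x \<le> p l) \<and> (\<exists>j. en d j = Some x)) \<and>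
     (\<forall>j x. en d j = Some x \<longrightarrow> j \<in> X \<and> x \<in> X - ins d \<and> p x \<le> p j \<and> ky d x = r j + k * p x) \<and>
     sm d = (\<Sum>j<n. esz (en d j))"

lemma dinv_d0: "dinv {} d0"
  using m_pos k_pos by (auto simp: dinv_def d0_def esz_def)

lemma dmin:
  assumes "ins d \<subseteq> {..<n}"
  shows "dmin d j = j \<or> dmin d j \<in> ins d" "p (dmin d j) \<le> p j"
    "l \<in> ins d \<Longrightarrow> p (dmin d j) \<le> p l"
  using fold_argmin[of "ins d" p "[0..<n]" j] assms by (auto simp: dmin_def)

lemma dinvD:
  assumes "dinv X d"
  shows "ins d \<subseteq> X" "X \<subseteq> {..<n}" "finite (ins d)" "ins d \<subseteq> {..<n}"
    "\<And>l. l \<in> ins d \<Longrightarrow> mc d l < m" "um d < m" "ur d \<le> k" "ur d = k \<Longrightarrow> um d = 0"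
    "\<And>i. i < m \<Longrightarrow> card {l \<in> ins d. mc d l = i} = ur d + (if i < um d then 1 else 0)"
    "\<And>x. x \<in> X \<Longrightarrow> x \<notin> ins d \<Longrightarrow> ur d = k"
    "\<And>x l. x \<in> X \<Longrightarrow> x \<notin> ins d \<Longrightarrow> l \<in> ins d \<Longrightarrow> p x \<le> p l"
    "\<And>x. x \<in> X \<Longrightarrow> x \<notin> ins d \<Longrightarrow> \<exists>j. en d j = Some x"
    "\<And>j x. en d j = Some x \<Longrightarrow> j \<in> X \<and> x \<in> X \<and> x \<notin> ins d \<and> p x \<le> p j \<and> ky d x = r j + k * p x"
    "sm d = (\<Sum>j<n. esz (en d j))"
  using assms finite_subset[of "ins d" "{..<n}"] unfolding dinv_def
  by (blast | simp)+

text \<open>That evicted jobs lie below all slot jobs survives an eviction: if \<open>y\<close>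
  comes from a slot, an earlier evicted \<open>x\<close> satisfies \<open>p x \<le> p y\<close> and
  \<open>p y \<le> p j\<close>, and \<open>y\<close> itself is a minimum.\<close>

lemma dinv_dins:
  assumes "dinv X d" "j \<notin> X" "j < n"
  shows "dinv (insert j X) (dins j d)"
proof (cases "ur d < k")
  case True
  note d = dinvD[OF assms(1)]
  have X: "X = ins d" using d(1,10) True by (metis less_irrefl subsetI subset_antisym)
  have fin: "finite (ins d)" using dinvD(3)[OF assms(1)] .
  have en: "en d i = None" for i using d(13) X by (metis option.exhaust)
  define d' where "d' = dins j d"
  have d'[simp]: "ins d' = insert j (ins d)" "mc d' = (mc d)(j := um d)"
      "ur d' = (if Suc (um d) = m then Suc (ur d) else ur d)"
      "um d' = (if Suc (um d) = m then 0 else Suc (um d))" "en d' = en d" "sm d' = sm d"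
    using True by (simp_all add: d'_def dins_def)
  have cnt: "card {l \<in> ins d'. mc d' l = i} = ur d' + (if i < um d' then 1 else 0)" if "i < m" for i
  proof -
    have "{l \<in> ins d'. mc d' l = i} =
        (if i = um d then insert j {l \<in> ins d. mc d l = i} else {l \<in> ins d. mc d l = i})"
      using assms(2) X by auto
    hence "card {l \<in> ins d'. mc d' l = i} =
        card {l \<in> ins d. mc d l = i} + (if i = um d then 1 else 0)"
      using assms(2) X fin by auto
    also have "card {l \<in> ins d. mc d l = i} = ur d + (if i < um d then 1 else 0)"
      using d that by blast
    finally show ?thesis using d that by auto
  qed
  have mcl: "\<forall>l\<in>ins d'. mc d' l < m" using d by auto
  have um: "um d' < m" "ur d' \<le> k" "ur d' = k \<longrightarrow> um d' = 0" using d m_pos True by auto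
  have "sm d' = (\<Sum>j<n. esz (en d' j))" "insert j X \<subseteq> {..<n}" using d assms(3) by auto
  thus ?thesis unfolding d'_def[symmetric] dinv_def using cnt mcl um X en by simp
next
  case False
  note d = dinvD[OF assms(1)]
  define y where "y = dmin d j"
  have urk: "ur d = k" "um d = 0" using d False by auto
  have sub: "ins d \<subseteq> {..<n}" using dinvD(4)[OF assms(1)] .
  have fin: "finite (ins d)" using dinvD(3)[OF assms(1)] .
  note y = dmin[OF sub, where j = j, folded y_def]
  have yX: "y \<in> insert j X" "y < n" using y(1) d assms(3) by auto
  have eq: "dins j d = d\<lparr>ins := insert j (ins d) - {y}, mc := (mc d)(j := mc d y),
         fl := max (fl d) (r j) + p y / hm, sm := sm d + p y,
         en := (en d)(j := Some y), ky := (ky d)(y := r j + k * p y)\<rparr>"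
    using False by (simp add: dins_def y_def Let_def)
  have enj: "en d j = None" using d(13) assms(2) by (metis option.exhaust)
  \<comment> \<open>No job is evicted twice: the entries of \<open>en\<close> lie outside the slots,
    whereas \<open>y\<close> is a slot job or new.\<close>
  have ny: "en d i \<noteq> Some y" for i using d(13) y(1) assms(2) by metis
  have card: "card {l \<in> insert j (ins d) - {y}. ((mc d)(j := mc d y)) l = i} = k" if "i < m" for i
  proof (cases "y = j")
    case True
    hence "{l \<in> insert j (ins d) - {y}. ((mc d)(j := mc d y)) l = i} = {l \<in> ins d. mc d l = i}"
      using assms(2) d by auto
    thus ?thesis using d urk that by auto
  next
    case yj: False
    hence yin: "y \<in> ins d" using y by auto
    show ?thesis
    proof (cases "mc d y = i")
      case True
      have "{l \<in> insert j (ins d) - {y}. ((mc d)(j := mc d y)) l = i} =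
          insert j ({l \<in> ins d. mc d l = i} - {y})"
        using True yj assms(2) d by auto
      moreover have "card (insert j ({l \<in> ins d. mc d l = i} - {y})) = card {l \<in> ins d. mc d l = i}"
      proof -
        let ?A = "{l \<in> ins d. mc d l = i}"
        have "finite ?A" "y \<in> ?A" "j \<notin> ?A - {y}" using fin yin True assms(2) d(1) by auto
        thus ?thesis using card_Suc_Diff1[of ?A y] by simp
      qed
      ultimately show ?thesis using d urk that by auto
    next
      case False
      have "{l \<in> insert j (ins d) - {y}. ((mc d)(j := mc d y)) l = i} = {l \<in> ins d. mc d l = i}"
        using False yj assms(2) d by auto
      thus ?thesis using d urk that by auto
    qed
  qed
  have mcl: "((mc d)(j := mc d y)) l < m" if "l \<in> insert j (ins d) - {y}" for l
    using that y(1) d by auto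
  have out: "ur d = k \<and> (\<forall>l\<in>insert j (ins d) - {y}. p x \<le> p l) \<and> (\<exists>i. ((en d)(j := Some y)) i = Some x)"
    if "x \<in> insert j X - (insert j (ins d) - {y})" for x
  proof (cases "x = y")
    case True thus ?thesis using urk y by auto
  next
    case xy: False
    hence x: "x \<in> X - ins d" using that by auto
    then obtain i where i: "en d i = Some x" using d(12) by blast
    have "\<forall>l\<in>insert j (ins d) - {y}. p x \<le> p l"
    proof (cases "y = j")
      case True thus ?thesis using x d(11) by blast
    next
      case False
      hence "p x \<le> p y" using y(1) x d(11) by blast
      hence "p x \<le> p j" using y(2) by linarith
      thus ?thesis using x d(11) by blast
    qed
    moreover have "i \<noteq> j" using i enj by auto
    ultimately show ?thesis using i urk by auto
  qed
  have ents: "i \<in> insert j X \<and> x \<in> insert j X - (insert j (ins d) - {y}) \<and> p x \<le> p i \<and>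
      ((ky d)(y := r j + k * p y)) x = r i + k * p x"
    if "((en d)(j := Some y)) i = Some x" for i x
  proof (cases "i = j")
    case True thus ?thesis using that y yX by auto
  next
    case False
    hence e: "en d i = Some x" using that by simp
    hence "x \<noteq> y" using ny by auto
    with d(13)[OF e] show ?thesis using assms(2) by auto
  qed
  have "(\<Sum>i<n. esz (((en d)(j := Some y)) i)) = sm d + p y"
    using d(14) enj assms(3)
    by (subst sum_upd[where a = j and f = "\<lambda>i. esz (en d i)"]) (auto simp: esz_def)
  moreover have "insert j (ins d) - {y} \<subseteq> insert j X" "insert j X \<subseteq> {..<n}"
    using d assms(3) by auto
  ultimately show ?thesis
    using urk card out ents mcl m_pos unfolding eq dinv_def by simp
qed

lemma card_machine_le: "dinv X d \<Longrightarrow> i < m \<Longrightarrow> card {l \<in> ins d. mc d l = i} \<le> k"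
  using dinvD(7-9)[of X d] by (cases "ur d = k") force+

lemma card_full:
  assumes "dinv X d" "ur d = k"
  shows "card (ins d) = m * k"
proof -
  note d = dinvD[OF assms(1)]
  have "ins d = (\<Union>i<m. {l \<in> ins d. mc d l = i})" using d(5) by auto
  hence "card (ins d) = card (\<Union>i<m. {l \<in> ins d. mc d l = i})" by simp
  also have "\<dots> = (\<Sum>i<m. card {l \<in> ins d. mc d l = i})"
    using d(3) by (intro card_UN_disjoint) auto
  also have "\<dots> = (\<Sum>i<m. k)" using d(8,9) assms(2) by (intro sum.cong) auto
  finally show ?thesis by simp
qed

text \<open>All \<open>m * k\<close> slots are full and hold jobs at least as large as
  \<open>x\<close>.\<close>

lemma evicted_size:
  assumes "dinv X d" "x \<in> X" "x \<notin> ins d"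
  shows "real m * real k * p x \<le> P"
proof -
  note d = dinvD[OF assms(1)]
  have "real m * real k * p x = (\<Sum>l\<in>ins d. p x)"
    using card_full[OF assms(1) d(10)[OF assms(2,3)]] by simp
  also have "\<dots> \<le> (\<Sum>l\<in>ins d. p l)" using d(11) assms by (intro sum_mono) blast
  also have "\<dots> \<le> P" unfolding P_def
    using d(4) p_pos by (intro sum_mono2) (auto intro: less_imp_le)
  finally show ?thesis .
qed

section \<open>The slots as a function of time\<close>

definition ord :: "nat list" where "ord = sort_key r [0..<n]"
definition dfin :: dconf where "dfin = fold dins ord d0"
text \<open>A round at time \<open>t\<close> begins with the slots \<open>before t\<close>, and its
  insertions lead to \<open>after t\<close>.\<close>

definition before :: "real \<Rightarrow> dconf" where
  "before t = fold dins (filter (\<lambda>j. r j < t) ord) d0"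
definition after :: "real \<Rightarrow> dconf" where
  "after t = fold dins (filter (\<lambda>j. r j \<le> t) ord) d0"

lemma ord_simps [simp]: "set ord = {..<n}" "distinct ord" "sorted (map r ord)"
  by (auto simp: ord_def)

lemma dinv_fold:
  "distinct xs \<Longrightarrow> set xs \<subseteq> {..<n} \<Longrightarrow> dinv (set xs) (fold dins xs d0)"
proof (induction xs rule: rev_induct)
  case Nil thus ?case using dinv_d0 by simp
next
  case (snoc x xs) thus ?case using dinv_dins[of "set xs" "fold dins xs d0" x] by simp
qed

lemma en_dins: "i \<noteq> j \<Longrightarrow> en (dins j d) i = en d i"
  by (simp add: dins_def Let_def)

lemma en_fold: "i \<notin> set ys \<Longrightarrow> en (fold dins ys d) i = en d i"
  by (induction ys arbitrary: d) (auto simp: en_dins)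

lemma sorted_split:
  "sorted (map f xs) \<Longrightarrow> xs = filter (\<lambda>x. f x < t) xs @ filter (\<lambda>x. \<not> f x < t) xs"
proof (induction xs)
  case (Cons x xs)
  show ?case
  proof (cases "f x < t")
    case False
    hence "filter (\<lambda>x. f x < t) (x # xs) = []" "filter (\<lambda>x. \<not> f x < t) (x # xs) = x # xs"
      using Cons.prems by (auto simp: filter_empty_conv filter_id_conv)
    thus ?thesis by simp
  qed (use Cons in auto)
qed simp

lemma after_split: "ord = filter (\<lambda>j. r j \<le> t) ord @ filter (\<lambda>j. \<not> r j \<le> t) ord"
proof -
  have "sorted (map r xs) \<Longrightarrow> xs = filter (\<lambda>j. r j \<le> t) xs @ filter (\<lambda>j. \<not> r j \<le> t) xs" for xs
  proof (induction xs)
    case (Cons x xs)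
    show ?case
    proof (cases "r x \<le> t")
      case False
      hence "filter (\<lambda>x. r x \<le> t) (x # xs) = []" "filter (\<lambda>x. \<not> r x \<le> t) (x # xs) = x # xs"
        using Cons.prems by (auto simp: filter_empty_conv filter_id_conv)
      thus ?thesis by simp
    qed (use Cons in auto)
  qed simp
  thus ?thesis by simp
qed

text \<open>\<open>sort_key\<close> is stable, so jobs with the same release time stand in
  \<open>ord\<close> in the order of their names, which is the order in which a round inserts
  them.\<close>

lemma after_before: "after t = fold dins (filter (\<lambda>j. r j = t) [0..<n]) (before t)"
proof -
  have "filter (\<lambda>j. r j \<le> t) ord = filter (\<lambda>j. r j < t) (filter (\<lambda>j. r j \<le> t) ord) @
      filter (\<lambda>j. \<not> r j < t) (filter (\<lambda>j. r j \<le> t) ord)"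
    by (rule sorted_split) (simp add: sorted_filter)
  also have "filter (\<lambda>j. r j < t) (filter (\<lambda>j. r j \<le> t) ord) = filter (\<lambda>j. r j < t) ord"
    by (auto intro: filter_cong)
  also have "filter (\<lambda>j. \<not> r j < t) (filter (\<lambda>j. r j \<le> t) ord) = filter (\<lambda>j. r j = t) ord"
    by (auto intro: filter_cong)
  also have "filter (\<lambda>j. r j = t) ord = filter (\<lambda>j. r j = t) [0..<n]"
    unfolding ord_def by (rule sort_key_stable)
  finally show ?thesis by (simp add: after_def before_def)
qed

text \<open>The eviction caused by \<open>j\<close> is recorded under \<open>j\<close> and never
  overwritten. So every intermediate state of the slots can be read off from
  \<open>dfin\<close>.\<close>

lemma prefix_facts:
  assumes "ord = xs @ ys"
  shows "dinv (set xs) (fold dins xs d0)"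
    "en (fold dins xs d0) j = (if j \<in> set xs then en dfin j else None)"
    "sm (fold dins xs d0) = (\<Sum>j<n. if j \<in> set xs then esz (en dfin j) else 0)"
proof -
  have xs: "distinct xs" "set xs \<subseteq> {..<n}" "set xs \<inter> set ys = {}"
    using ord_simps(1,2) unfolding assms by auto
  show 1: "dinv (set xs) (fold dins xs d0)" using dinv_fold xs by blast
  have 2: "en (fold dins xs d0) j = (if j \<in> set xs then en dfin j else None)" for j
  proof (cases "j \<in> set xs")
    case True
    hence "j \<notin> set ys" using xs(3) by auto
    thus ?thesis using True en_fold[of j ys "fold dins xs d0"] by (simp add: dfin_def assms)
  next
    case False
    thus ?thesis using dinvD(13)[OF 1, of j] by (metis option.exhaust)
  qed
  show "en (fold dins xs d0) j = (if j \<in> set xs then en dfin j else None)" by (rule 2)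
  show "sm (fold dins xs d0) = (\<Sum>j<n. if j \<in> set xs then esz (en dfin j) else 0)"
    unfolding dinvD(14)[OF 1] 2 by (intro sum.cong) (auto simp: esz_def)
qed

section \<open>Evicted volume, fluid idle time and machine capacity\<close>

definition esd :: "nat \<Rightarrow> real" where "esd j = esz (en dfin j)"
definition sd :: "real \<Rightarrow> real" where "sd t = (\<Sum>j<n. if r j < t then esd j else 0)"
definition sdle :: "real \<Rightarrow> real" where "sdle t = (\<Sum>j<n. if r j \<le> t then esd j else 0)"

text \<open>By reflection, \<open>Zd t\<close> is the idle time of the fluid up to time \<open>t\<close>; it does not depend
  on the random numbers.\<close>

definition Zd :: "real \<Rightarrow> real" where "Zd t = (SUP w\<in>{0..t}. w - sd w / hm)"

lemma after_facts:
  "dinv {j. j < n \<and> r j \<le> t} (after t)" "sm (after t) = sdle t"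
  using prefix_facts(1,3)[OF after_split[of t]]
  by (auto simp: after_def sdle_def esd_def intro!: sum.cong)

lemma dinv_dfin: "dinv {..<n} dfin"
  using prefix_facts(1)[of ord "[]"] by (simp add: dfin_def)

lemma esd_nonneg: "0 \<le> esd j" and esd_le: "j < n \<Longrightarrow> esd j \<le> p j"
  using dinvD(13)[OF dinv_dfin, of j] p_pos[of j] p_pos
  by (auto simp: esd_def esz_def split: option.splits intro: less_imp_le)

lemma sd_nonneg: "0 \<le> sd t" and sd_mono: "t \<le> u \<Longrightarrow> sd t \<le> sd u"
  unfolding sd_def using esd_nonneg by (auto intro!: sum_nonneg sum_mono)

lemma Zd_bdd: "bdd_above ((\<lambda>w. w - sd w / hm) ` {0..t})"
proof (rule bdd_aboveI2)
  fix w assume "w \<in> {0..t}"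
  thus "w - sd w / hm \<le> t" using sd_nonneg[of w] hm_pos by (simp add: add_increasing2 diff_le_eq)
qed

lemma Zd_upper: "0 \<le> w \<Longrightarrow> w \<le> t \<Longrightarrow> w - sd w / hm \<le> Zd t"
  unfolding Zd_def by (rule cSUP_upper[OF _ Zd_bdd]) auto

lemma Zd_least: "0 \<le> t \<Longrightarrow> (\<And>w. 0 \<le> w \<Longrightarrow> w \<le> t \<Longrightarrow> w - sd w / hm \<le> z) \<Longrightarrow> Zd t \<le> z"
  unfolding Zd_def by (rule cSUP_least) auto

lemma Zd_mono: "0 \<le> t \<Longrightarrow> t \<le> u \<Longrightarrow> Zd t \<le> Zd u"
  by (rule Zd_least) (auto intro: Zd_upper)

lemma Zd_lip: "0 \<le> t \<Longrightarrow> t \<le> u \<Longrightarrow> Zd u \<le> Zd t + (u - t)"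
proof (rule Zd_least)
  fix w assume *: "0 \<le> t" "t \<le> u" "0 \<le> w" "w \<le> u"
  show "w - sd w / hm \<le> Zd t + (u - t)"
  proof (cases "w \<le> t")
    case True thus ?thesis using Zd_upper[of w t] * by simp
  next
    case False
    hence "sd t / hm \<le> sd w / hm" using sd_mono[of t w] by (intro divide_right_mono) auto
    thus ?thesis using Zd_upper[of t t] * by simp
  qed
qed auto

lemma Zd_0: "Zd 0 = 0"
proof -
  have "sd 0 = 0" unfolding sd_def using r_nonneg by (intro sum.neutral) force
  thus ?thesis using Zd_upper[of 0 0] Zd_least[of 0 0] by force
qed

text \<open>After \<open>t\<close> and up to \<open>u\<close> the evicted volume is constant, so on
  this stretch the supremum is attained at the right end.\<close>

lemma Zd_step:
  assumes "0 \<le> t" "t < u" "\<And>j. j < n \<Longrightarrow> t < r j \<Longrightarrow> u \<le> r j"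
  shows "Zd u = max (Zd t) (u - sdle t / hm)"
proof -
  have sd: "sd w = sdle t" if "t < w" "w \<le> u" for w
    unfolding sd_def sdle_def using assms(3) that by (intro sum.cong) force+
  show ?thesis
  proof (rule antisym)
    show "Zd u \<le> max (Zd t) (u - sdle t / hm)"
    proof (rule Zd_least)
      fix w assume "0 \<le> w" "w \<le> u"
      thus "w - sd w / hm \<le> max (Zd t) (u - sdle t / hm)"
        using Zd_upper[of w t] sd[of w] by (cases "w \<le> t") auto
    qed (use assms in auto)
    show "max (Zd t) (u - sdle t / hm) \<le> Zd u"
      using Zd_mono[of t u] Zd_upper[of u u] sd[of u] assms by auto
  qed
qed

text \<open>The volume of evictions triggered from time \<open>u\<close> on whose deadline is at most \<open>\<kappa>\<close>.\<close>

definition A :: "dconf \<Rightarrow> real \<Rightarrow> real \<Rightarrow> real" where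
  "A d \<kappa> u = (\<Sum>j<n. if u \<le> r j \<and> r j + k * esz (en d j) \<le> \<kappa> then esz (en d j) else 0)"

lemma A_prefix:
  assumes "ord = xs @ ys"
  shows "A (fold dins xs d0) \<kappa> u \<le> A dfin \<kappa> u"
  unfolding A_def prefix_facts(2)[OF assms]
  using esd_nonneg by (intro sum_mono) (auto simp: esz_def esd_def)

text \<open>If every job \<open>j\<close> has a part of size \<open>e j\<close> that is due \<open>k * e j\<close> after its release,
  then the parts due until \<open>\<kappa>\<close> exceed the capacity of the machines only by the parts
  that are late, and these are paid for by the flow time \<open>V\<close>.\<close>

definition capacity :: "real \<Rightarrow> bool" where
  "capacity V \<longleftrightarrow> (\<forall>(u::real) \<kappa> (e :: nat \<Rightarrow> real). 0 \<le> u \<longrightarrow> u \<le> \<kappa> \<longrightarrow>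
      (\<forall>j<n. 0 \<le> e j \<and> e j \<le> p j) \<longrightarrow>
      (\<Sum>j<n. if u \<le> r j \<and> r j + k * e j \<le> \<kappa> then e j else 0) \<le> m * (\<kappa> - u) + V / k)"

text \<open>The volume due and the idle capacity of the fluid fit together into the machines. For a
  point \<open>w\<close> after \<open>u\<close> of the supremum \<open>Zd \<kappa>\<close>,
  evictions triggered before \<open>w\<close> are part of the growth of \<open>sd\<close>, which
  lowers the idle time, and those from \<open>w\<close> on are bounded by \<open>capacity\<close> on
  the interval from \<open>w\<close> to \<open>\<kappa>\<close>. The rest is
  \<open>hm \<le> m\<close>.\<close>

lemma A_capacity:
  fixes u \<kappa> :: real
  assumes cap: "capacity V" and "0 \<le> u" "u \<le> \<kappa>"
  shows "A dfin \<kappa> u + hm * (Zd \<kappa> - Zd u) \<le> m * (\<kappa> - u) + V / k"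
proof -
  have A: "A dfin \<kappa> w \<le> m * (\<kappa> - w) + V / k" if "0 \<le> w" "w \<le> \<kappa>" for w :: real
    using cap[unfolded capacity_def, rule_format, OF that, of esd] esd_nonneg esd_le
    unfolding A_def esd_def[symmetric] by blast
  have "Zd \<kappa> \<le> Zd u + (m * (\<kappa> - u) + V / k - A dfin \<kappa> u) / hm"
  proof (rule Zd_least)
    fix w assume w: "0 \<le> w" "w \<le> \<kappa>"
    show "w - sd w / hm \<le> Zd u + (m * (\<kappa> - u) + V / k - A dfin \<kappa> u) / hm"
    proof (cases "w \<le> u")
      case True
      have "0 \<le> (m * (\<kappa> - u) + V / k - A dfin \<kappa> u) / hm" using A[of u] assms by simp
      thus ?thesis using Zd_upper[of w u] w True by linarith
    next
      case False
      \<comment> \<open>Evictions triggered between \<open>u\<close> and \<open>w\<close> count in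
        \<open>sd w - sd u\<close> whatever their deadline is.\<close>
      have "A dfin \<kappa> u \<le> (sd w - sd u) + A dfin \<kappa> w"
        unfolding A_def sd_def sum_subtractf[symmetric] sum.distrib[symmetric] esd_def[symmetric]
        using False esd_nonneg by (intro sum_mono) auto
      also have "\<dots> \<le> sd w - sd u + m * (\<kappa> - w) + V / k" using A[OF w] by simp
      finally have "hm * (w - u) + sd u - sd w \<le> m * (\<kappa> - u) + V / k - A dfin \<kappa> u"
        using False hm_le mult_right_mono[of "real hm" "real m" "w - u"]
        by (simp add: algebra_simps)
      hence "(hm * (w - u) + sd u - sd w) / hm \<le> (m * (\<kappa> - u) + V / k - A dfin \<kappa> u) / hm"
        by (rule divide_right_mono) simp
      moreover have "(hm * (w - u) + sd u - sd w) / hm = (w - u) + sd u / hm - sd w / hm"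
        using hm_pos by (simp add: field_simps)
      ultimately show ?thesis using Zd_upper[of u u] assms by simp
    qed
  qed (use assms in auto)
  thus ?thesis using hm_pos by (simp add: field_simps)
qed

end


section \<open>The algorithm as a state machine\<close>

text \<open>
  Status \<open>st\<close>: 0 not yet seen, 1 counting down in a slot, 2 claiming its machine, 3 queued after
  an eviction, 4 started. A job has counted \<open>qc\<close> periods and \<open>dd\<close> is left of the current
  one; \<open>bl\<close> is the remaining time for which a machine is blocked and \<open>bu\<close> the time until
  which it is busy. \<open>pend i = Suc l\<close> if \<open>l\<close> claims machine \<open>i\<close>, and 0 without a claim.
  Only the analysis uses \<open>fz\<close>, the fluid idle time at which a job fired, and \<open>xt\<close>, the
  time at which it stopped counting.
\<close>

record conf =
  dc :: dconf
  tm :: real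
  st :: "nat \<Rightarrow> nat"
  qc :: "nat \<Rightarrow> nat"
  dd :: "nat \<Rightarrow> real"
  bl :: "nat \<Rightarrow> real"
  pend :: "nat \<Rightarrow> nat"
  bu :: "nat \<Rightarrow> real"
  sch :: nonpreemptive
  fz :: "nat \<Rightarrow> real option"
  xt :: "nat \<Rightarrow> real"

context flow
begin

text \<open>The time up to \<open>tm\<close> during which the fluid was idle.\<close>

definition Zc :: "conf \<Rightarrow> real" where
  "Zc c = max (tm c) (fl (dc c)) - sm (dc c) / hm"

definition c0 :: conf where
  "c0 = \<lparr>dc = d0, tm = 0, st = \<lambda>_. 0, qc = \<lambda>_. 0, dd = \<lambda>_. 0, bl = \<lambda>_. 0, pend = \<lambda>_. 0,
     bu = \<lambda>_. 0, sch = Map.empty, fz = \<lambda>_. None, xt = \<lambda>_. 0\<rparr>"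

text \<open>An evicted job is queued only if it is still counting down; \<open>j\<close> itself
  counts as such. A job that has fired stays with its claim or its start, although
  \<open>dins\<close> removes it from the slots.\<close>

definition insj :: "nat \<Rightarrow> conf \<Rightarrow> conf" where
  "insj j c =
    (if st c j = 0 \<and> r j \<le> tm c then
       let y = dmin (dc c) j; st' = (st c)(j := 1) in
       if ur (dc c) < k then c\<lparr>dc := dins j (dc c), st := st'\<rparr>
       else if st' y = 1
         then c\<lparr>dc := dins j (dc c), st := st'(y := 3), xt := (xt c)(y := tm c)\<rparr>
         else c\<lparr>dc := dins j (dc c), st := st'\<rparr>
     else c)"

text \<open>A job enters with \<open>dd = 0\<close>, so \<open>R l = 0\<close> means that it fires
  without waiting for a period; in general \<open>R l\<close> full periods pass.\<close>

definition tick :: "(nat \<Rightarrow> nat) \<Rightarrow> nat \<Rightarrow> conf \<Rightarrow> conf" where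
  "tick R l c =
    (if st c l = 1 \<and> fl (dc c) \<le> tm c \<and> bl c (mc (dc c) l) \<le> 0 \<and> dd c l \<le> 0 then
       if qc c l = R l
       then c\<lparr>st := (st c)(l := 2), bl := (bl c)(mc (dc c) l := 4 * p l),
              pend := (pend c)(mc (dc c) l := Suc l), fz := (fz c)(l := Some (Zc c)),
              xt := (xt c)(l := tm c)\<rparr>
       else c\<lparr>qc := (qc c)(l := Suc (qc c l)), dd := (dd c)(l := p l)\<rparr>
     else c)"

text \<open>As in \<open>pend\<close>, job \<open>l\<close> is represented by \<open>Suc l\<close>, and 0 stands for no job.\<close>

definition best :: "conf \<Rightarrow> nat" where
  "best c = fold (\<lambda>l b. if st c l = 3 \<and> (b = 0 \<or> ky (dc c) l < ky (dc c) (b - 1)) then Suc l else b)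
     [0..<n] 0"

definition starti :: "nat \<Rightarrow> conf \<Rightarrow> conf" where
  "starti i c =
    (if bu c i \<le> tm c then
       let b = (if pend c i = 0 then best c else pend c i) in
       if b = 0 then c
       else c\<lparr>st := (st c)(b - 1 := 4), bu := (bu c)(i := tm c + p (b - 1)),
              pend := (pend c)(i := 0), sch := (sch c)(b - 1 \<mapsto> (i, tm c))\<rparr>
     else c)"

text \<open>In the disjuncts on \<open>bl\<close> and \<open>bu\<close> the index names a machine.
  As \<open>m \<le> n\<close> all machines are covered, and from \<open>m\<close> on both entries
  are 0 and give no time after \<open>tm c\<close>.\<close>

definition cset :: "conf \<Rightarrow> real set" where
  "cset c = {x. tm c < x \<and> (x = fl (dc c) \<or>
     fl (dc c) \<le> tm c \<and> (\<exists>l<n. x = tm c + bl c l) \<or>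
     fl (dc c) \<le> tm c \<and> (\<exists>l<n. st c l = 1 \<and> bl c (mc (dc c) l) \<le> 0 \<and> x = tm c + dd c l) \<or>
     (\<exists>l<n. x = bu c l))}"

definition wtime :: "conf \<Rightarrow> real" where
  "wtime c = (if cset c = {} then next_release J (tm c) else wait_until J (tm c) (Min (cset c)))"

definition wait :: "conf \<Rightarrow> conf" where
  "wait c =
    (let t' = wtime c; dt = t' - tm c in
     if fl (dc c) \<le> tm c
     then c\<lparr>tm := t',
            dd := (\<lambda>l. if st c l = 1 \<and> bl c (mc (dc c) l) \<le> 0 then dd c l - dt else dd c l),
            bl := (\<lambda>i. if 0 < bl c i then bl c i - dt else bl c i)\<rparr>
     else c\<lparr>tm := t'\<rparr>)"

definition body :: "(nat \<Rightarrow> nat) \<Rightarrow> conf \<Rightarrow> conf" where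
  "body R c = wait (fold starti [0..<m] (fold (tick R) [0..<n] (fold insj [0..<n] c)))"

lemma best:
  "best c = 0 \<Longrightarrow> l < n \<Longrightarrow> st c l \<noteq> 3"
  "best c \<noteq> 0 \<Longrightarrow> best c - 1 < n \<and> st c (best c - 1) = 3 \<and>
     (\<forall>l<n. st c l = 3 \<longrightarrow> ky (dc c) (best c - 1) \<le> ky (dc c) l)"
proof -
  define g where "g = (\<lambda>l b. if st c l = 3 \<and> (b = 0 \<or> ky (dc c) l < ky (dc c) (b - 1)) then Suc l else b)"
  have "(fold g [0..<i] 0 = 0 \<longrightarrow> (\<forall>l<i. st c l \<noteq> 3)) \<and>
    (fold g [0..<i] 0 \<noteq> 0 \<longrightarrow> fold g [0..<i] 0 - 1 < i \<and> st c (fold g [0..<i] 0 - 1) = 3 \<and>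
     (\<forall>l<i. st c l = 3 \<longrightarrow> ky (dc c) (fold g [0..<i] 0 - 1) \<le> ky (dc c) l))" for i
  proof (induction i)
    case (Suc i)
    define b where "b = fold g [0..<i] 0"
    have "fold g [0..<Suc i] 0 = g i b" by (simp add: b_def)
    thus ?case using Suc unfolding b_def[symmetric]
      by (auto simp: g_def less_Suc_eq)
  qed simp
  from this[of n] show "best c = 0 \<Longrightarrow> l < n \<Longrightarrow> st c l \<noteq> 3"
    "best c \<noteq> 0 \<Longrightarrow> best c - 1 < n \<and> st c (best c - 1) = 3 \<and>
     (\<forall>l<n. st c l = 3 \<longrightarrow> ky (dc c) (best c - 1) \<le> ky (dc c) l)"
    unfolding best_def g_def by auto
qed

lemma finite_future: "finite (future_releases J t)"
  by (simp add: future_releases_def)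

lemma finite_cset: "finite (cset c)"
proof (rule finite_subset)
  show "cset c \<subseteq> insert (fl (dc c)) ((\<lambda>l. tm c + bl c l) ` {..<n} \<union> (\<lambda>l. tm c + dd c l) ` {..<n} \<union>
      bu c ` {..<n})"
    by (auto simp: cset_def)
qed auto

lemma wtime_facts:
  shows wtime_ge: "tm c \<le> wtime c"
    and wtime_release: "\<And>j. j < n \<Longrightarrow> tm c < r j \<Longrightarrow> wtime c \<le> r j"
    and wtime_cand: "\<And>x. x \<in> cset c \<Longrightarrow> wtime c \<le> x"
    and wtime_strict: "cset c \<noteq> {} \<or> (\<exists>j<n. tm c < r j) \<Longrightarrow> tm c < wtime c"
    and wtime_cases: "tm c < wtime c \<Longrightarrow> wtime c \<in> cset c \<or> (\<exists>j<n. wtime c = r j)"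
proof -
  let ?f = "future_releases J (tm c)"
  have f: "x \<in> ?f \<longleftrightarrow> (\<exists>j<n. tm c < r j \<and> x = r j)" for x
    by (auto simp: future_releases_def)
  have "tm c \<le> wtime c \<and> (\<forall>x\<in>?f. wtime c \<le> x) \<and> (\<forall>x\<in>cset c. wtime c \<le> x) \<and>
    (cset c \<noteq> {} \<or> ?f \<noteq> {} \<longrightarrow> tm c < wtime c) \<and>
    (tm c < wtime c \<longrightarrow> wtime c \<in> cset c \<or> wtime c \<in> ?f)"
  proof (cases "cset c = {}")
    case True
    show ?thesis
    proof (cases "?f = {}")
      case False
      hence "wtime c = Min ?f" "Min ?f \<in> ?f"
        using True finite_future by (auto simp: wtime_def next_release_def)
      moreover have "\<forall>x\<in>?f. Min ?f \<le> x" using finite_future by simp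
      ultimately show ?thesis using True f[of "wtime c"] by auto
    qed (use True in \<open>auto simp: wtime_def next_release_def\<close>)
  next
    case False
    let ?m = "Min (cset c)"
    have m: "?m \<in> cset c" "\<forall>x\<in>cset c. ?m \<le> x" using False finite_cset by auto
    hence mt: "tm c < ?m" by (auto simp: cset_def)
    have w: "wtime c = Min (insert ?m ?f)" using False mt by (simp add: wtime_def wait_until_def)
    have "wtime c \<in> insert ?m ?f" "\<forall>x\<in>insert ?m ?f. wtime c \<le> x"
      unfolding w using finite_future Min_in[of "insert ?m ?f"] by (auto simp del: Min_insert)
    thus ?thesis using m mt f[of "wtime c"] by auto
  qed
  thus "tm c \<le> wtime c" "\<And>j. j < n \<Longrightarrow> tm c < r j \<Longrightarrow> wtime c \<le> r j"
    "\<And>x. x \<in> cset c \<Longrightarrow> wtime c \<le> x"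
    "cset c \<noteq> {} \<or> (\<exists>j<n. tm c < r j) \<Longrightarrow> tm c < wtime c"
    "tm c < wtime c \<Longrightarrow> wtime c \<in> cset c \<or> (\<exists>j<n. wtime c = r j)"
    using f by blast+
qed

lemma dins_simps:
  "l \<noteq> j \<Longrightarrow> mc (dins j d) l = mc d l"
  "l \<in> ins (dins j d) \<Longrightarrow> l = j \<or> l \<in> ins d"
  "ur d < k \<Longrightarrow> ins (dins j d) = insert j (ins d) \<and> fl (dins j d) = fl d \<and> sm (dins j d) = sm d \<and>
     en (dins j d) = en d \<and> ky (dins j d) = ky d"
  "\<not> ur d < k \<Longrightarrow> ins (dins j d) = insert j (ins d) - {dmin d j} \<and>
     fl (dins j d) = max (fl d) (r j) + p (dmin d j) / hm \<and> sm (dins j d) = sm d + p (dmin d j) \<and>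
     en (dins j d) = (en d)(j := Some (dmin d j)) \<and>
     ky (dins j d) = (ky d)(dmin d j := r j + k * p (dmin d j)) \<and> ur (dins j d) = ur d"
  by (auto simp: dins_def Let_def split: if_splits)

definition rem :: "conf \<Rightarrow> nat \<Rightarrow> real" where
  "rem c i = max 0 (bu c i - tm c) + (if pend c i = 0 then 0 else p (pend c i - 1))"

text \<open>The heart is the clause on \<open>rem\<close>: the work left on a machine is at most
  half of its blocking time, unless no claim waits there and the machine is idle or runs an evicted
  job, which is no larger than any slot job. Hence an unblocked machine has no claim, and a claim
  starts within its own length, as the clauses on \<open>xt\<close> record. The clause on positive
  \<open>bl\<close> names the job behind a blocking and its firing time in fluid idle time.\<close>

definition invA :: "(nat \<Rightarrow> nat) \<Rightarrow> conf \<Rightarrow> bool" where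
  "invA R c \<longleftrightarrow>
    dinv {l. st c l \<noteq> 0} (dc c) \<and>
    (\<forall>l. st c l \<le> 4) \<and>
    (\<forall>l. st c l = 1 \<longrightarrow> l \<in> ins (dc c) \<and> fz c l = None) \<and>
    (\<forall>l. st c l = 2 \<longrightarrow> pend c (mc (dc c) l) = Suc l \<and> fz c l \<noteq> None) \<and>
    (\<forall>i. pend c i \<noteq> 0 \<longrightarrow> i < m \<and> st c (pend c i - 1) = 2 \<and> mc (dc c) (pend c i - 1) = i \<and>
       tm c \<le> xt c (pend c i - 1) + p (pend c i - 1) \<and>
       bu c i \<le> xt c (pend c i - 1) + p (pend c i - 1)) \<and>
    (\<forall>l. st c l = 3 \<longrightarrow> fz c l = None) \<and>
    (\<forall>l. st c l = 0 \<longrightarrow> fz c l = None \<and> qc c l = 0 \<and> dd c l = 0) \<and>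
    (\<forall>l. qc c l \<le> R l \<and> 0 \<le> dd c l) \<and>
    (\<forall>i. 0 \<le> bl c i \<and> (m \<le> i \<longrightarrow> bl c i = 0 \<and> bu c i = 0)) \<and>
    (\<forall>i. 0 < bl c i \<longrightarrow> (\<exists>l \<zeta>. l < n \<and> fz c l = Some \<zeta> \<and> mc (dc c) l = i \<and>
       Zc c - \<zeta> = 4 * p l - bl c i \<and> \<zeta> \<le> Zc c)) \<and>
    (\<forall>i<m. rem c i \<le> bl c i / 2 \<or> pend c i = 0 \<and> (rem c i = 0 \<or>
       ur (dc c) = k \<and> (\<forall>l\<in>ins (dc c). rem c i \<le> p l) \<and> m * k * rem c i \<le> P)) \<and>
    (\<forall>l. st c l \<noteq> 0 \<longrightarrow> r l \<le> tm c) \<and> 0 \<le> tm c \<and>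
    (\<forall>l<n. st c l = 0 \<longrightarrow> tm c \<le> r l) \<and>
    (\<forall>l. (sch c l = None) = (st c l \<noteq> 4)) \<and>
    (\<forall>l i s. sch c l = Some (i, s) \<longrightarrow> i < m \<and> r l \<le> s \<and> s + p l \<le> bu c i \<and>
       (fz c l \<noteq> None \<longrightarrow> s \<le> xt c l + p l)) \<and>
    (\<forall>l l' i s s'. l \<noteq> l' \<longrightarrow> sch c l = Some (i, s) \<longrightarrow> sch c l' = Some (i, s') \<longrightarrow>
       s + p l \<le> s' \<or> s' + p l' \<le> s) \<and>
    (\<forall>l. st c l = 3 \<or> st c l = 4 \<and> fz c l = None \<longrightarrow>
       l \<notin> ins (dc c) \<and> ky (dc c) l \<le> xt c l + k * p l)"

text \<open>The projections in the order of the conjuncts, cited below as \<open>a(1)\<close> to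
  \<open>a(18)\<close>.\<close>

lemmas invAD =
  invA_def[THEN iffD1, THEN conjunct1, rule_format]
  invA_def[THEN iffD1, THEN conjunct2, THEN conjunct1, rule_format]
  invA_def[THEN iffD1, THEN conjunct2, THEN conjunct2, THEN conjunct1, rule_format]
  invA_def[THEN iffD1, THEN conjunct2, THEN conjunct2, THEN conjunct2, THEN conjunct1, rule_format]
  invA_def[THEN iffD1, THEN conjunct2, THEN conjunct2, THEN conjunct2, THEN conjunct2, THEN conjunct1, rule_format]
  invA_def[THEN iffD1, THEN conjunct2, THEN conjunct2, THEN conjunct2, THEN conjunct2, THEN conjunct2, THEN conjunct1, rule_format]
  invA_def[THEN iffD1, THEN conjunct2, THEN conjunct2, THEN conjunct2, THEN conjunct2, THEN conjunct2, THEN conjunct2, THEN conjunct1, rule_format]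
  invA_def[THEN iffD1, THEN conjunct2, THEN conjunct2, THEN conjunct2, THEN conjunct2, THEN conjunct2, THEN conjunct2, THEN conjunct2, THEN conjunct1, rule_format]
  invA_def[THEN iffD1, THEN conjunct2, THEN conjunct2, THEN conjunct2, THEN conjunct2, THEN conjunct2, THEN conjunct2, THEN conjunct2, THEN conjunct2, THEN conjunct1, rule_format]
  invA_def[THEN iffD1, THEN conjunct2, THEN conjunct2, THEN conjunct2, THEN conjunct2, THEN conjunct2, THEN conjunct2, THEN conjunct2, THEN conjunct2, THEN conjunct2, THEN conjunct1, rule_format]
  invA_def[THEN iffD1, THEN conjunct2, THEN conjunct2, THEN conjunct2, THEN conjunct2, THEN conjunct2, THEN conjunct2, THEN conjunct2, THEN conjunct2, THEN conjunct2, THEN conjunct2, THEN conjunct1, rule_format]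
  invA_def[THEN iffD1, THEN conjunct2, THEN conjunct2, THEN conjunct2, THEN conjunct2, THEN conjunct2, THEN conjunct2, THEN conjunct2, THEN conjunct2, THEN conjunct2, THEN conjunct2, THEN conjunct2, THEN conjunct1, rule_format]
  invA_def[THEN iffD1, THEN conjunct2, THEN conjunct2, THEN conjunct2, THEN conjunct2, THEN conjunct2, THEN conjunct2, THEN conjunct2, THEN conjunct2, THEN conjunct2, THEN conjunct2, THEN conjunct2, THEN conjunct2, THEN conjunct1, rule_format]
  invA_def[THEN iffD1, THEN conjunct2, THEN conjunct2, THEN conjunct2, THEN conjunct2, THEN conjunct2, THEN conjunct2, THEN conjunct2, THEN conjunct2, THEN conjunct2, THEN conjunct2, THEN conjunct2, THEN conjunct2, THEN conjunct2, THEN conjunct1, rule_format]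
  invA_def[THEN iffD1, THEN conjunct2, THEN conjunct2, THEN conjunct2, THEN conjunct2, THEN conjunct2, THEN conjunct2, THEN conjunct2, THEN conjunct2, THEN conjunct2, THEN conjunct2, THEN conjunct2, THEN conjunct2, THEN conjunct2, THEN conjunct2, THEN conjunct1, rule_format]
  invA_def[THEN iffD1, THEN conjunct2, THEN conjunct2, THEN conjunct2, THEN conjunct2, THEN conjunct2, THEN conjunct2, THEN conjunct2, THEN conjunct2, THEN conjunct2, THEN conjunct2, THEN conjunct2, THEN conjunct2, THEN conjunct2, THEN conjunct2, THEN conjunct2, THEN conjunct1, rule_format]
  invA_def[THEN iffD1, THEN conjunct2, THEN conjunct2, THEN conjunct2, THEN conjunct2, THEN conjunct2, THEN conjunct2, THEN conjunct2, THEN conjunct2, THEN conjunct2, THEN conjunct2, THEN conjunct2, THEN conjunct2, THEN conjunct2, THEN conjunct2, THEN conjunct2, THEN conjunct2, THEN conjunct1, rule_format]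
  invA_def[THEN iffD1, THEN conjunct2, THEN conjunct2, THEN conjunct2, THEN conjunct2, THEN conjunct2, THEN conjunct2, THEN conjunct2, THEN conjunct2, THEN conjunct2, THEN conjunct2, THEN conjunct2, THEN conjunct2, THEN conjunct2, THEN conjunct2, THEN conjunct2, THEN conjunct2, THEN conjunct2, rule_format]

lemma invAI:
  assumes "dinv {l. st c l \<noteq> 0} (dc c)"
    "\<And>l. st c l \<le> 4"
    "\<And>l. st c l = 1 \<Longrightarrow> l \<in> ins (dc c) \<and> fz c l = None"
    "\<And>l. st c l = 2 \<Longrightarrow> pend c (mc (dc c) l) = Suc l \<and> fz c l \<noteq> None"
    "\<And>i. pend c i \<noteq> 0 \<Longrightarrow> i < m \<and> st c (pend c i - 1) = 2 \<and> mc (dc c) (pend c i - 1) = i \<and>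
       tm c \<le> xt c (pend c i - 1) + p (pend c i - 1) \<and>
       bu c i \<le> xt c (pend c i - 1) + p (pend c i - 1)"
    "\<And>l. st c l = 3 \<Longrightarrow> fz c l = None"
    "\<And>l. st c l = 0 \<Longrightarrow> fz c l = None \<and> qc c l = 0 \<and> dd c l = 0"
    "\<And>l. qc c l \<le> R l \<and> 0 \<le> dd c l"
    "\<And>i. 0 \<le> bl c i \<and> (m \<le> i \<longrightarrow> bl c i = 0 \<and> bu c i = 0)"
    "\<And>i. 0 < bl c i \<Longrightarrow> \<exists>l \<zeta>. l < n \<and> fz c l = Some \<zeta> \<and> mc (dc c) l = i \<and>
       Zc c - \<zeta> = 4 * p l - bl c i \<and> \<zeta> \<le> Zc c"
    "\<And>i. i < m \<Longrightarrow> rem c i \<le> bl c i / 2 \<or> pend c i = 0 \<and> (rem c i = 0 \<or>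
       ur (dc c) = k \<and> (\<forall>l\<in>ins (dc c). rem c i \<le> p l) \<and> m * k * rem c i \<le> P)"
    "\<And>l. st c l \<noteq> 0 \<Longrightarrow> r l \<le> tm c" "0 \<le> tm c"
    "\<And>l. l < n \<Longrightarrow> st c l = 0 \<Longrightarrow> tm c \<le> r l"
    "\<And>l. (sch c l = None) = (st c l \<noteq> 4)"
    "\<And>l i s. sch c l = Some (i, s) \<Longrightarrow> i < m \<and> r l \<le> s \<and> s + p l \<le> bu c i \<and>
       (fz c l \<noteq> None \<longrightarrow> s \<le> xt c l + p l)"
    "\<And>l l' i s s'. l \<noteq> l' \<Longrightarrow> sch c l = Some (i, s) \<Longrightarrow> sch c l' = Some (i, s') \<Longrightarrow>
       s + p l \<le> s' \<or> s' + p l' \<le> s"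
    "\<And>l. st c l = 3 \<or> st c l = 4 \<and> fz c l = None \<Longrightarrow>
       l \<notin> ins (dc c) \<and> ky (dc c) l \<le> xt c l + k * p l"
  shows "invA R c"
  apply (insert assms)
  apply atomize
  apply (unfold invA_def)
  apply ((assumption | rule conjI)+)
  done

lemma invA_c0: "invA R c0"
  by (rule invAI) (use dinv_d0 r_nonneg in \<open>auto simp: c0_def rem_def\<close>)

end


section \<open>Preservation of the invariant by the steps of a round\<close>

context flow
begin

lemma insj_eqs:
  fixes c j
  defines "c' \<equiv> insj j c" and "y \<equiv> dmin (dc c) j"
  assumes act: "st c j = 0" "r j \<le> tm c"
  shows "dc c' = dins j (dc c)" "tm c' = tm c" "qc c' = qc c" "dd c' = dd c" "bl c' = bl c"
    "pend c' = pend c" "bu c' = bu c" "sch c' = sch c" "fz c' = fz c"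
    "l \<noteq> j \<Longrightarrow> st c' l = st c l \<or> st c' l = 3 \<and> st c l = 1 \<and> l = y \<and> \<not> ur (dc c) < k"
    "st c' j = 1 \<or> st c' j = 3 \<and> y = j \<and> \<not> ur (dc c) < k"
    "st c l \<noteq> 1 \<Longrightarrow> l \<noteq> j \<Longrightarrow> xt c' l = xt c l"
    "st c' l = 3 \<Longrightarrow> st c l = 1 \<or> l = j \<Longrightarrow> xt c' l = tm c \<and> l = y \<and> \<not> ur (dc c) < k"
    "st c' y = 1 \<Longrightarrow> ur (dc c) < k"
    "st c' l \<noteq> 3 \<Longrightarrow> xt c' l = xt c l"
  using act unfolding c'_def y_def by (auto simp: insj_def Let_def split: if_splits)

lemma insj_id: "\<not> (st c j = 0 \<and> r j \<le> tm c) \<Longrightarrow> insj j c = c"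
  by (auto simp: insj_def)

text \<open>An eviction at time \<open>t\<close> prolongs the busy period by exactly the new volume
  divided by the rate, which leaves the idle time unchanged.\<close>

lemma dins_Z:
  assumes "r j = t" "ins d \<subseteq> {..<n}" "j < n"
  shows "max t (fl (dins j d)) - sm (dins j d) / hm = max t (fl d) - sm d / hm"
proof (cases "ur d < k")
  case False
  have "dmin d j < n" using dmin(1)[OF assms(2), of j] assms by auto
  hence "0 \<le> p (dmin d j) / hm" using p_pos by (simp add: less_imp_le)
  thus ?thesis using dins_simps(4)[OF False] assms by (auto simp: add_divide_distrib max_def)
qed (use dins_simps(3) in auto)

lemma insj_invA:
  assumes "invA R c" "j < n"
  shows "invA R (insj j c)"
proof (cases "st c j = 0 \<and> r j \<le> tm c")
  case False thus ?thesis using insj_id assms by simp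
next
  case True
  note a = invAD[OF assms(1)]
  note e = insj_eqs[OF conjunct1[OF True] conjunct2[OF True]]
  have tm: "r j = tm c" using a(14)[of j] True assms(2) by simp
  let ?d = "dc c" let ?y = "dmin (dc c) j" let ?c = "insj j c"
  note D = dinvD[OF a(1)]
  have jX: "j \<notin> ins ?d" using D(1) True by auto
  have X: "{l. st ?c l \<noteq> 0} = insert j {l. st c l \<noteq> 0}"
  proof -
    have "st ?c l \<noteq> 0 \<longleftrightarrow> l = j \<or> st c l \<noteq> 0" for l
      using e(10)[of l] e(11) by (cases "l = j") auto
    thus ?thesis by auto
  qed
  have dinv: "dinv {l. st ?c l \<noteq> 0} (dc ?c)"
    unfolding X e(1) using dinv_dins[OF a(1) _ assms(2)] True by simp
  note D' = dinvD[OF dinv]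
  have Z: "Zc ?c = Zc c" unfolding Zc_def e(1,2) using dins_Z[OF tm D(4) assms(2)] .
  have mc: "l \<noteq> j \<Longrightarrow> mc (dc ?c) l = mc ?d l" for l using dins_simps(1) e(1) by simp
  have ym: "?y = j \<or> ?y \<in> ins ?d" "p ?y \<le> p j" "\<And>l. l \<in> ins ?d \<Longrightarrow> p ?y \<le> p l"
    using dmin[OF D(4)] by blast+
  have rem: "rem ?c = rem c" by (auto simp: rem_def e fun_eq_iff)
  have fz0: "fz c j = None" using a(7) True by blast
  show ?thesis
  proof (rule invAI)
    show "st ?c l \<le> 4" for l using e(10)[of l] e(11) a(2)[of l] by (cases "l = j") auto
    show "l \<in> ins (dc ?c) \<and> fz ?c l = None" if "st ?c l = 1" for l
    proof -
      have "l \<in> ins ?d \<or> l = j" "fz c l = None"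
        using e(10)[of l] that a(3)[of l] fz0 by (cases "l = j"; auto)+
      moreover have "l \<noteq> ?y \<or> ur ?d < k" using e(14) that by auto
      ultimately show ?thesis using dins_simps(3,4)[of ?d j] e by auto
    qed
    show "pend ?c (mc (dc ?c) l) = Suc l \<and> fz ?c l \<noteq> None" if "st ?c l = 2" for l
    proof -
      have "l \<noteq> j" using e(11) that by auto
      moreover have "st c l = 2" using e(10)[of l] that \<open>l \<noteq> j\<close> by auto
      ultimately show ?thesis using a(4) mc e by auto
    qed
    show "i < m \<and> st ?c (pend ?c i - 1) = 2 \<and> mc (dc ?c) (pend ?c i - 1) = i \<and>
       tm ?c \<le> xt ?c (pend ?c i - 1) + p (pend ?c i - 1) \<and>
       bu ?c i \<le> xt ?c (pend ?c i - 1) + p (pend ?c i - 1)" if "pend ?c i \<noteq> 0" for i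
    proof -
      let ?l = "pend c i - 1"
      have p: "pend c i \<noteq> 0" using that e by simp
      note h = a(5)[OF this]
      have "?l \<noteq> j" using h True by auto
      moreover have "st ?c ?l = 2" using e(10)[OF \<open>?l \<noteq> j\<close>] h by auto
      ultimately show ?thesis using h mc e(12)[of ?l] e by auto
    qed
    show "fz ?c l = None" if "st ?c l = 3" for l
      using that e(9) e(10)[of l] a(3,6)[of l] fz0 by (cases "l = j") auto
    show "fz ?c l = None \<and> qc ?c l = 0 \<and> dd ?c l = 0" if "st ?c l = 0" for l
    proof -
      have "l \<notin> insert j {l. st c l \<noteq> 0}" using that unfolding X[symmetric] by simp
      hence "st c l = 0" by simp
      thus ?thesis using a(7)[of l] e(3,4,9) by simp
    qed
    show "qc ?c l \<le> R l \<and> 0 \<le> dd ?c l" for l using a(8) e by simp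
    show "0 \<le> bl ?c i \<and> (m \<le> i \<longrightarrow> bl ?c i = 0 \<and> bu ?c i = 0)" for i using a(9) e by simp
    show "\<exists>l \<zeta>. l < n \<and> fz ?c l = Some \<zeta> \<and> mc (dc ?c) l = i \<and>
       Zc ?c - \<zeta> = 4 * p l - bl ?c i \<and> \<zeta> \<le> Zc ?c" if "0 < bl ?c i" for i
    proof -
      obtain l \<zeta> where l: "l < n" "fz c l = Some \<zeta>" "mc ?d l = i"
        "Zc c - \<zeta> = 4 * p l - bl c i" "\<zeta> \<le> Zc c" using a(10)[of i] \<open>0 < bl ?c i\<close> e by auto
      moreover have "l \<noteq> j" using l fz0 by auto
      ultimately show ?thesis using mc Z e by auto
    qed
    show "rem ?c i \<le> bl ?c i / 2 \<or> pend ?c i = 0 \<and> (rem ?c i = 0 \<or>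
       ur (dc ?c) = k \<and> (\<forall>l\<in>ins (dc ?c). rem ?c i \<le> p l) \<and> m * k * rem ?c i \<le> P)"
      if i: "i < m" for i
    proof (cases "rem c i \<le> bl c i / 2 \<or> pend c i = 0 \<and> rem c i = 0")
      case True thus ?thesis unfolding rem e(5,6) by blast
    next
      case False
      hence h: "pend c i = 0" "ur ?d = k" "\<forall>l\<in>ins ?d. rem c i \<le> p l" "m * k * rem c i \<le> P"
        using a(11)[OF i] by auto
      hence u: "\<not> ur ?d < k" by simp
      \<comment> \<open>A newcomer that stays is at least as large as the job it evicts. That job
        came from a slot and so was at least \<open>rem c i\<close>.\<close>
      have "rem c i \<le> p l" if l: "l \<in> ins (dc ?c)" for l
      proof (cases "l = j")
        case True
        hence "?y \<noteq> j" using l dins_simps(4)[OF u, of j] e(1) by auto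
        hence "rem c i \<le> p ?y" using ym(1) h(3) by blast
        thus ?thesis using ym(2) True by simp
      next
        case False
        thus ?thesis using l dins_simps(2)[of l j ?d] e(1) h(3) by auto
      qed
      thus ?thesis using h rem e dins_simps(4)[OF u, of j] by simp
    qed
    show "r l \<le> tm ?c" if "st ?c l \<noteq> 0" for l
    proof -
      have "l \<in> insert j {l. st c l \<noteq> 0}" using that unfolding X[symmetric] by simp
      thus ?thesis using a(12)[of l] True e(2) by auto
    qed
    show "0 \<le> tm ?c" using a(13) e by simp
    show "tm ?c \<le> r l" if "l < n" "st ?c l = 0" for l
    proof -
      have "l \<notin> insert j {l. st c l \<noteq> 0}" using that unfolding X[symmetric] by simp
      thus ?thesis using that a(14)[of l] e(2) by auto
    qed
    show "(sch ?c l = None) = (st ?c l \<noteq> 4)" for l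
      using a(15)[of l] True e(8) e(10)[of l] e(11) by (cases "l = j") auto
    show "i < m \<and> r l \<le> s \<and> s + p l \<le> bu ?c i \<and> (fz ?c l \<noteq> None \<longrightarrow> s \<le> xt ?c l + p l)"
      if "sch ?c l = Some (i, s)" for l i s
    proof -
      have s: "sch c l = Some (i, s)" using that e by simp
      hence "st c l = 4" using a(15)[of l] by auto
      moreover hence "l \<noteq> j" using True by auto
      ultimately have "xt ?c l = xt c l" using e(12)[of l] by auto
      thus ?thesis using a(16)[OF s] e by simp
    qed
    show "s + p l \<le> s' \<or> s' + p l' \<le> s"
      if "l \<noteq> l'" "sch ?c l = Some (i, s)" "sch ?c l' = Some (i, s')" for l l' i s s'
      using a(17) that e by simp
    show "l \<notin> ins (dc ?c) \<and> ky (dc ?c) l \<le> xt ?c l + k * p l"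
      if l: "st ?c l = 3 \<or> st ?c l = 4 \<and> fz ?c l = None" for l
    proof (cases "st c l = 1 \<or> l = j")
      case True
      hence "st ?c l = 3" using l e(10)[of l] e(11) by (cases "l = j") auto
      with e(13)[OF this True] have "xt ?c l = tm c" "l = ?y" "\<not> ur ?d < k" by auto
      thus ?thesis using dins_simps(4)[of ?d j] e(1) tm by simp
    next
      case False
      hence s: "st c l = 3 \<or> st c l = 4 \<and> fz c l = None" using l e(9) e(10)[of l] by auto
      note b = a(18)[OF s]
      have "l \<noteq> ?y" using b ym(1) False by auto
      hence "ky (dc ?c) l = ky ?d l"
        using dins_simps(3,4)[of ?d j] e(1) by (cases "ur ?d < k") auto
      moreover have "l \<notin> ins (dc ?c)" using b False dins_simps(2)[of l j ?d] e(1) by auto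
      moreover have "xt ?c l = xt c l" using e(12)[of l] False by auto
      ultimately show ?thesis using b by simp
    qed
  qed (rule dinv)
qed

text \<open>When \<open>l\<close> fires its machine is unblocked, so no claim waits there and at
  most \<open>p l\<close> of an evicted job is left. With the new claim this makes at most
  \<open>2 * p l\<close>, half of the new blocking time.\<close>

lemma tick_invA:
  assumes "invA R c" "l < n"
  shows "invA R (tick R l c)"
proof (cases "st c l = 1 \<and> fl (dc c) \<le> tm c \<and> bl c (mc (dc c) l) \<le> 0 \<and> dd c l \<le> 0")
  case False thus ?thesis using assms by (auto simp: tick_def)
next
  case act: True
  note a = invAD[OF assms(1)]
  let ?i = "mc (dc c) l"
  have pl: "0 < p l" using p_pos assms by auto
  have lin: "l \<in> ins (dc c)" "fz c l = None" using a(3) act by auto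
  have im: "?i < m" using dinvD(5)[OF a(1) lin(1)] .
  have b0: "bl c ?i = 0" using a(9)[of ?i] act by auto
  show ?thesis
  proof (cases "qc c l = R l")
    case False
    let ?c = "tick R l c"
    have sel: "dc ?c = dc c" "tm ?c = tm c" "st ?c = st c" "qc ?c = (qc c)(l := Suc (qc c l))"
      "dd ?c = (dd c)(l := p l)" "bl ?c = bl c" "pend ?c = pend c" "bu ?c = bu c"
      "sch ?c = sch c" "fz ?c = fz c" "xt ?c = xt c"
      using act False by (simp_all add: tick_def)
    have q: "Suc (qc c l) \<le> R l" using a(8)[of l] False by simp
    have sel2: "rem ?c = rem c" "Zc ?c = Zc c"
      by (auto simp: rem_def Zc_def fun_eq_iff sel)
    have n1: "\<forall>l'. (st c l' = 0 \<longrightarrow> fz c l' = None \<and> ((qc c)(l := Suc (qc c l))) l' = 0 \<and> ((dd c)(l := p l)) l' = 0)"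
      using a(7) act by auto
    have n2: "\<forall>l'. ((qc c)(l := Suc (qc c l))) l' \<le> R l' \<and> 0 \<le> ((dd c)(l := p l)) l'"
      using a(8) q pl by auto
    show ?thesis using assms(1) n1 n2 unfolding invA_def sel sel2
      by (elim conjE) ((assumption | rule conjI)+)
  next
    case True
    let ?c = "tick R l c"
    have sel: "dc ?c = dc c" "tm ?c = tm c" "st ?c = (st c)(l := 2)" "qc ?c = qc c"
      "dd ?c = dd c" "bl ?c = (bl c)(?i := 4 * p l)" "pend ?c = (pend c)(?i := Suc l)"
      "bu ?c = bu c" "sch ?c = sch c" "fz ?c = (fz c)(l := Some (Zc c))" "xt ?c = (xt c)(l := tm c)"
      using act True by (simp_all add: tick_def)
    have Z: "Zc ?c = Zc c" by (auto simp: Zc_def sel)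
    have p0: "pend c ?i = 0"
    proof (rule ccontr)
      assume "pend c ?i \<noteq> 0"
      moreover have "st c (pend c ?i - 1) \<noteq> 0" using a(5)[OF calculation] by simp
      hence "pend c ?i - 1 < n" using dinvD(2)[OF a(1)] by auto
      ultimately show False using a(11)[OF im] b0 p_pos[of "pend c ?i - 1"] by (auto simp: rem_def)
    qed
    have ri: "rem c ?i \<le> p l" using a(11)[OF im] b0 pl lin(1) by auto
    have bul: "bu c ?i \<le> tm c + p l" using ri p0 by (auto simp: rem_def)
    have st0: "(((st c)(l := 2)) l' = 0) = (st c l' = 0)" for l' using act by auto
    show ?thesis
    proof (rule invAI, unfold sel Z st0)
      show "dinv {l. st c l \<noteq> 0} (dc c)" by (rule a(1))
      show "((st c)(l := 2)) l' \<le> 4" for l' using a(2) by auto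
      show "l' \<in> ins (dc c) \<and> ((fz c)(l := Some (Zc c))) l' = None" if "((st c)(l := 2)) l' = 1" for l'
        using that a(3)[of l'] by (auto split: if_splits)
      show "((pend c)(?i := Suc l)) (mc (dc c) l') = Suc l' \<and> ((fz c)(l := Some (Zc c))) l' \<noteq> None"
        if "((st c)(l := 2)) l' = 2" for l'
        using that a(4)[of l'] p0 by (auto split: if_splits)
      show "i < m \<and> ((st c)(l := 2)) (((pend c)(?i := Suc l)) i - 1) = 2 \<and>
         mc (dc c) (((pend c)(?i := Suc l)) i - 1) = i \<and>
         tm c \<le> ((xt c)(l := tm c)) (((pend c)(?i := Suc l)) i - 1) + p (((pend c)(?i := Suc l)) i - 1) \<and>
         bu c i \<le> ((xt c)(l := tm c)) (((pend c)(?i := Suc l)) i - 1) + p (((pend c)(?i := Suc l)) i - 1)"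
        if "((pend c)(?i := Suc l)) i \<noteq> 0" for i
      proof (cases "i = ?i")
        case True thus ?thesis using im pl bul by simp
      next
        case False
        hence "pend c i \<noteq> 0" using that by simp
        moreover have "pend c i - 1 \<noteq> l" using a(5)[OF calculation] act by auto
        ultimately show ?thesis using a(5)[of i] False by simp
      qed
      show "((fz c)(l := Some (Zc c))) l' = None" if "((st c)(l := 2)) l' = 3" for l'
        using that a(6)[of l'] by (auto split: if_splits)
      show "((fz c)(l := Some (Zc c))) l' = None \<and> qc c l' = 0 \<and> dd c l' = 0" if "st c l' = 0" for l'
        using that a(7)[of l'] act by auto
      show "qc c l' \<le> R l' \<and> 0 \<le> dd c l'" for l' by (rule a(8))
      show "0 \<le> ((bl c)(?i := 4 * p l)) i \<and> (m \<le> i \<longrightarrow> ((bl c)(?i := 4 * p l)) i = 0 \<and> bu c i = 0)" for i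
        using a(9)[of i] pl im by auto
      show "\<exists>l' \<zeta>. l' < n \<and> ((fz c)(l := Some (Zc c))) l' = Some \<zeta> \<and> mc (dc c) l' = i \<and>
         Zc c - \<zeta> = 4 * p l' - ((bl c)(?i := 4 * p l)) i \<and> \<zeta> \<le> Zc c"
        if pos: "0 < ((bl c)(?i := 4 * p l)) i" for i
      proof (cases "i = ?i")
        case True thus ?thesis using assms(2) by (intro exI[of _ l] exI[of _ "Zc c"]) auto
      next
        case False
        then obtain l' \<zeta> where "l' < n" "fz c l' = Some \<zeta>" "mc (dc c) l' = i"
          "Zc c - \<zeta> = 4 * p l' - bl c i" "\<zeta> \<le> Zc c" using a(10)[of i] pos by auto
        thus ?thesis using False lin(2) by (intro exI[of _ l'] exI[of _ \<zeta>]) auto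
      qed
      show "rem ?c i \<le> ((bl c)(?i := 4 * p l)) i / 2 \<or> ((pend c)(?i := Suc l)) i = 0 \<and> (rem ?c i = 0 \<or>
         ur (dc c) = k \<and> (\<forall>l\<in>ins (dc c). rem ?c i \<le> p l) \<and> m * k * rem ?c i \<le> P)" if "i < m" for i
      proof (cases "i = ?i")
        case True
        have "rem ?c i = rem c i + p l" using True p0 by (simp add: rem_def sel)
        thus ?thesis using True ri by simp
      next
        case False
        hence "rem ?c i = rem c i" by (simp add: rem_def sel)
        thus ?thesis using a(11)[OF that] False by simp
      qed
      show "r l' \<le> tm c" if "st c l' \<noteq> 0" for l' using a(12) that .
      show "0 \<le> tm c" by (rule a(13))
      show "tm c \<le> r l'" if "l' < n" "st c l' = 0" for l' using a(14) that .
      show "(sch c l' = None) = (((st c)(l := 2)) l' \<noteq> 4)" for l' using a(15)[of l'] act by auto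
      show "i < m \<and> r l' \<le> s \<and> s + p l' \<le> bu c i \<and>
         (((fz c)(l := Some (Zc c))) l' \<noteq> None \<longrightarrow> s \<le> ((xt c)(l := tm c)) l' + p l')"
        if "sch c l' = Some (i, s)" for l' i s
        using a(16)[OF that] a(15)[of l'] that act by auto
      show "s + p l1 \<le> s' \<or> s' + p l2 \<le> s"
        if "l1 \<noteq> l2" "sch c l1 = Some (i, s)" "sch c l2 = Some (i, s')" for l1 l2 i s s'
        using a(17) that by blast
      show "l' \<notin> ins (dc c) \<and> ky (dc c) l' \<le> ((xt c)(l := tm c)) l' + k * p l'"
        if "((st c)(l := 2)) l' = 3 \<or> ((st c)(l := 2)) l' = 4 \<and> ((fz c)(l := Some (Zc c))) l' = None" for l'
        using that a(18)[of l'] by (auto split: if_splits)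
    qed
  qed
qed

text \<open>Starting a claim only moves its length inside \<open>rem\<close> from the claim to the
  busy time. Starting a queued job leads to the last alternative of the clause on
  \<open>rem\<close>, by \<open>evicted_size\<close>.\<close>

lemma starti_invA:
  assumes "invA R c" "i < m"
  shows "invA R (starti i c)"
proof -
  note a = invAD[OF assms(1)]
  define b where "b = (if pend c i = 0 then best c else pend c i)"
  show ?thesis
  proof (cases "bu c i \<le> tm c \<and> b \<noteq> 0")
    case False thus ?thesis using assms by (auto simp: starti_def b_def[symmetric] Let_def)
  next
    case True
    let ?c = "starti i c"
    define j where "j = b - 1"
    have sel: "dc ?c = dc c" "tm ?c = tm c" "st ?c = (st c)(j := 4)" "qc ?c = qc c"
      "dd ?c = dd c" "bl ?c = bl c" "pend ?c = (pend c)(i := 0)"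
      "bu ?c = (bu c)(i := tm c + p j)" "sch ?c = (sch c)(j \<mapsto> (i, tm c))" "fz ?c = fz c" "xt ?c = xt c"
      using True by (simp_all add: starti_def b_def[symmetric] Let_def j_def)
    have Z: "Zc ?c = Zc c" by (auto simp: Zc_def sel)
    have j: "pend c i = Suc j \<and> st c j = 2 \<or> pend c i = 0 \<and> st c j = 3"
    proof (cases "pend c i = 0")
      case True
      thus ?thesis using best(2)[of c] \<open>_ \<and> b \<noteq> 0\<close> by (auto simp: b_def j_def)
    next
      case False
      thus ?thesis using a(5)[OF False] by (auto simp: b_def j_def)
    qed
    have "j \<in> {l. st c l \<noteq> 0}" using j by auto
    hence jn: "j < n" using dinvD(2)[OF a(1)] by blast
    have pj: "0 < p j" using p_pos jn by auto
    have st0: "(((st c)(j := 4)) l = 0) = (st c l = 0)" for l using j by auto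
    have remi: "rem ?c i = p j" using pj by (simp add: rem_def sel)
    show ?thesis
    proof (rule invAI, unfold sel Z st0)
      show "dinv {l. st c l \<noteq> 0} (dc c)" by (rule a(1))
      show "((st c)(j := 4)) l \<le> 4" for l using a(2) by auto
      show "l \<in> ins (dc c) \<and> fz c l = None" if "((st c)(j := 4)) l = 1" for l
        using that a(3)[of l] by (auto split: if_splits)
      show "((pend c)(i := 0)) (mc (dc c) l) = Suc l \<and> fz c l \<noteq> None" if "((st c)(j := 4)) l = 2" for l
        using that a(4)[of l] j by (auto split: if_splits)
      show "i' < m \<and> ((st c)(j := 4)) (((pend c)(i := 0)) i' - 1) = 2 \<and>
         mc (dc c) (((pend c)(i := 0)) i' - 1) = i' \<and>
         tm c \<le> xt c (((pend c)(i := 0)) i' - 1) + p (((pend c)(i := 0)) i' - 1) \<and>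
         ((bu c)(i := tm c + p j)) i' \<le> xt c (((pend c)(i := 0)) i' - 1) + p (((pend c)(i := 0)) i' - 1)"
        if "((pend c)(i := 0)) i' \<noteq> 0" for i'
      proof -
        have i': "i' \<noteq> i" "pend c i' \<noteq> 0" using that by (auto split: if_splits)
        have "pend c i' - 1 \<noteq> j" using a(5)[OF i'(2)] j a(5)[of i] i'(1) by auto
        thus ?thesis using a(5)[OF i'(2)] i' by auto
      qed
      show "fz c l = None" if "((st c)(j := 4)) l = 3" for l
        using that a(6)[of l] by (auto split: if_splits)
      show "fz c l = None \<and> qc c l = 0 \<and> dd c l = 0" if "st c l = 0" for l
        using that a(7)[of l] by auto
      show "qc c l \<le> R l \<and> 0 \<le> dd c l" for l by (rule a(8))
      show "0 \<le> bl c i' \<and> (m \<le> i' \<longrightarrow> bl c i' = 0 \<and> ((bu c)(i := tm c + p j)) i' = 0)" for i'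
        using a(9)[of i'] assms(2) by auto
      show "\<exists>l \<zeta>. l < n \<and> fz c l = Some \<zeta> \<and> mc (dc c) l = i' \<and>
         Zc c - \<zeta> = 4 * p l - bl c i' \<and> \<zeta> \<le> Zc c" if "0 < bl c i'" for i'
        using a(10)[OF that] .
      show "rem ?c i' \<le> bl c i' / 2 \<or> ((pend c)(i := 0)) i' = 0 \<and> (rem ?c i' = 0 \<or>
         ur (dc c) = k \<and> (\<forall>l\<in>ins (dc c). rem ?c i' \<le> p l) \<and> m * k * rem ?c i' \<le> P)" if "i' < m" for i'
      proof (cases "i' = i")
        case False
        hence "rem ?c i' = rem c i'" by (simp add: rem_def sel)
        thus ?thesis using a(11)[OF that] False by simp
      next
        case i: True
        show ?thesis
        proof (cases "pend c i = 0")
          case True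
          hence s3: "st c j = 3" using j by auto
          have "j \<in> {l. st c l \<noteq> 0}" "j \<notin> ins (dc c)" using s3 a(18)[of j] by auto
          thus ?thesis using i remi evicted_size[OF a(1)] dinvD(10,11)[OF a(1)] by auto
        next
          case False
          hence "rem c i \<ge> p j" using j by (auto simp: rem_def)
          thus ?thesis using i remi a(11)[OF that] False by auto
        qed
      qed
      show "r l \<le> tm c" if "st c l \<noteq> 0" for l using a(12) that .
      show "0 \<le> tm c" by (rule a(13))
      show "tm c \<le> r l" if "l < n" "st c l = 0" for l using a(14) that .
      show "(((sch c)(j \<mapsto> (i, tm c))) l = None) = (((st c)(j := 4)) l \<noteq> 4)" for l
        using a(15)[of l] by auto
      show "i' < m \<and> r l \<le> s \<and> s + p l \<le> ((bu c)(i := tm c + p j)) i' \<and>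
         (fz c l \<noteq> None \<longrightarrow> s \<le> xt c l + p l)"
        if l: "((sch c)(j \<mapsto> (i, tm c))) l = Some (i', s)" for l i' s
      proof (cases "l = j")
        case True
        hence "s = tm c" "i' = i" using l by auto
        moreover have "fz c j \<noteq> None \<longrightarrow> tm c \<le> xt c j + p j"
          using j a(6)[of j] a(5)[of i] by auto
        ultimately show ?thesis using True assms(2) a(12)[of j] j by auto
      next
        case False
        hence "sch c l = Some (i', s)" using l by simp
        note b = a(16)[OF this]
        show ?thesis using b True pj by (auto split: if_splits)
      qed
      show "s + p l1 \<le> s' \<or> s' + p l2 \<le> s"
        if l: "l1 \<noteq> l2" "((sch c)(j \<mapsto> (i, tm c))) l1 = Some (i', s)"
          "((sch c)(j \<mapsto> (i, tm c))) l2 = Some (i', s')" for l1 l2 i' s s'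
      proof -
        consider "l1 = j" | "l2 = j" | "l1 \<noteq> j" "l2 \<noteq> j" by blast
        thus ?thesis
        proof cases
          case 1
          hence "sch c l2 = Some (i', s')" "i' = i" "s = tm c" using l by auto
          thus ?thesis using a(16)[of l2 i' s'] True by auto
        next
          case 2
          hence "sch c l1 = Some (i', s)" "i' = i" "s' = tm c" using l by auto
          thus ?thesis using a(16)[of l1 i' s] True by auto
        next
          case 3 thus ?thesis using l a(17)[OF l(1)] by simp
        qed
      qed
      show "l \<notin> ins (dc c) \<and> ky (dc c) l \<le> xt c l + k * p l"
        if "((st c)(j := 4)) l = 3 \<or> ((st c)(j := 4)) l = 4 \<and> fz c l = None" for l
        using that a(18)[of l] j a(4)[of j] by (auto split: if_splits)
    qed
  qed
qed


lemma fold_upt_inv: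
  assumes "Q c" "\<And>i c. i < b \<Longrightarrow> Q c \<Longrightarrow> Q (f i c)"
  shows "Q (fold f [0..<b] c)"
proof -
  have "i \<le> b \<Longrightarrow> Q (fold f [0..<i] c)" for i
    by (induction i) (use assms in auto)
  thus ?thesis by simp
qed

text \<open>This and the next two predicates describe a round that is about to wait. They ensure
  that no machine with work, no countdown and no release is passed over while waiting.\<close>

definition started_ok :: "conf \<Rightarrow> bool" where
  "started_ok c \<longleftrightarrow> (\<forall>i<m. tm c < bu c i \<or> pend c i = 0 \<and> (\<forall>l. st c l \<noteq> 3))"

definition ticked_ok :: "conf \<Rightarrow> bool" where
  "ticked_ok c \<longleftrightarrow> (\<forall>l. st c l = 1 \<longrightarrow> fl (dc c) \<le> tm c \<longrightarrow> bl c (mc (dc c) l) \<le> 0 \<longrightarrow> 0 < dd c l)"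

definition seen_ok :: "conf \<Rightarrow> bool" where
  "seen_ok c \<longleftrightarrow> (\<forall>l<n. st c l = 0 \<longrightarrow> tm c < r l)"

lemma wait_eqs:
  "dc (wait c) = dc c" "tm (wait c) = wtime c" "st (wait c) = st c" "qc (wait c) = qc c"
  "dd (wait c) = (\<lambda>l. if fl (dc c) \<le> tm c \<and> st c l = 1 \<and> bl c (mc (dc c) l) \<le> 0
     then dd c l - (wtime c - tm c) else dd c l)"
  "bl (wait c) = (\<lambda>i. if fl (dc c) \<le> tm c \<and> 0 < bl c i then bl c i - (wtime c - tm c) else bl c i)"
  "pend (wait c) = pend c" "bu (wait c) = bu c" "sch (wait c) = sch c" "fz (wait c) = fz c"
  "xt (wait c) = xt c"
  by (auto simp: wait_def Let_def)

text \<open>A wait that begins with a busy fluid ends by \<open>fl\<close>, so the fluid is either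
  idle throughout a wait or busy throughout.\<close>

lemma wait_Z: "Zc (wait c) = Zc c + (if fl (dc c) \<le> tm c then wtime c - tm c else 0)"
proof (cases "fl (dc c) \<le> tm c")
  case True thus ?thesis using wtime_ge[of c] by (simp add: Zc_def wait_eqs)
next
  case False
  hence "fl (dc c) \<in> cset c" by (auto simp: cset_def)
  hence "wtime c \<le> fl (dc c)" by (rule wtime_cand)
  thus ?thesis using False by (simp add: Zc_def wait_eqs)
qed

lemma wait_bounds:
  "fl (dc c) \<le> tm c \<Longrightarrow> 0 < bl c i \<Longrightarrow> i < n \<Longrightarrow> wtime c - tm c \<le> bl c i"
  "fl (dc c) \<le> tm c \<Longrightarrow> st c l = 1 \<Longrightarrow> bl c (mc (dc c) l) \<le> 0 \<Longrightarrow> 0 < dd c l \<Longrightarrow> l < n \<Longrightarrow>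
    wtime c - tm c \<le> dd c l"
  "tm c < bu c i \<Longrightarrow> i < n \<Longrightarrow> wtime c \<le> bu c i"
proof -
  show "wtime c - tm c \<le> bl c i" if "fl (dc c) \<le> tm c" "0 < bl c i" "i < n"
  proof -
    have "tm c + bl c i \<in> cset c" unfolding cset_def using that by force
    from wtime_cand[OF this] show ?thesis by simp
  qed
  show "wtime c - tm c \<le> dd c l"
    if "fl (dc c) \<le> tm c" "st c l = 1" "bl c (mc (dc c) l) \<le> 0" "0 < dd c l" "l < n"
  proof -
    have "tm c + dd c l \<in> cset c" unfolding cset_def using that by force
    from wtime_cand[OF this] show ?thesis by simp
  qed
  show "wtime c \<le> bu c i" if "tm c < bu c i" "i < n"
    using that by (intro wtime_cand) (auto simp: cset_def)
qed

text \<open>A busy machine loses \<open>rem\<close> at full rate and \<open>bl\<close> at most at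
  full rate, so \<open>rem \<le> bl / 2\<close> survives, also while the fluid stops
  \<open>bl\<close>. A claim waits only while its machine is busy, and the wait ends by
  \<open>bu c i\<close>, which keeps its start within the promised time.\<close>

lemma wait_invA:
  assumes "invA R c" "started_ok c" "ticked_ok c" "seen_ok c"
  shows "invA R (wait c)"
proof -
  note a = invAD[OF assms(1)]
  note e = wait_eqs[of c]
  let ?c = "wait c" let ?dt = "wtime c - tm c"
  have dt: "0 \<le> ?dt" using wtime_ge[of c] by simp
  have ln: "l < n" if "st c l \<noteq> 0" for l using dinvD(2)[OF a(1)] that by auto
  have blm: "i < m" if "0 < bl c i" for i
  proof (rule ccontr)
    assume "\<not> i < m" thus False using a(9)[of i] that by simp
  qed
  hence bln: "i < n" if "0 < bl c i" for i using that m_le_n by (meson less_le_trans)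
  have mn: "i < n" if "i < m" for i using that m_le_n by simp
  show ?thesis
  proof (rule invAI, unfold e(1-4,7-11) wait_Z)
    show "dinv {l. st c l \<noteq> 0} (dc c)" by (rule a(1))
    show "st c l \<le> 4" for l by (rule a(2))
    show "l \<in> ins (dc c) \<and> fz c l = None" if "st c l = 1" for l using a(3) that .
    show "pend c (mc (dc c) l) = Suc l \<and> fz c l \<noteq> None" if "st c l = 2" for l using a(4) that .
    show "i < m \<and> st c (pend c i - 1) = 2 \<and> mc (dc c) (pend c i - 1) = i \<and>
       wtime c \<le> xt c (pend c i - 1) + p (pend c i - 1) \<and>
       bu c i \<le> xt c (pend c i - 1) + p (pend c i - 1)" if "pend c i \<noteq> 0" for i
    proof -
      note h = a(5)[OF that]
      hence im: "i < m" by simp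
      have "tm c < bu c i"
        using assms(2)[unfolded started_ok_def, rule_format, OF im] that by auto
      hence "wtime c \<le> bu c i" using wait_bounds(3) mn[OF im] by simp
      thus ?thesis using h by linarith
    qed
    show "fz c l = None" if "st c l = 3" for l using a(6) that .
    show "fz c l = None \<and> qc c l = 0 \<and> dd ?c l = 0" if "st c l = 0" for l
      using a(7)[OF that] that by (simp add: e(5))
    show "qc c l \<le> R l \<and> 0 \<le> dd ?c l" for l
    proof (cases "fl (dc c) \<le> tm c \<and> st c l = 1 \<and> bl c (mc (dc c) l) \<le> 0")
      case True
      hence "0 < dd c l" using assms(3)[unfolded ticked_ok_def, rule_format, of l] by auto
      hence "?dt \<le> dd c l" using True wait_bounds(2) ln[of l] by simp
      thus ?thesis using True a(8)[of l] by (simp add: e(5))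
    next
      case False thus ?thesis using a(8)[of l] by (simp only: e(5) if_False simp_thms)
    qed
    show "0 \<le> bl ?c i \<and> (m \<le> i \<longrightarrow> bl ?c i = 0 \<and> bu c i = 0)" for i
      using a(9)[of i] wait_bounds(1)[of c i] bln[of i] blm[of i] by (auto simp: e(6))
    show "\<exists>l \<zeta>. l < n \<and> fz c l = Some \<zeta> \<and> mc (dc c) l = i \<and>
       Zc c + (if fl (dc c) \<le> tm c then ?dt else 0) - \<zeta> = 4 * p l - bl ?c i \<and>
       \<zeta> \<le> Zc c + (if fl (dc c) \<le> tm c then ?dt else 0)" if i: "0 < bl ?c i" for i
    proof -
      have b: "0 < bl c i" using i dt by (auto simp: e(6) split: if_splits)
      from a(10)[OF this] obtain l \<zeta> where l: "l < n" "fz c l = Some \<zeta>" "mc (dc c) l = i"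
        "Zc c - \<zeta> = 4 * p l - bl c i" "\<zeta> \<le> Zc c" by blast
      thus ?thesis using b dt by (intro exI[of _ l] exI[of _ \<zeta>]) (auto simp: e(6))
    qed
    show "rem ?c i \<le> bl ?c i / 2 \<or> pend c i = 0 \<and> (rem ?c i = 0 \<or>
       ur (dc c) = k \<and> (\<forall>l\<in>ins (dc c). rem ?c i \<le> p l) \<and> m * k * rem ?c i \<le> P)" if i: "i < m" for i
    proof (cases "tm c < bu c i")
      case False
      hence "pend c i = 0" using assms(2)[unfolded started_ok_def, rule_format, OF i] by auto
      moreover have "rem ?c i = 0" using calculation False dt by (simp add: rem_def e)
      ultimately show ?thesis by blast
    next
      case True
      have "wtime c \<le> bu c i" using wait_bounds(3)[OF True mn[OF i]] .
      hence r: "rem ?c i = rem c i - ?dt" using True by (simp add: rem_def e(2,7,8))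
      from a(11)[OF i] consider "rem c i \<le> bl c i / 2" | "pend c i = 0" "rem c i = 0" |
        "pend c i = 0" "ur (dc c) = k" "\<forall>l\<in>ins (dc c). rem c i \<le> p l" "m * k * rem c i \<le> P" by metis
      thus ?thesis
      proof cases
        case 1
        thus ?thesis using r dt by (auto simp: e(6))
      next
        case 2
        thus ?thesis using r dt True by (simp add: rem_def)
      next
        case 3
        have "m * k * (rem c i - ?dt) \<le> m * k * rem c i" using dt by (intro mult_left_mono) auto
        hence "m * k * rem ?c i \<le> P" using 3(4) r by simp
        moreover have "\<forall>l\<in>ins (dc c). rem ?c i \<le> p l" using 3(3) r dt by fastforce
        ultimately show ?thesis using 3 by blast
      qed
    qed
    show "r l \<le> wtime c" if "st c l \<noteq> 0" for l using a(12)[OF that] dt by simp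
    show "0 \<le> wtime c" using a(13) dt by simp
    show "wtime c \<le> r l" if "l < n" "st c l = 0" for l
      using wtime_release[of l c] assms(4)[unfolded seen_ok_def, rule_format, OF that] that by auto
    show "(sch c l = None) = (st c l \<noteq> 4)" for l by (rule a(15))
    show "i < m \<and> r l \<le> s \<and> s + p l \<le> bu c i \<and> (fz c l \<noteq> None \<longrightarrow> s \<le> xt c l + p l)"
      if "sch c l = Some (i, s)" for l i s using a(16) that .
    show "s + p l \<le> s' \<or> s' + p l' \<le> s"
      if "l \<noteq> l'" "sch c l = Some (i, s)" "sch c l' = Some (i, s')" for l l' i s s'
      using a(17) that by blast
    show "l \<notin> ins (dc c) \<and> ky (dc c) l \<le> xt c l + k * p l"
      if "st c l = 3 \<or> st c l = 4 \<and> fz c l = None" for l using a(18) that .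
  qed
qed

end


section \<open>The time that jobs spend in the slots\<close>

context flow
begin

text \<open>The time counts from release to firing or eviction, whichever comes first;
  \<open>xt\<close> is frozen then, so a later start does not change it.\<close>

definition wl :: "conf \<Rightarrow> nat \<Rightarrow> real" where
  "wl c l = (if st c l = 0 then 0 else if st c l = 1 then tm c - r l else xt c l - r l)"

text \<open>The total time spent in the slots is charged to running countdowns, to the busy time
  \<open>tm - Zc\<close> of the fluid schedule and to the blocking of the machines.\<close>

definition invW :: "conf \<Rightarrow> bool" where
  "invW c \<longleftrightarrow> (\<Sum>l<n. wl c l) \<le> (\<Sum>l<n. qc c l * p l - dd c l) + m * k * (tm c - Zc c) +
     k * ((\<Sum>l<n. if fz c l = None then 0 else 4 * p l) - (\<Sum>i<m. bl c i))"

lemma invW_c0: "invW c0"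
  by (simp add: invW_def wl_def c0_def Zc_def d0_def)

lemma insj_Z:
  assumes "invA R c" "j < n"
  shows "Zc (insj j c) = Zc c"
proof (cases "st c j = 0 \<and> r j \<le> tm c")
  case True
  note e = insj_eqs[OF conjunct1[OF True] conjunct2[OF True]]
  have "r j = tm c" using invAD(14)[OF assms(1), of j] True assms(2) by simp
  thus ?thesis using dins_Z[OF _ dinvD(4)[OF invAD(1)[OF assms(1)]] assms(2)] e(1,2)
    by (simp add: Zc_def)
qed (simp add: insj_id)

lemma insj_invW:
  assumes "invA R c" "j < n" "invW c"
  shows "invW (insj j c)"
proof (cases "st c j = 0 \<and> r j \<le> tm c")
  case True
  note e = insj_eqs[OF conjunct1[OF True] conjunct2[OF True]]
  have tm: "r j = tm c" using invAD(14)[OF assms(1), of j] True assms(2) by simp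
  have wl: "wl (insj j c) l = wl c l" for l
  proof (cases "l = j")
    case lj: True
    show ?thesis using e(2) e(11) e(13)[of j] tm True by (auto simp: wl_def lj)
  next
    case False
    show ?thesis
    proof (cases "st c l = 1 \<and> st (insj j c) l = 3")
      case True thus ?thesis using e(13)[of l] e(2) by (auto simp: wl_def)
    next
      case ns: False
      hence s: "st (insj j c) l = st c l" using e(10)[OF False] by auto
      thus ?thesis using e(2) e(12)[of l] False by (auto simp: wl_def)
    qed
  qed
  show ?thesis using assms(3) unfolding invW_def wl insj_Z[OF assms(1,2)] e(2-5,9) .
qed (simp add: insj_id assms)

lemma tick_invW:
  assumes "invA R c" "l < n" "invW c"
  shows "invW (tick R l c)"
proof (cases "st c l = 1 \<and> fl (dc c) \<le> tm c \<and> bl c (mc (dc c) l) \<le> 0 \<and> dd c l \<le> 0")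
  case False thus ?thesis using assms by (auto simp: tick_def)
next
  case act: True
  note a = invAD[OF assms(1)]
  let ?i = "mc (dc c) l"
  have d0: "dd c l = 0" using a(8)[of l] act by simp
  have lin: "l \<in> ins (dc c)" "fz c l = None" using a(3) act by auto
  have im: "?i < m" using dinvD(5)[OF a(1) lin(1)] .
  have b0: "bl c ?i = 0" using a(9)[of ?i] act by auto
  show ?thesis
  proof (cases "qc c l = R l")
    case False
    let ?c = "tick R l c"
    have eq: "?c = c\<lparr>qc := (qc c)(l := Suc (qc c l)), dd := (dd c)(l := p l)\<rparr>"
      using act False by (simp add: tick_def)
    have "(\<Sum>l'<n. qc ?c l' * p l' - dd ?c l') = (\<Sum>l'<n. qc c l' * p l' - dd c l')"
      by (rule sum.cong) (auto simp: eq d0 algebra_simps)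
    moreover have "wl ?c = wl c" "Zc ?c = Zc c" by (auto simp: eq wl_def Zc_def fun_eq_iff)
    ultimately show ?thesis using assms(3) unfolding invW_def by (simp add: eq)
  next
    case True
    let ?c = "tick R l c"
    have eq: "?c = c\<lparr>st := (st c)(l := 2), bl := (bl c)(?i := 4 * p l),
              pend := (pend c)(?i := Suc l), fz := (fz c)(l := Some (Zc c)), xt := (xt c)(l := tm c)\<rparr>"
      using act True by (simp add: tick_def)
    have "wl ?c = wl c" "Zc ?c = Zc c" using act by (auto simp: eq wl_def Zc_def fun_eq_iff)
    moreover have "(\<Sum>l'<n. if fz ?c l' = None then 0 else 4 * p l') =
        (\<Sum>l'<n. if fz c l' = None then 0 else 4 * p l') + 4 * p l"
      using assms(2) lin(2)
      by (subst sum_upd[where a = l and f = "\<lambda>l'. if fz c l' = None then 0 else 4 * p l'"])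
        (auto simp: eq)
    moreover have "(\<Sum>i<m. bl ?c i) = (\<Sum>i<m. bl c i) + 4 * p l"
      using im b0 by (subst sum_upd[where a = ?i and f = "bl c"]) (auto simp: eq)
    moreover have "qc ?c = qc c" "dd ?c = dd c" "tm ?c = tm c" by (auto simp: eq)
    ultimately show ?thesis using assms(3) unfolding invW_def by simp
  qed
qed

lemma starti_eqs:
  fixes c i
  defines "b \<equiv> (if pend c i = 0 then best c else pend c i)"
  shows "\<not> (bu c i \<le> tm c \<and> b \<noteq> 0) \<Longrightarrow> starti i c = c"
    "bu c i \<le> tm c \<Longrightarrow> b \<noteq> 0 \<Longrightarrow> starti i c =
      c\<lparr>st := (st c)(b - 1 := 4), bu := (bu c)(i := tm c + p (b - 1)),
        pend := (pend c)(i := 0), sch := (sch c)(b - 1 \<mapsto> (i, tm c))\<rparr>"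
    "dc (starti i c) = dc c" "tm (starti i c) = tm c" "qc (starti i c) = qc c"
    "dd (starti i c) = dd c" "bl (starti i c) = bl c" "fz (starti i c) = fz c" "xt (starti i c) = xt c"
    "Zc (starti i c) = Zc c"
  by (auto simp: starti_def Let_def b_def Zc_def)

lemma starti_job:
  fixes c i
  defines "b \<equiv> (if pend c i = 0 then best c else pend c i)"
  assumes "invA R c" "b \<noteq> 0"
  shows "pend c i = b \<and> st c (b - 1) = 2 \<or> pend c i = 0 \<and> st c (b - 1) = 3" "b - 1 < n"
proof -
  note a = invAD[OF assms(2)]
  show j: "pend c i = b \<and> st c (b - 1) = 2 \<or> pend c i = 0 \<and> st c (b - 1) = 3"
  proof (cases "pend c i = 0")
    case True
    thus ?thesis using best(2)[of c] assms(3) by (auto simp: b_def)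
  next
    case False
    thus ?thesis using a(5)[OF False] by (auto simp: b_def)
  qed
  have "b - 1 \<in> {l. st c l \<noteq> 0}" using j by auto
  thus "b - 1 < n" using dinvD(2)[OF a(1)] by blast
qed

lemma starti_invW:
  assumes "invA R c" "invW c"
  shows "invW (starti i c)"
proof -
  define b where "b = (if pend c i = 0 then best c else pend c i)"
  note e = starti_eqs[where c = c and i = i, folded b_def]
  have "wl (starti i c) = wl c"
  proof (cases "bu c i \<le> tm c \<and> b \<noteq> 0")
    case True
    hence "st c (b - 1) \<in> {2, 3}" using starti_job(1)[where i = i, OF assms(1), folded b_def] by auto
    thus ?thesis using e(2) True by (auto simp: wl_def fun_eq_iff)
  qed (use e(1) in simp)
  thus ?thesis using assms(2) unfolding invW_def e(3-10) by simp
qed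

text \<open>At most \<open>k\<close> jobs per machine are counting. If the fluid is busy they are
  paid by \<open>m * k\<close> times the busy time. If it is idle, an unblocked machine shows the
  elapsed time in \<open>qc * p - dd\<close>, and a blocked one pays for its at most
  \<open>k\<close> jobs by the decrease of \<open>k * bl\<close>.\<close>

lemma wait_invW:
  assumes "invA R c" "invW c"
  shows "invW (wait c)"
proof -
  note a = invAD[OF assms(1)]
  note D = dinvD[OF a(1)]
  note e = wait_eqs[of c]
  let ?c = "wait c"
  define dt where "dt = wtime c - tm c"
  have dt: "0 \<le> dt" using wtime_ge[of c] by (simp add: dt_def)
  define W where "W = {l. l < n \<and> st c l = 1}"
  have W: "finite W" "W \<subseteq> ins (dc c)" using a(3) by (auto simp: W_def)
  have "(\<Sum>l<n. wl ?c l) = (\<Sum>l<n. wl c l + (if l \<in> W then dt else 0))"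
    by (rule sum.cong) (auto simp: wl_def e W_def dt_def)
  also have "\<dots> = (\<Sum>l<n. wl c l) + card W * dt"
    by (simp add: sum.distrib sum.If_cases W_def Int_def)
  finally have L: "(\<Sum>l<n. wl ?c l) = (\<Sum>l<n. wl c l) + card W * dt" .
  define Wi where "Wi i = {l \<in> W. mc (dc c) l = i}" for i
  have WU: "W = (\<Union>i<m. Wi i)" using W(2) D(5) by (auto simp: Wi_def)
  have Wk: "card (Wi i) \<le> k" if "i < m" for i
  proof -
    have "card (Wi i) \<le> card {l \<in> ins (dc c). mc (dc c) l = i}"
      using W D(3) by (intro card_mono) (auto simp: Wi_def)
    thus ?thesis using card_machine_le[OF a(1) that] by simp
  qed
  have cW: "card W = (\<Sum>i<m. card (Wi i))"
    unfolding WU by (rule card_UN_disjoint) (use W in \<open>auto simp: Wi_def\<close>)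
  show ?thesis
  proof (cases "fl (dc c) \<le> tm c")
    case False
    have "card W \<le> m * k" using cW sum_mono[of "{..<m}" "\<lambda>i. card (Wi i)" "\<lambda>_. k"] Wk by simp
    hence "real (card W) * dt \<le> m * k * dt"
      using dt by (intro mult_right_mono) (simp_all flip: of_nat_mult)
    thus ?thesis using assms(2) False
      unfolding invW_def L wait_Z by (simp add: e dt_def algebra_simps)
  next
    case True
    define U where "U = {l \<in> W. bl c (mc (dc c) l) \<le> 0}"
    have "(\<Sum>l<n. qc ?c l * p l - dd ?c l) = (\<Sum>l<n. (qc c l * p l - dd c l) + (if l \<in> U then dt else 0))"
      by (rule sum.cong) (auto simp: e True U_def W_def dt_def)
    also have "\<dots> = (\<Sum>l<n. qc c l * p l - dd c l) + card U * dt"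
      by (simp add: sum.distrib sum.If_cases U_def W_def Int_def conj_assoc)
    finally have 1: "(\<Sum>l<n. qc ?c l * p l - dd ?c l) = (\<Sum>l<n. qc c l * p l - dd c l) + card U * dt" .
    have "(\<Sum>i<m. bl ?c i) = (\<Sum>i<m. bl c i - (if 0 < bl c i then dt else 0))"
      by (rule sum.cong) (auto simp: e True dt_def)
    also have "\<dots> = (\<Sum>i<m. bl c i) - card {i. i < m \<and> 0 < bl c i} * dt"
      by (simp add: sum_subtractf sum.If_cases Int_def)
    finally have 2: "(\<Sum>i<m. bl ?c i) = (\<Sum>i<m. bl c i) - card {i. i < m \<and> 0 < bl c i} * dt" .
    have cU: "card U = (\<Sum>i<m. if 0 < bl c i then 0 else card (Wi i))"
    proof -
      have "U = (\<Union>i<m. if 0 < bl c i then {} else Wi i)"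
        unfolding U_def WU by (auto simp: Wi_def split: if_splits)
      moreover have "card (\<Union>i<m. if 0 < bl c i then {} else Wi i) =
          (\<Sum>i<m. card (if 0 < bl c i then {} else Wi i))"
        by (rule card_UN_disjoint) (use W in \<open>auto simp: Wi_def split: if_splits\<close>)
      ultimately have "card U = (\<Sum>i<m. card (if 0 < bl c i then {} else Wi i))" by simp
      also have "\<dots> = (\<Sum>i<m. if 0 < bl c i then 0 else card (Wi i))"
        by (intro sum.cong) auto
      finally show ?thesis .
    qed
    have "card W \<le> (\<Sum>i<m. (if 0 < bl c i then 0 else card (Wi i)) + (if 0 < bl c i then k else 0))"
      unfolding cW using Wk by (intro sum_mono) auto
    also have "\<dots> = card U + k * card {i. i < m \<and> 0 < bl c i}"
      unfolding sum.distrib cU by (simp add: sum.If_cases Int_def)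
    finally have "real (card W) * dt \<le> real (card U + k * card {i. i < m \<and> 0 < bl c i}) * dt"
      using dt by (intro mult_right_mono) linarith+
    thus ?thesis using assms(2) True
      unfolding invW_def L wait_Z 1 2 by (simp add: e dt_def algebra_simps)
  qed
qed

text \<open>In this window of idle time a blocking by \<open>l\<close> can hurt a job due at
  \<open>\<kappa>\<close>. It lasts \<open>4 * p l\<close>, which gives the lower end. It is counted
  only if it exceeds half of the lateness, which is then below \<open>8 * p l\<close>; this gives
  the upper end.\<close>

definition hit :: "(nat \<Rightarrow> real option) \<Rightarrow> real \<Rightarrow> nat \<Rightarrow> bool" where
  "hit f \<kappa> l \<longleftrightarrow> (\<exists>\<zeta>. f l = Some \<zeta> \<and> Zd \<kappa> - 4 * p l < \<zeta> \<and> \<zeta> < Zd \<kappa> + 8 * p l)"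

text \<open>A started job with \<open>fz c x = None\<close> was taken from the queue. The right side
  only grows, since firing times are never withdrawn, so the bound has to be shown only at the start
  of \<open>x\<close>.\<close>

definition invB :: "real \<Rightarrow> conf \<Rightarrow> bool" where
  "invB V c \<longleftrightarrow> (\<forall>x i s. sch c x = Some (i, s) \<longrightarrow> fz c x = None \<longrightarrow>
     m * (s - ky (dc c) x) \<le> 4 * ((P + V) / k + 2 * (\<Sum>l<n. if hit (fz c) (ky (dc c) x) l then p l else 0)))"

definition Qs :: "conf \<Rightarrow> real \<Rightarrow> real" where
  "Qs c \<kappa> = (\<Sum>x<n. if st c x = 3 \<and> ky (dc c) x \<le> \<kappa> then p x else 0)"

text \<open>\<open>u\<close> is a time at which no queued job had a deadline up to \<open>\<kappa>\<close>; since then all machines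
  have been busy.\<close>

definition lag :: "conf \<Rightarrow> real \<Rightarrow> real \<Rightarrow> bool" where
  "lag c \<kappa> u \<longleftrightarrow> 0 \<le> u \<and> u \<le> tm c \<and>
     (\<forall>x. st c x = 3 \<longrightarrow> ky (dc c) x \<le> \<kappa> \<longrightarrow> (\<exists>j. en (dc c) j = Some x \<and> u \<le> r j)) \<and>
     Qs c \<kappa> + (\<Sum>i<m. rem c i) \<le> P / k + A (dc c) \<kappa> u - m * (tm c - u) + m / 2 * (Zc c - Zd u) +
       (\<Sum>i<m. bl c i) / 2"

definition empq :: "conf \<Rightarrow> real \<Rightarrow> bool" where
  "empq c \<kappa> \<longleftrightarrow> (\<forall>x. st c x = 3 \<longrightarrow> \<kappa> < ky (dc c) x)"

lemma A_nonneg: "dinv X d \<Longrightarrow> 0 \<le> A d \<kappa> u"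
  unfolding A_def
proof (rule sum_nonneg)
  fix j assume "dinv X d" "j \<in> {..<n}"
  thus "0 \<le> (if u \<le> r j \<and> r j + k * esz (en d j) \<le> \<kappa> then esz (en d j) else 0)"
    using dinvD(2,13)[of X d] p_pos
    by (auto simp: esz_def less_imp_le split: option.split) (meson less_imp_le lessThan_iff subsetD)
qed

text \<open>With nothing relevant queued, only \<open>rem\<close> has to be paid. On each machine it
  is covered by \<open>bl / 2\<close> or belongs to an evicted job and is at most
  \<open>P / (m * k)\<close>; this is the origin of the term \<open>P / k\<close>.\<close>

lemma lag_reset:
  assumes "invA R c" "Zc c = Zd (tm c)" "empq c \<kappa>"
  shows "lag c \<kappa> (tm c)"
proof -
  note a = invAD[OF assms(1)]
  have "Qs c \<kappa> = 0" unfolding Qs_def using assms(3) by (intro sum.neutral) (force simp: empq_def)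
  moreover have "(\<Sum>i<m. rem c i) \<le> (\<Sum>i<m. bl c i / 2 + P / (m * k))"
  proof (rule sum_mono)
    fix i assume "i \<in> {..<m}"
    hence i: "i < m" by simp
    have mk: "0 < real m * real k" using m_pos k_pos by simp
    have "0 \<le> P / (m * k)" using P_nonneg by simp
    moreover have "rem c i \<le> P / (m * k)" if "m * k * rem c i \<le> P"
      using that mk by (simp add: pos_le_divide_eq mult.commute)
    ultimately show "rem c i \<le> bl c i / 2 + P / (m * k)" using a(11)[OF i] a(9)[of i] by auto
  qed
  moreover have "(\<Sum>i<m. bl c i / 2 + P / (m * k)) = (\<Sum>i<m. bl c i) / 2 + P / k"
    using m_pos by (simp add: sum.distrib sum_divide_distrib)
  ultimately show ?thesis
    using A_nonneg[OF a(1), of \<kappa> "tm c"] a(13) assms(2,3) by (auto simp: lag_def empq_def)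
qed

end


section \<open>The lateness of evicted jobs\<close>

context flow
begin

lemma seen_less: "invA R c \<Longrightarrow> st c x \<noteq> 0 \<Longrightarrow> x < n"
  using dinvD(2)[OF invAD(1), of R c] by blast

lemma insj_ky:
  assumes "invA R c" "j < n" "st c x = 3 \<or> st c x = 4 \<and> fz c x = None"
  shows "ky (dc (insj j c)) x = ky (dc c) x"
proof (cases "st c j = 0 \<and> r j \<le> tm c")
  case True
  note a = invAD[OF assms(1)]
  note e = insj_eqs[OF conjunct1[OF True] conjunct2[OF True]]
  have "x \<notin> ins (dc c)" "x \<noteq> j" using a(18)[OF assms(3)] assms(3) True by auto
  hence "dmin (dc c) j \<noteq> x" using dmin(1)[OF dinvD(4)[OF a(1)], of j] by auto
  thus ?thesis using dins_simps(3,4)[of "dc c" j] e(1) by (cases "ur (dc c) < k") auto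
qed (simp add: insj_id)

text \<open>An eviction with a deadline up to \<open>\<kappa>\<close> adds its volume to
  \<open>A\<close>, and at most the same volume to the queue.\<close>

lemma insj_lag:
  assumes "invA R c" "j < n" "lag c \<kappa> u"
  shows "lag (insj j c) \<kappa> u"
proof (cases "st c j = 0 \<and> r j \<le> tm c")
  case True
  note a = invAD[OF assms(1)]
  note e = insj_eqs[OF conjunct1[OF True] conjunct2[OF True]]
  note L = assms(3)[unfolded lag_def]
  let ?c = "insj j c" let ?y = "dmin (dc c) j"
  have tm: "r j = tm c" using a(14)[of j] True assms(2) by simp
  have rem: "rem ?c = rem c" by (auto simp: rem_def e fun_eq_iff)
  note D = dinvD[OF a(1)]
  have en0: "en (dc c) j = None"
    using D(13)[of j] True by (cases "en (dc c) j") auto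
  have s3: "st ?c x = 3 \<longleftrightarrow> st c x = 3" if "x \<noteq> ?y \<or> ur (dc c) < k" for x
    using that e(10)[of x] e(11) True by (cases "x = j") auto
  show ?thesis
  proof (cases "ur (dc c) < k")
    case u: True
    have d: "en (dc ?c) = en (dc c)" "ky (dc ?c) = ky (dc c)"
      using dins_simps(3)[OF u, of j] e(1) by auto
    have "Qs ?c \<kappa> = Qs c \<kappa>" "A (dc ?c) \<kappa> u = A (dc c) \<kappa> u"
      unfolding Qs_def A_def d using s3 u by auto
    thus ?thesis using L s3 u d by (simp add: lag_def insj_Z[OF assms(1,2)] e rem)
  next
    case u: False
    have d: "en (dc ?c) = (en (dc c))(j := Some ?y)"
      "ky (dc ?c) = (ky (dc c))(?y := r j + k * p ?y)"
      using dins_simps(4)[OF u, of j] e(1) by auto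
    have y: "?y < n" "?y = j \<or> ?y \<in> ins (dc c)"
      using dmin(1)[OF D(4), of j] D(4) assms(2) by auto
    have y3: "st c ?y \<noteq> 3" using y(2) a(18)[of ?y] True by auto
    have py: "0 < p ?y" using p_pos y by simp
    let ?v = "if r j + k * p ?y \<le> \<kappa> then p ?y else 0"
    have A: "A (dc ?c) \<kappa> u = A (dc c) \<kappa> u + ?v"
      unfolding A_def d using assms(2) en0 L tm
      by (subst sum_upd[where a = j and
        f = "\<lambda>i. if u \<le> r i \<and> r i + k * esz (en (dc c) i) \<le> \<kappa> then esz (en (dc c) i) else 0"])
        (auto simp: esz_def)
    have Q: "Qs ?c \<kappa> \<le> Qs c \<kappa> + ?v"
      unfolding Qs_def d using y(1) y3 s3 py
      by (subst sum_upd[where a = ?y and f = "\<lambda>x. if st c x = 3 \<and> ky (dc c) x \<le> \<kappa> then p x else 0"])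
        auto
    have "\<exists>i. en (dc ?c) i = Some x \<and> u \<le> r i" if x: "st ?c x = 3" "ky (dc ?c) x \<le> \<kappa>" for x
    proof (cases "x = ?y")
      case True thus ?thesis using d L tm by auto
    next
      case False
      then obtain i where i: "en (dc c) i = Some x" "u \<le> r i"
        using L x s3[of x] d by auto
      moreover have "i \<noteq> j" using i en0 by auto
      ultimately show ?thesis using d by auto
    qed
    thus ?thesis using L A Q by (auto simp: lag_def insj_Z[OF assms(1,2)] e rem)
  qed
qed (simp add: insj_id assms)

text \<open>Firing adds \<open>p l\<close> to the work left and \<open>2 * p l\<close> to half the
  blocking time.\<close>

lemma tick_lag:
  assumes "invA R c" "l < n" "lag c \<kappa> u"
  shows "lag (tick R l c) \<kappa> u"
proof (cases "st c l = 1 \<and> fl (dc c) \<le> tm c \<and> bl c (mc (dc c) l) \<le> 0 \<and> dd c l \<le> 0")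
  case False thus ?thesis using assms by (auto simp: tick_def)
next
  case act: True
  note a = invAD[OF assms(1)]
  note L = assms(3)[unfolded lag_def]
  let ?i = "mc (dc c) l" let ?c = "tick R l c"
  have lin: "l \<in> ins (dc c)" using a(3) act by auto
  have im: "?i < m" using dinvD(5)[OF a(1) lin] .
  have b0: "bl c ?i = 0" using a(9)[of ?i] act by auto
  have pl: "0 < p l" using p_pos assms by auto
  show ?thesis
  proof (cases "qc c l = R l")
    case False
    have eq: "dc ?c = dc c" "tm ?c = tm c" "st ?c = st c" "bl ?c = bl c" "bu ?c = bu c" "pend ?c = pend c"
      using act False by (simp_all add: tick_def)
    have "Qs ?c \<kappa> = Qs c \<kappa>" "rem ?c = rem c" "Zc ?c = Zc c"
      by (simp_all add: Qs_def rem_def Zc_def eq fun_eq_iff)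
    thus ?thesis using assms(3) unfolding lag_def eq by simp
  next
    case True
    have eq: "?c = c\<lparr>st := (st c)(l := 2), bl := (bl c)(?i := 4 * p l),
              pend := (pend c)(?i := Suc l), fz := (fz c)(l := Some (Zc c)), xt := (xt c)(l := tm c)\<rparr>"
      using act True by (simp add: tick_def)
    have Q: "Qs ?c \<kappa> = Qs c \<kappa>" unfolding Qs_def eq using act by (auto intro!: sum.cong)
    have "rem ?c ?i \<le> rem c ?i + p l"
    proof -
      have "0 \<le> (if pend c ?i = 0 then 0 else p (pend c ?i - 1))"
      proof (cases "pend c ?i = 0")
        case False
        have "pend c ?i - 1 \<in> {l. st c l \<noteq> 0}" using a(5)[OF False] by simp
        hence "pend c ?i - 1 < n" using dinvD(2)[OF a(1)] by blast
        thus ?thesis using p_pos by (simp add: less_imp_le)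
      qed simp
      thus ?thesis by (simp add: rem_def eq)
    qed
    hence Rm: "(\<Sum>i<m. rem ?c i) \<le> (\<Sum>i<m. rem c i) + p l"
      using im by (subst sum_upd[where a = ?i and f = "rem c"]) (auto simp: rem_def eq)
    have B: "(\<Sum>i<m. bl ?c i) = (\<Sum>i<m. bl c i) + 4 * p l"
      using im b0 by (subst sum_upd[where a = ?i and f = "bl c"]) (auto simp: eq)
    have s: "dc ?c = dc c" "tm ?c = tm c" "Zc ?c = Zc c" "\<And>x. st ?c x = 3 \<Longrightarrow> st c x = 3"
      by (auto simp: eq Zc_def split: if_splits)
    have ar: "X + R' \<le> Y + B' / 2" if "X + R1 \<le> Y + B1 / 2" "R' \<le> R1 + p l" "B' = B1 + 4 * p l"
      for X Y R1 R' B1 B' :: real using that pl by argo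
    show ?thesis unfolding lag_def s(1-3) Q
      using L s(4) by (intro conjI ar[OF _ Rm B]) auto
  qed
qed

text \<open>Between the starts of a round the inequality may be replaced by an empty queue: starting
  a job with a deadline after \<open>\<kappa>\<close> raises \<open>rem\<close> without lowering
  \<open>Qs\<close>.\<close>

definition lagE :: "conf \<Rightarrow> bool" where
  "lagE c \<longleftrightarrow> (\<forall>\<kappa>. (\<exists>u. lag c \<kappa> u) \<or> empq c \<kappa>)"

text \<open>A claim leaves the left side as it is, and a queued job due by \<open>\<kappa>\<close>
  moves from \<open>Qs\<close> to \<open>rem\<close>. A job due later is chosen only when nothing
  due by \<open>\<kappa>\<close> is queued, because \<open>best\<close> takes the earliest
  deadline.\<close>

lemma starti_lagE:
  assumes "invA R c" "i < m" "lagE c"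
  shows "lagE (starti i c)"
proof -
  define b where "b = (if pend c i = 0 then best c else pend c i)"
  note e = starti_eqs[where c = c and i = i, folded b_def]
  note a = invAD[OF assms(1)]
  show ?thesis
  proof (cases "bu c i \<le> tm c \<and> b \<noteq> 0")
    case False thus ?thesis using e(1) assms by simp
  next
    case True
    let ?c = "starti i c"
    have b0: "b \<noteq> 0" using True by simp
    note j = starti_job[where i = i, OF assms(1), folded b_def, OF b0]
    define x where "x = b - 1"
    have eq: "?c = c\<lparr>st := (st c)(x := 4), bu := (bu c)(i := tm c + p x),
        pend := (pend c)(i := 0), sch := (sch c)(x \<mapsto> (i, tm c))\<rparr>"
      using e(2) True by (simp add: x_def)
    have px: "0 < p x" using p_pos j(2) by (simp add: x_def)
    have s3: "st ?c y = 3 \<Longrightarrow> st c y = 3" for y by (auto simp: eq split: if_splits)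
    have remo: "rem ?c i' = rem c i'" if "i' \<noteq> i" for i' using that by (simp add: rem_def eq)
    have remi: "rem ?c i = p x" using px by (simp add: rem_def eq)
    have Rm: "(\<Sum>i<m. rem ?c i) = (\<Sum>i<m. rem c i) - rem c i + p x"
      using remi assms(2) remo by (subst sum_upd[where a = i and f = "rem c"]) auto
    show ?thesis unfolding lagE_def
    proof
      fix \<kappa>
      show "(\<exists>u. lag ?c \<kappa> u) \<or> empq ?c \<kappa>"
      proof (cases "empq c \<kappa>")
        case True thus ?thesis using s3 by (auto simp: empq_def eq)
      next
        case False
        then obtain u where L: "lag c \<kappa> u" using assms(3) by (auto simp: lagE_def)
        from j(1) consider "pend c i = Suc x" "st c x = 2" | "pend c i = 0" "st c x = 3"
          using b0 by (auto simp: x_def)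
        thus ?thesis
        proof cases
          case 1
          have "rem c i = p x" using 1 True by (simp add: rem_def)
          moreover have "Qs ?c \<kappa> = Qs c \<kappa>" using 1 by (auto simp: Qs_def eq intro!: sum.cong)
          ultimately show ?thesis using L Rm s3 unfolding lag_def e(3-10) by auto
        next
          case 2
          hence ri: "rem c i = 0" using True by (simp add: rem_def)
          show ?thesis
          proof (cases "ky (dc c) x \<le> \<kappa>")
            case ky: True
            have "Qs ?c \<kappa> = Qs c \<kappa> - p x"
              using j(2) 2 ky unfolding Qs_def x_def[symmetric]
              by (subst sum_upd[where a = x and f = "\<lambda>x. if st c x = 3 \<and> ky (dc c) x \<le> \<kappa> then p x else 0"])
                (auto simp: eq)
            thus ?thesis using L Rm ri s3 unfolding lag_def e(3-10) by auto
          next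
            case ky: False
            have "b = best c" using 2 by (simp add: b_def)
            hence "\<forall>l<n. st c l = 3 \<longrightarrow> ky (dc c) x \<le> ky (dc c) l"
              using best(2)[of c] b0 by (simp add: x_def)
            moreover have "l < n" if "st c l = 3" for l using that seen_less[OF assms(1), of l] by simp
            ultimately have "empq ?c \<kappa>" using ky s3 unfolding empq_def e(3) by fastforce
            thus ?thesis ..
          qed
        qed
      qed
    qed
  qed
qed

text \<open>If a job due by \<open>\<kappa>\<close> is queued, all machines are busy and
  \<open>rem\<close> loses the full \<open>m * dt\<close>. Half the blocking time loses at most
  \<open>m * dt / 2\<close>, and only while the fluid is idle, when the term with \<open>Zc\<close>
  gains as much. If none is queued, the reference time is reset to the end of the wait.\<close>

lemma wait_lag:
  assumes "invA R c" "started_ok c" "ticked_ok c" "seen_ok c" "lagE c" "Zc (wait c) = Zd (wtime c)"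
  shows "\<exists>u. lag (wait c) \<kappa> u"
proof (cases "empq c \<kappa>")
  case True
  hence "empq (wait c) \<kappa>" by (simp add: empq_def wait_eqs)
  thus ?thesis using lag_reset[OF wait_invA[OF assms(1-4)]] assms(6) wait_eqs(2) by auto
next
  case False
  then obtain u where L: "lag c \<kappa> u" using assms(5) by (auto simp: lagE_def)
  note L' = L[unfolded lag_def]
  let ?c = "wait c"
  define dt where "dt = wtime c - tm c"
  have dt: "0 \<le> dt" using wtime_ge[of c] by (simp add: dt_def)
  note a = invAD[OF assms(1)]
  note e = wait_eqs[of c]
  have busy: "tm c < bu c i" if "i < m" for i
    using assms(2)[unfolded started_ok_def, rule_format, OF that] False by (auto simp: empq_def)
  have "rem ?c i = rem c i - dt" if "i < m" for i
  proof -
    have "wtime c \<le> bu c i" using wait_bounds(3)[OF busy[OF that]] that m_le_n by simp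
    thus ?thesis using busy[OF that] by (simp add: rem_def e dt_def)
  qed
  hence Rm: "(\<Sum>i<m. rem ?c i) = (\<Sum>i<m. rem c i) - m * dt" by (simp add: sum_subtractf)
  have B: "(\<Sum>i<m. bl c i) - (if fl (dc c) \<le> tm c then m * dt else 0) \<le> (\<Sum>i<m. bl ?c i)"
  proof -
    have "(\<Sum>i<m. bl c i - (if fl (dc c) \<le> tm c then dt else 0)) \<le> (\<Sum>i<m. bl ?c i)"
      using dt by (intro sum_mono) (auto simp: e dt_def)
    thus ?thesis by (simp add: sum_subtractf split: if_splits)
  qed
  have Q: "Qs ?c \<kappa> = Qs c \<kappa>" by (simp add: Qs_def e)
  have C: "m * (tm c + dt - u) = m * (tm c - u) + m * dt" by (simp add: algebra_simps)
  have D: "m / 2 * (Zc c + (if fl (dc c) \<le> tm c then dt else 0) - Zd u) =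
      m / 2 * (Zc c - Zd u) + (if fl (dc c) \<le> tm c then m * dt / 2 else 0)"
    by (simp add: algebra_simps)
  have ar: "Q + R' \<le> X + Y - c' + d' + B' / 2"
    if "Q + R1 \<le> X + Y - c1 + d1 + B1 / 2" "R' = R1 - x" "B1 - (if g then x else 0) \<le> B'"
      "c' = c1 + x" "d' = d1 + (if g then x / 2 else 0)" "0 \<le> x"
    for Q X Y R1 R' B1 B' c1 c' d1 d' x :: real and g
    using that by (auto split: if_splits)
  have w: "wtime c = tm c + dt" by (simp add: dt_def)
  have x: "0 \<le> m * dt" using dt by simp
  have L1: "Qs c \<kappa> + (\<Sum>i<m. rem c i) \<le> P / k + A (dc c) \<kappa> u - m * (tm c - u) +
      m / 2 * (Zc c - Zd u) + (\<Sum>i<m. bl c i) / 2" using L' by blast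
  have "Qs ?c \<kappa> + (\<Sum>i<m. rem ?c i) \<le> P / k + A (dc c) \<kappa> u - m * (tm c + dt - u) +
      m / 2 * (Zc c + (if fl (dc c) \<le> tm c then dt else 0) - Zd u) + (\<Sum>i<m. bl ?c i) / 2"
    unfolding Q by (rule ar[OF L1 Rm B C D x])
  hence "lag ?c \<kappa> u"
    using L' dt unfolding lag_def wait_Z e(1,2,3) w
    by (cases "fl (dc c) \<le> tm c") simp_all
  thus ?thesis ..
qed

lemma insj_invB: 
  assumes "invA R c" "j < n" "invB V c"
  shows "invB V (insj j c)"
proof -
  have s: "sch (insj j c) = sch c" "fz (insj j c) = fz c"
    by (auto simp: insj_def Let_def)
  have ky: "ky (dc (insj j c)) x = ky (dc c) x" if "sch c x = Some (i, s)" "fz c x = None" for x i s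
  proof -
    have "st c x = 4" using that invAD(15)[OF assms(1), of x] by auto
    thus ?thesis using insj_ky[OF assms(1,2)] that by simp
  qed
  show ?thesis unfolding invB_def s
  proof (intro allI impI)
    fix x i t assume x: "sch c x = Some (i, t)" "fz c x = None"
    show "m * (t - ky (dc (insj j c)) x) \<le> 4 * ((P + V) / k +
       2 * (\<Sum>l<n. if hit (fz c) (ky (dc (insj j c)) x) l then p l else 0))"
      unfolding ky[OF x] using assms(3)[unfolded invB_def, rule_format, OF x] .
  qed
qed

lemma tick_invB:
  assumes "invA R c" "l < n" "invB V c"
  shows "invB V (tick R l c)"
proof -
  let ?c = "tick R l c"
  have s: "sch ?c = sch c" "dc ?c = dc c" by (auto simp: tick_def)
  have f: "fz ?c x = fz c x \<or> fz c x = None" for x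
    using invAD(3)[OF assms(1), of l] by (auto simp: tick_def)
  have h: "hit (fz c) \<kappa> x \<Longrightarrow> hit (fz ?c) \<kappa> x" for \<kappa> x
    using f[of x] by (auto simp: hit_def)
  show ?thesis unfolding invB_def s
  proof (intro allI impI)
    fix x i t assume x: "sch c x = Some (i, t)" "fz ?c x = None"
    hence "fz c x = None" by (auto simp: tick_def split: if_splits)
    hence 1: "m * (t - ky (dc c) x) \<le> 4 * ((P + V) / k +
       2 * (\<Sum>l<n. if hit (fz c) (ky (dc c) x) l then p l else 0))"
      using x assms(3) unfolding invB_def by blast
    have 2: "(\<Sum>l<n. if hit (fz c) (ky (dc c) x) l then p l else 0) \<le>
        (\<Sum>l<n. if hit (fz ?c) (ky (dc c) x) l then p l else 0)"
      using h p_pos by (intro sum_mono) (auto simp: less_imp_le)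
    show "m * (t - ky (dc c) x) \<le> 4 * ((P + V) / k +
       2 * (\<Sum>l<n. if hit (fz ?c) (ky (dc c) x) l then p l else 0))"
      by (rule order.trans[OF 1]) (use 2 in simp)
  qed
qed

lemma wait_invB: "invB V c \<Longrightarrow> invB V (wait c)"
  by (simp add: invB_def wait_eqs)

text \<open>Let \<open>y\<close> be the lateness. As the left side of \<open>lag\<close> is
  nonnegative, \<open>A_capacity\<close> bounds \<open>m * y\<close> by \<open>(P + V) / k\<close>,
  \<open>m / 2\<close> times the idle time since \<open>\<kappa>\<close>, and half the blocking
  time. The idle time is at most \<open>y\<close>, which costs half of \<open>m * y\<close>.
  Blockings of at most \<open>y / 2\<close> per machine cost another quarter, and longer ones are
  hits. The remaining quarter explains the factor 4.\<close>

lemma start_bound: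
  assumes "invA R c" "lag c \<kappa> u" "Zc c = Zd (tm c)" "capacity V" "0 \<le> V"
    and x: "st c x = 3" "ky (dc c) x = \<kappa>"
    and pre: "A (dc c) \<kappa> u \<le> A dfin \<kappa> u"
  shows "m * (tm c - \<kappa>) \<le> 4 * ((P + V) / k + 2 * (\<Sum>l<n. if hit (fz c) \<kappa> l then p l else 0))"
proof (cases "tm c \<le> \<kappa>")
  case True
  have "0 \<le> (\<Sum>l<n. if hit (fz c) \<kappa> l then p l else 0)"
    using p_pos by (intro sum_nonneg) (auto simp: less_imp_le)
  hence "0 \<le> 4 * ((P + V) / k + 2 * (\<Sum>l<n. if hit (fz c) \<kappa> l then p l else 0))"
    using P_nonneg assms(5) by simp
  moreover have "m * (tm c - \<kappa>) \<le> 0" using True by (simp add: mult_nonneg_nonpos)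
  ultimately show ?thesis by linarith
next
  case False
  note a = invAD[OF assms(1)]
  note L = assms(2)[unfolded lag_def]
  define y where "y = tm c - \<kappa>"
  have y: "0 < y" using False by (simp add: y_def)
  have xn: "x < n" using x(1) seen_less[OF assms(1), of x] by simp
  obtain j where j: "en (dc c) j = Some x" "u \<le> r j" using L x by auto
  have kx: "\<kappa> = r j + k * p x" using dinvD(13)[OF a(1) j(1)] x by auto
  have u\<kappa>: "u \<le> \<kappa>" using kx j(2) p_pos[OF xn] by (simp add: add_increasing2 less_imp_le)
  have "0 \<le> Qs c \<kappa> + (\<Sum>i<m. rem c i)"
  proof -
    have "0 \<le> Qs c \<kappa>" unfolding Qs_def using p_pos by (intro sum_nonneg) (auto simp: less_imp_le)
    moreover have "0 \<le> (\<Sum>i<m. rem c i)"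
    proof (rule sum_nonneg)
      fix i assume "i \<in> {..<m}"
      have "0 \<le> p (pend c i - 1)" if "pend c i \<noteq> 0"
      proof -
        have "pend c i - 1 \<in> {l. st c l \<noteq> 0}" using a(5)[OF that] by simp
        hence "pend c i - 1 < n" using dinvD(2)[OF a(1)] by blast
        thus ?thesis using p_pos by (simp add: less_imp_le)
      qed
      thus "0 \<le> rem c i" by (auto simp: rem_def)
    qed
    ultimately show ?thesis by simp
  qed
  hence 1: "0 \<le> P / k + A dfin \<kappa> u - m * (tm c - u) + m / 2 * (Zd (tm c) - Zd u) + (\<Sum>i<m. bl c i) / 2"
    using L pre assms(3) by auto
  have 2: "A dfin \<kappa> u + hm * (Zd \<kappa> - Zd u) \<le> m * (\<kappa> - u) + V / k"
    using A_capacity[OF assms(4)] L u\<kappa> by simp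
  \<comment> \<open>Slot jobs are charged at rate \<open>m / 2\<close> of idle time,
    \<open>A_capacity\<close> grants the rate \<open>hm\<close>; here \<open>m < 2 * hm\<close>
    matters.\<close>
  have "m / 2 * (Zd \<kappa> - Zd u) \<le> hm * (Zd \<kappa> - Zd u)"
    using m_less Zd_mono[of u \<kappa>] L u\<kappa> by (intro mult_right_mono) auto
  hence 3: "0 \<le> (P + V) / k - m * y + m / 2 * (Zd (tm c) - Zd \<kappa>) + (\<Sum>i<m. bl c i) / 2"
    using 1 2 by (simp add: y_def algebra_simps add_divide_distrib)
  have lip: "Zd (tm c) \<le> Zd \<kappa> + y" and mono: "Zd \<kappa> \<le> Zd (tm c)"
    using Zd_lip[of \<kappa> "tm c"] Zd_mono[of \<kappa> "tm c"] L u\<kappa> False by (auto simp: y_def)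
  have "m / 2 * (Zd (tm c) - Zd \<kappa>) \<le> m / 2 * y"
    using lip by (intro mult_left_mono) auto
  hence 4: "m * y / 2 \<le> (P + V) / k + (\<Sum>i<m. bl c i) / 2"
    using 3 by linarith
  define Hs where "Hs = {l. l < n \<and> hit (fz c) \<kappa> l}"
  \<comment> \<open>A blocking that exceeds \<open>y / 2\<close> began less than
    \<open>4 * p l\<close> of idle time ago. As it is at most \<open>4 * p l\<close>, it also forces
    \<open>y < 8 * p l\<close>.\<close>
  have bli: "bl c i \<le> y / 2 + (\<Sum>l\<in>{l\<in>Hs. mc (dc c) l = i}. 4 * p l)" if "i < m" for i
  proof -
    have nn: "0 \<le> (\<Sum>l\<in>{l\<in>Hs. mc (dc c) l = i}. 4 * p l)"
      using p_pos by (intro sum_nonneg) (auto simp: Hs_def less_imp_le)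
    show ?thesis
    proof (cases "bl c i \<le> y / 2")
      case False
      hence "0 < bl c i" using y by simp
      from a(10)[OF this] obtain l \<zeta> where l: "l < n" "fz c l = Some \<zeta>" "mc (dc c) l = i"
        "Zc c - \<zeta> = 4 * p l - bl c i" "\<zeta> \<le> Zc c" by blast
      have "hit (fz c) \<kappa> l"
        unfolding hit_def using l assms(3) False lip mono y by (intro exI[of _ \<zeta>]) auto
      hence "l \<in> {l\<in>Hs. mc (dc c) l = i}" using l by (simp add: Hs_def)
      hence "4 * p l \<le> (\<Sum>l\<in>{l\<in>Hs. mc (dc c) l = i}. 4 * p l)"
        using p_pos by (intro member_le_sum) (auto simp: Hs_def less_imp_le)
      thus ?thesis using l y by simp
    qed (use nn in simp)
  qed
  have "(\<Sum>i<m. bl c i) \<le> (\<Sum>i<m. y / 2 + (\<Sum>l\<in>{l\<in>Hs. mc (dc c) l = i}. 4 * p l))"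
    using bli by (intro sum_mono) auto
  also have "\<dots> = m * y / 2 + (\<Sum>i<m. \<Sum>l\<in>{l\<in>Hs. mc (dc c) l = i}. 4 * p l)"
    by (simp add: sum.distrib)
  finally have 6: "(\<Sum>i<m. bl c i) \<le> m * y / 2 + (\<Sum>i<m. \<Sum>l\<in>{l\<in>Hs. mc (dc c) l = i}. 4 * p l)" .
  have "(\<Sum>i<m. \<Sum>l\<in>{l\<in>Hs. mc (dc c) l = i}. 4 * p l) =
      (\<Sum>l\<in>(\<Union>i<m. {l\<in>Hs. mc (dc c) l = i}). 4 * p l)"
    by (subst sum.UNION_disjoint) (auto simp: Hs_def)
  also have "\<dots> \<le> (\<Sum>l\<in>Hs. 4 * p l)"
    using p_pos by (intro sum_mono2) (auto simp: Hs_def less_imp_le)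
  also have "(\<Sum>l\<in>Hs. 4 * p l) = 4 * (\<Sum>l<n. if hit (fz c) \<kappa> l then p l else 0)"
    by (simp add: Hs_def sum.If_cases Int_def sum_distrib_left)
  finally have 5: "(\<Sum>i<m. bl c i) \<le> m * y / 2 + 4 * (\<Sum>l<n. if hit (fz c) \<kappa> l then p l else 0)"
    using 6 by linarith
  have "M \<le> 4 * (X + 2 * H)" if "M / 2 \<le> X + S / 2" "S \<le> M / 2 + 4 * H" for M X S H :: real
    using that by argo
  from this[OF 4 5] show ?thesis by (simp add: y_def)
qed

lemma starti_invB:
  assumes "invA R c" "i < m" "lagE c" "Zc c = Zd (tm c)" "capacity V" "0 \<le> V" "invB V c"
    and pre: "\<And>\<kappa> u. A (dc c) \<kappa> u \<le> A dfin \<kappa> u"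
  shows "invB V (starti i c)"
proof -
  define b where "b = (if pend c i = 0 then best c else pend c i)"
  note e = starti_eqs[where c = c and i = i, folded b_def]
  show ?thesis
  proof (cases "bu c i \<le> tm c \<and> b \<noteq> 0")
    case False thus ?thesis using e(1) assms by simp
  next
    case True
    have b0: "b \<noteq> 0" using True by simp
    note j = starti_job[where i = i, OF assms(1), folded b_def, OF b0]
    have s: "sch (starti i c) = (sch c)(b - 1 \<mapsto> (i, tm c))" using e(2) True by simp
    show ?thesis unfolding invB_def s e(3,8)
    proof (intro allI impI)
      fix x i' t assume x: "((sch c)(b - 1 \<mapsto> (i, tm c))) x = Some (i', t)" "fz c x = None"
      show "m * (t - ky (dc c) x) \<le> 4 * ((P + V) / k +
         2 * (\<Sum>l<n. if hit (fz c) (ky (dc c) x) l then p l else 0))"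
      proof (cases "x = b - 1")
        case True
        hence s3: "st c x = 3" using j(1) x(2) invAD(4)[OF assms(1), of x] by auto
        hence "\<not> empq c (ky (dc c) x)" by (auto simp: empq_def)
        then obtain u where "lag c (ky (dc c) x) u" using assms(3) by (auto simp: lagE_def)
        from start_bound[OF assms(1) this assms(4-6) s3 refl pre] show ?thesis using x True by simp
      next
        case False
        hence "sch c x = Some (i', t)" using x by simp
        thus ?thesis using assms(7) x(2) unfolding invB_def by blast
      qed
    qed
  qed
qed

end


section \<open>One round of the state machine\<close>

context flow
begin

definition ph1 :: "conf \<Rightarrow> conf" where "ph1 c = fold insj [0..<n] c"
definition ph2 :: "(nat \<Rightarrow> nat) \<Rightarrow> conf \<Rightarrow> conf" where "ph2 R c = fold (tick R) [0..<n] c"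
definition ph3 :: "conf \<Rightarrow> conf" where "ph3 c = fold starti [0..<m] c"

lemma body_ph: "body R c = wait (ph3 (ph2 R (ph1 c)))"
  by (simp add: body_def ph1_def ph2_def ph3_def)

lemma fold_upt_ind:
  assumes "Q 0 c" "\<And>i c. i < b \<Longrightarrow> Q i c \<Longrightarrow> Q (Suc i) (f i c)"
  shows "Q b (fold f [0..<b] c)"
proof -
  have "i \<le> b \<Longrightarrow> Q i (fold f [0..<i] c)" for i
    by (induction i) (use assms in auto)
  thus ?thesis by simp
qed

definition invC :: "(nat \<Rightarrow> nat) \<Rightarrow> real \<Rightarrow> conf \<Rightarrow> bool" where
  "invC R V c \<longleftrightarrow> invA R c \<and> invW c \<and> invB V c"

text \<open>Jobs released exactly at the current time are not yet inserted. The inequality is kept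
  for all \<open>\<kappa>\<close> at once, because each queued job will need it at its own
  deadline.\<close>

definition headI :: "(nat \<Rightarrow> nat) \<Rightarrow> real \<Rightarrow> conf \<Rightarrow> bool" where
  "headI R V c \<longleftrightarrow> invC R V c \<and> (\<forall>\<kappa>. \<exists>u. lag c \<kappa> u) \<and> Zc c = Zd (tm c) \<and>
     dc c = before (tm c) \<and> (\<forall>l<n. st c l = 0 \<longleftrightarrow> tm c \<le> r l)"

lemma headI_c0: "headI R V c0"
proof -
  have "before 0 = d0"
    using r_nonneg by (auto simp: before_def filter_empty_conv not_less)
  moreover have Z: "Zc c0 = Zd (tm c0)" by (simp add: Zc_def c0_def d0_def Zd_0)
  moreover have "lag c0 \<kappa> 0" for \<kappa>
    using lag_reset[OF invA_c0 Z, of \<kappa>] by (auto simp: empq_def c0_def)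
  moreover have "invB V c0" by (simp add: invB_def c0_def)
  ultimately show ?thesis using invA_c0 invW_c0 r_nonneg
    by (auto simp: headI_def invC_def c0_def)
qed

definition midI :: "(nat \<Rightarrow> nat) \<Rightarrow> real \<Rightarrow> real \<Rightarrow> conf \<Rightarrow> bool" where
  "midI R V t c \<longleftrightarrow> invC R V c \<and> lagE c \<and> Zc c = Zd t \<and> tm c = t \<and> dc c = after t \<and>
     (\<forall>l<n. st c l = 0 \<longleftrightarrow> t < r l)"

lemma insj_tm: "tm (insj j c) = tm c" by (simp add: insj_def Let_def)

lemma ph1:
  assumes "headI R V c"
  shows "midI R V (tm c) (ph1 c)" "sch (ph1 c) = sch c"
proof -
  note h = assms[unfolded headI_def invC_def]
  define t where "t = tm c"
  define I where "I i c' \<longleftrightarrow> invC R V c' \<and> (\<forall>\<kappa>. \<exists>u. lag c' \<kappa> u) \<and> Zc c' = Zd t \<and> tm c' = t \<and>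
     dc c' = fold dins (filter (\<lambda>j. r j = t) [0..<i]) (before t) \<and>
     (\<forall>l<n. st c' l = 0 \<longleftrightarrow> t \<le> r l \<and> \<not> (l < i \<and> r l = t)) \<and> sch c' = sch c" for i c'
  have "I n (ph1 c)" unfolding ph1_def
  proof (rule fold_upt_ind)
    show "I 0 c" using h by (simp add: I_def t_def invC_def)
    fix i c' assume i: "i < n" and "I i c'"
    note H = this(2)[unfolded I_def invC_def]
    have inv: "invA R c'" using H by blast
    have s: "sch (insj i c') = sch c'" by (simp add: insj_def Let_def)
    show "I (Suc i) (insj i c')"
    proof (cases "st c' i = 0 \<and> r i \<le> tm c'")
      case True
      note e = insj_eqs[OF conjunct1[OF True] conjunct2[OF True]]
      have ri: "r i = t" using True H i by auto
      have "(st (insj i c') l = 0) = (t \<le> r l \<and> \<not> (l < Suc i \<and> r l = t))" if "l < n" for l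
      proof (cases "l = i")
        case True thus ?thesis using e(11) ri by auto
      next
        case False
        have "(st (insj i c') l = 0) = (st c' l = 0)" using e(10)[OF False] by auto
        thus ?thesis using H that False by (auto simp: less_Suc_eq)
      qed
      moreover have "dc (insj i c') = fold dins (filter (\<lambda>j. r j = t) [0..<Suc i]) (before t)"
        using e(1) H ri by simp
      ultimately show ?thesis
        using H i insj_invA[OF inv i] insj_invW[OF inv i] insj_invB[OF inv i] insj_lag[OF inv i]
          insj_Z[OF inv i] insj_tm s unfolding I_def invC_def by metis
    next
      case False
      have "r i \<noteq> t" using False H i by auto
      thus ?thesis using H insj_id[OF False] by (auto simp: I_def invC_def less_Suc_eq)
    qed
  qed
  thus "midI R V (tm c) (ph1 c)" "sch (ph1 c) = sch c"
    by (auto simp: I_def midI_def t_def lagE_def after_before)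
qed

lemma tick_fields:
  "dc (tick R l c) = dc c" "tm (tick R l c) = tm c" "Zc (tick R l c) = Zc c"
  "sch (tick R l c) = sch c" "(st (tick R l c) x = 0) = (st c x = 0)" "bu (tick R l c) = bu c"
  by (auto simp: tick_def Zc_def)

lemma ph2:
  assumes "midI R V t c" "\<And>\<kappa>. \<exists>u. lag c \<kappa> u"
  shows "midI R V t (ph2 R c)" "ticked_ok (ph2 R c)" "sch (ph2 R c) = sch c"
proof -
  note h = assms[unfolded midI_def invC_def]
  define I where "I i c' \<longleftrightarrow> invC R V c' \<and> (\<forall>\<kappa>. \<exists>u. lag c' \<kappa> u) \<and> Zc c' = Zd t \<and> tm c' = t \<and>
     dc c' = after t \<and> (\<forall>l<n. st c' l = 0 \<longleftrightarrow> t < r l) \<and> sch c' = sch c \<and>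
     (\<forall>l<i. st c' l = 1 \<longrightarrow> fl (dc c') \<le> tm c' \<longrightarrow> bl c' (mc (dc c') l) \<le> 0 \<longrightarrow> 0 < dd c' l)" for i c'
  have "I n (ph2 R c)" unfolding ph2_def
  proof (rule fold_upt_ind)
    show "I 0 c" using h by (simp add: I_def invC_def)
    fix i c' assume i: "i < n" and "I i c'"
    note H = this(2)[unfolded I_def invC_def]
    have inv: "invA R c'" using H by blast
    have "0 < dd (tick R i c') l" if "l < Suc i" "st (tick R i c') l = 1"
      "fl (dc (tick R i c')) \<le> tm (tick R i c')"
      "bl (tick R i c') (mc (dc (tick R i c')) l) \<le> 0" for l
    proof -
      have "l < i \<Longrightarrow> st c' l = 1 \<Longrightarrow> fl (dc c') \<le> tm c' \<Longrightarrow> bl c' (mc (dc c') l) \<le> 0 \<Longrightarrow> 0 < dd c' l"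
        using H by blast
      thus ?thesis using that p_pos[OF i]
        by (cases "l = i") (auto simp: tick_def split: if_splits)
    qed
    thus "I (Suc i) (tick R i c')"
      using H tick_invA[OF inv i] tick_invW[OF inv i] tick_invB[OF inv i] tick_lag[OF inv i]
      unfolding I_def invC_def tick_fields by blast
  qed
  hence "I n (ph2 R c)" .
  note H = this[unfolded I_def]
  thus "midI R V t (ph2 R c)" "sch (ph2 R c) = sch c"
    by (auto simp: midI_def lagE_def)
  have inv: "invA R (ph2 R c)" using H by (auto simp: invC_def)
  show "ticked_ok (ph2 R c)" unfolding ticked_ok_def
    using H seen_less[OF inv] by (metis one_neq_zero)
qed

lemma A_after: "A (after t) \<kappa> u \<le> A dfin \<kappa> u"
  using A_prefix[OF after_split] by (simp add: after_def)

lemma ph3: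
  assumes "midI R V t c" "ticked_ok c" "capacity V" "0 \<le> V"
  shows "midI R V t (ph3 c)" "ticked_ok (ph3 c)" "started_ok (ph3 c)"
proof -
  note h = assms[unfolded midI_def invC_def]
  define I where "I i c' \<longleftrightarrow> midI R V t c' \<and> ticked_ok c' \<and>
    (\<forall>i'<i. tm c' < bu c' i' \<or> pend c' i' = 0 \<and> (\<forall>l. st c' l \<noteq> 3))" for i c'
  have "I m (ph3 c)" unfolding ph3_def
  proof (rule fold_upt_ind)
    show "I 0 c" using assms by (simp add: I_def)
    fix i c' assume i: "i < m" and "I i c'"
    note H = this(2)[unfolded I_def midI_def invC_def]
    have inv: "invA R c'" using H by blast
    define b where "b = (if pend c' i = 0 then best c' else pend c' i)"
    note e = starti_eqs[where c = c' and i = i, folded b_def]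
    show "I (Suc i) (starti i c')"
    proof (cases "bu c' i \<le> tm c' \<and> b \<noteq> 0")
      case False
      have "tm c' < bu c' i \<or> pend c' i = 0 \<and> (\<forall>l. st c' l \<noteq> 3)"
      proof (cases "bu c' i \<le> tm c'")
        case True
        hence "b = 0" using False by simp
        hence "pend c' i = 0" "best c' = 0" by (auto simp: b_def split: if_splits)
        moreover have "st c' l \<noteq> 3" for l
          using best(1)[OF \<open>best c' = 0\<close>, of l] seen_less[OF inv, of l] by fastforce
        ultimately show ?thesis by blast
      qed simp
      thus ?thesis using \<open>I i c'\<close> e(1)[OF False] by (auto simp: I_def less_Suc_eq)
    next
      case True
      hence b0: "b \<noteq> 0" by simp
      note j = starti_job[where i = i, OF inv, folded b_def, OF b0]
      have eq: "starti i c' = c'\<lparr>st := (st c')(b - 1 := 4), bu := (bu c')(i := tm c' + p (b - 1)),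
        pend := (pend c')(i := 0), sch := (sch c')(b - 1 \<mapsto> (i, tm c'))\<rparr>" using e(2) True by simp
      have st1: "(st (starti i c') l = 1) = (st c' l = 1)" "(st (starti i c') l = 0) = (st c' l = 0)"
        "st (starti i c') l = 3 \<Longrightarrow> st c' l = 3" for l
        using j(1) by (auto simp: eq split: if_splits)
      have pre: "A (dc c') \<kappa> u \<le> A dfin \<kappa> u" for \<kappa> u using H A_after by simp
      have "midI R V t (starti i c')"
        using H starti_invA[OF inv i] starti_invW[OF inv] starti_lagE[OF inv i]
          starti_invB[OF inv i _ _ assms(3,4) _ pre]
        unfolding midI_def invC_def e(3-10) st1 by simp
      moreover have "ticked_ok (starti i c')"
        using H unfolding ticked_ok_def e(3-7) st1 by simp
      moreover have "tm (starti i c') < bu (starti i c') i' \<or>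
          pend (starti i c') i' = 0 \<and> (\<forall>l. st (starti i c') l \<noteq> 3)" if "i' < Suc i" for i'
      proof (cases "i' = i")
        case True thus ?thesis using p_pos[OF j(2)] by (simp add: eq)
      next
        case False
        hence "i' < i" using that by simp
        hence "tm c' < bu c' i' \<or> pend c' i' = 0 \<and> (\<forall>l. st c' l \<noteq> 3)" using H by blast
        thus ?thesis using False st1(3) by (auto simp: eq)
      qed
      ultimately show ?thesis by (simp add: I_def)
    qed
  qed
  hence "I m (ph3 c)" .
  thus "midI R V t (ph3 c)" "ticked_ok (ph3 c)" "started_ok (ph3 c)"
    by (auto simp: I_def started_ok_def)
qed

definition allst :: "conf \<Rightarrow> bool" where "allst c \<longleftrightarrow> (\<forall>l<n. st c l = 4)"

text \<open>Every unstarted job has an event ahead: a claim or a queued job waits for a busy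
  machine, a counting job for the end of the fluid, of a blocking or of its period, an unseen job
  for its release.\<close>

lemma progress:
  assumes "invA R c" "started_ok c" "ticked_ok c" "seen_ok c" "\<not> allst c"
  shows "tm c < wtime c"
proof (rule wtime_strict, rule ccontr)
  assume no: "\<not> (cset c \<noteq> {} \<or> (\<exists>j<n. tm c < r j))"
  note a = invAD[OF assms(1)]
  obtain l where l: "l < n" "st c l \<noteq> 4" using assms(5) by (auto simp: allst_def)
  have nb: "\<not> tm c < bu c i" if "i < n" for i using no that by (auto simp: cset_def)
  have so: "pend c i = 0 \<and> (\<forall>l. st c l \<noteq> 3)" if "i < m" for i
    using assms(2)[unfolded started_ok_def, rule_format, OF that] nb[of i] that m_le_n by auto
  have "st c l \<noteq> 3" using so[OF m_pos] by auto
  moreover have "st c l \<noteq> 2"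
  proof
    assume s: "st c l = 2"
    note q = a(4)[OF s]
    hence "mc (dc c) l < m" using a(5)[of "mc (dc c) l"] by auto
    thus False using so[of "mc (dc c) l"] q by simp
  qed
  moreover have "st c l \<noteq> 1"
  proof
    assume s: "st c l = 1"
    have im: "mc (dc c) l < m" using dinvD(5)[OF a(1)] a(3)[OF s] by blast
    hence in': "mc (dc c) l < n" using m_le_n by simp
    have "fl (dc c) \<notin> cset c" using no by auto
    hence f: "fl (dc c) \<le> tm c" by (auto simp: cset_def)
    have "\<not> 0 < bl c (mc (dc c) l)"
    proof
      assume "0 < bl c (mc (dc c) l)"
      hence "tm c + bl c (mc (dc c) l) \<in> cset c" using f in' unfolding cset_def by force
      thus False using no by auto
    qed
    hence b: "bl c (mc (dc c) l) \<le> 0" by simp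
    hence "0 < dd c l" using assms(3) s f unfolding ticked_ok_def by blast
    hence "tm c + dd c l \<in> cset c" using f b s l unfolding cset_def by force
    thus False using no by auto
  qed
  moreover have "st c l \<noteq> 0" using no assms(4) l(1) unfolding seen_ok_def by blast
  ultimately show False using a(2)[of l] l(2) by linarith
qed

lemma after_all:
  assumes "\<forall>l<n. r l \<le> t"
  shows "after t = dfin"
proof -
  have "filter (\<lambda>j. r j \<le> t) ord = ord" using assms by (simp add: filter_id_conv)
  thus ?thesis by (simp add: after_def dfin_def)
qed

lemma midI_seen: "midI R V t c \<Longrightarrow> seen_ok c"
  by (auto simp: midI_def seen_ok_def)

text \<open>Once all jobs have started, no event need be left and the clock may stand still. The
  slots may then contain jobs released at this very time, against \<open>headI\<close>, which is
  therefore claimed only as long as a job is unstarted.\<close>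

lemma body:
  assumes "headI R V c" "capacity V" "0 \<le> V"
  defines "c3 \<equiv> ph3 (ph2 R (ph1 c))"
  shows "invC R V (body R c)" "midI R V (tm c) c3" "ticked_ok c3" "started_ok c3"
    "\<not> allst (body R c) \<Longrightarrow> headI R V (body R c) \<and> tm c < wtime c3"
    "allst (body R c) \<Longrightarrow> dc (body R c) = dfin"
proof -
  note 1 = ph1[OF assms(1)]
  have "\<exists>u. lag (ph1 c) \<kappa> u" for \<kappa>
  proof -
    have "\<exists>u. lag c \<kappa> u" using assms(1) by (auto simp: headI_def)
    then obtain u where "lag c \<kappa> u" by blast
    have "invA R (fold insj [0..<n] c) \<and> lag (fold insj [0..<n] c) \<kappa> u"
      by (rule fold_upt_inv) (use assms(1) \<open>lag c \<kappa> u\<close> insj_invA insj_lag in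
        \<open>auto simp: headI_def invC_def\<close>)
    thus ?thesis by (auto simp: ph1_def)
  qed
  note 2 = ph2[OF 1(1) this]
  note 3 = ph3[OF 2(1,2) assms(2,3), folded c3_def]
  note m = 3(1)[unfolded midI_def invC_def]
  have inv: "invA R c3" using m by blast
  have seen: "seen_ok c3" using midI_seen[OF 3(1)] .
  have b: "body R c = wait c3" by (simp add: body_ph c3_def)
  show "midI R V (tm c) c3" "ticked_ok c3" "started_ok c3" using 3 by auto
  show C: "invC R V (body R c)"
    using wait_invA[OF inv 3(3,2) seen] wait_invW[OF inv] wait_invB m by (simp add: invC_def b)
  show "headI R V (body R c) \<and> tm c < wtime c3" if na: "\<not> allst (body R c)"
  proof -
    have "\<not> allst c3" using na by (simp add: allst_def b wait_eqs)
    hence tl: "tm c < wtime c3" using progress[OF inv 3(3,2) seen] m by simp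
    have t0: "0 \<le> tm c" using invAD(13)[OF inv] m by simp
    have rel: "\<And>j. j < n \<Longrightarrow> tm c < r j \<Longrightarrow> wtime c3 \<le> r j" using wtime_release[of _ c3] m by simp
    have bef: "before (wtime c3) = after (tm c)"
    proof -
      have "filter (\<lambda>j. r j < wtime c3) ord = filter (\<lambda>j. r j \<le> tm c) ord"
      proof (intro filter_cong refl)
        fix j assume "j \<in> set ord"
        hence "j < n" by simp
        from rel[OF this] show "(r j < wtime c3) = (r j \<le> tm c)" using tl by linarith
      qed
      thus ?thesis by (simp add: before_def after_def)
    qed
    have Z: "Zc (wait c3) = Zd (wtime c3)"
    proof -
      have "Zc (wait c3) = max (wtime c3) (fl (dc c3)) - sdle (tm c) / hm"
        using m after_facts(2) by (simp add: Zc_def wait_eqs)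
      also have "\<dots> = max (Zc c3) (wtime c3 - sdle (tm c) / hm)"
        using m after_facts(2) tl by (auto simp: Zc_def max_def)
      also have "\<dots> = Zd (wtime c3)" using Zd_step[OF t0 tl rel] m by simp
      finally show ?thesis .
    qed
    have lag: "\<exists>u. lag (wait c3) \<kappa> u" for \<kappa>
      using wait_lag[OF inv 3(3,2) seen _ Z] m by blast
    have "\<forall>l<n. st (wait c3) l = 0 \<longleftrightarrow> wtime c3 \<le> r l"
      using m rel tl by (auto simp: wait_eqs)
    thus ?thesis using C lag Z bef tl m by (simp add: headI_def b wait_eqs)
  qed
  show "dc (body R c) = dfin" if "allst (body R c)"
  proof -
    have "\<forall>l<n. r l \<le> tm c" using that m by (fastforce simp: allst_def b wait_eqs)
    hence "after (tm c) = dfin" by (rule after_all)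
    thus ?thesis using m by (simp add: b wait_eqs)
  qed
qed

section \<open>Termination\<close>

text \<open>The weights count the events ahead. Insertions, ticks, firings and starts weigh 2
  because each may create one further event: the end of a busy fluid, of a period, of a blocking or
  of a busy machine.\<close>

definition wj :: "conf \<Rightarrow> nat \<Rightarrow> int" where
  "wj c l = of_bool (tm c < r l) + 2 * of_bool (st c l = 0) + 2 * (int k - int (qc c l)) +
     2 * of_bool (fz c l = None) + 2 * of_bool (st c l \<noteq> 4) + of_bool (st c l = 1 \<and> 0 < dd c l)"

definition wi :: "conf \<Rightarrow> nat \<Rightarrow> int" where
  "wi c i = of_bool (0 < bl c i) + of_bool (tm c < bu c i)"

definition mea :: "conf \<Rightarrow> int" where
  "mea c = (\<Sum>l<n. wj c l) + (\<Sum>i<m. wi c i) + of_bool (tm c < fl (dc c))"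

lemma sum_drop:
  fixes f g :: "nat \<Rightarrow> int"
  assumes "\<And>l. l < b \<Longrightarrow> g l \<le> f l" "a < b" "g a + \<delta> \<le> f a"
  shows "(\<Sum>l<b. g l) + \<delta> \<le> (\<Sum>l<b. f l)"
proof -
  have "(\<Sum>l<b. g l + (if l = a then \<delta> else 0)) \<le> (\<Sum>l<b. f l)"
    using assms by (intro sum_mono) auto
  thus ?thesis using assms(2) by (simp add: sum.distrib)
qed

lemma sum_rise:
  fixes f g :: "nat \<Rightarrow> int"
  assumes "\<And>l. l < b \<Longrightarrow> l \<noteq> a \<Longrightarrow> g l \<le> f l" "g a \<le> f a + 1"
  shows "(\<Sum>l<b. g l) \<le> (\<Sum>l<b. f l) + 1"
proof -
  have "(\<Sum>l<b. g l) \<le> (\<Sum>l<b. f l + (if l = a then 1 else 0))"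
    using assms by (intro sum_mono) auto
  also have "\<dots> \<le> (\<Sum>l<b. f l) + 1" by (simp add: sum.distrib)
  finally show ?thesis .
qed

lemma insj_mea:
  assumes "invA R c" "j < n"
  shows "mea (insj j c) \<le> mea c"
proof (cases "st c j = 0 \<and> r j \<le> tm c")
  case True
  note e = insj_eqs[OF conjunct1[OF True] conjunct2[OF True]]
  note a = invAD[OF assms(1)]
  have 1: "wj (insj j c) l \<le> wj c l" if "l \<noteq> j" for l
    using e(10)[OF that] by (auto simp: wj_def e)
  have 2: "wj (insj j c) j + 2 \<le> wj c j"
    using e(11) True a(7)[of j] by (auto simp: wj_def e)
  have "wj (insj j c) l \<le> wj c l" for l using 1[of l] 2 by (cases "l = j") auto
  hence "(\<Sum>l<n. wj (insj j c) l) + 2 \<le> (\<Sum>l<n. wj c l)"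
    using assms(2) 2 by (intro sum_drop[where a = j]) auto
  moreover have "(\<Sum>i<m. wi (insj j c) i) = (\<Sum>i<m. wi c i)" by (simp add: wi_def e)
  ultimately show ?thesis by (simp add: mea_def)
qed (simp add: insj_id)

lemma tick_mea:
  assumes "invA R c" "l < n"
  shows "mea (tick R l c) \<le> mea c"
proof (cases "st c l = 1 \<and> fl (dc c) \<le> tm c \<and> bl c (mc (dc c) l) \<le> 0 \<and> dd c l \<le> 0")
  case act: True
  note a = invAD[OF assms(1)]
  have f: "fz c l = None" using a(3) act by blast
  show ?thesis
  proof (cases "qc c l = R l")
    case False
    hence eq: "tick R l c = c\<lparr>qc := (qc c)(l := Suc (qc c l)), dd := (dd c)(l := p l)\<rparr>"
      using act by (simp add: tick_def)
    have "(\<Sum>x<n. wj (tick R l c) x) + 1 \<le> (\<Sum>x<n. wj c x)"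
      using assms(2) act by (intro sum_drop[where a = l]) (auto simp: wj_def eq)
    thus ?thesis by (simp add: mea_def wi_def eq)
  next
    case True
    hence eq: "tick R l c = c\<lparr>st := (st c)(l := 2), bl := (bl c)(mc (dc c) l := 4 * p l),
              pend := (pend c)(mc (dc c) l := Suc l), fz := (fz c)(l := Some (Zc c)),
              xt := (xt c)(l := tm c)\<rparr>" using act by (simp add: tick_def)
    have "(\<Sum>x<n. wj (tick R l c) x) + 1 \<le> (\<Sum>x<n. wj c x)"
      using assms(2) act f by (intro sum_drop[where a = l]) (auto simp: wj_def eq)
    moreover have "(\<Sum>i<m. wi (tick R l c) i) \<le> (\<Sum>i<m. wi c i) + 1"
      using act by (intro sum_rise[where a = "mc (dc c) l"]) (auto simp: wi_def eq)
    ultimately show ?thesis by (simp add: mea_def eq)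
  qed
qed (auto simp: tick_def)

lemma starti_mea:
  assumes "invA R c"
  shows "starti i c = c \<or> mea (starti i c) < mea c"
proof -
  define b where "b = (if pend c i = 0 then best c else pend c i)"
  note e = starti_eqs[where c = c and i = i, folded b_def]
  show ?thesis
  proof (cases "bu c i \<le> tm c \<and> b \<noteq> 0")
    case True
    hence b0: "b \<noteq> 0" by simp
    note j = starti_job[where i = i, OF assms, folded b_def, OF b0]
    have eq: "starti i c = c\<lparr>st := (st c)(b - 1 := 4), bu := (bu c)(i := tm c + p (b - 1)),
        pend := (pend c)(i := 0), sch := (sch c)(b - 1 \<mapsto> (i, tm c))\<rparr>" using e(2) True by simp
    have "(\<Sum>x<n. wj (starti i c) x) + 2 \<le> (\<Sum>x<n. wj c x)"
      using j by (intro sum_drop[where a = "b - 1"]) (auto simp: wj_def eq)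
    moreover have "(\<Sum>x<m. wi (starti i c) x) \<le> (\<Sum>x<m. wi c x) + 1"
      using True by (intro sum_rise[where a = i]) (auto simp: wi_def eq)
    ultimately show ?thesis by (simp add: mea_def eq)
  qed (use e(1) in blast)
qed

lemma wait_mea:
  assumes "invA R c"
  shows "mea (wait c) \<le> mea c" "tm c < wtime c \<Longrightarrow> mea (wait c) < mea c"
proof -
  note a = invAD[OF assms]
  note e = wait_eqs[of c]
  have t: "tm c \<le> wtime c" by (rule wtime_ge)
  have 1: "wj (wait c) l \<le> wj c l" for l using t by (auto simp: wj_def e)
  have 2: "wi (wait c) i \<le> wi c i" for i using t by (auto simp: wi_def e)
  have 3: "of_bool (wtime c < fl (dc c)) \<le> (of_bool (tm c < fl (dc c)) :: int)" using t by auto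
  have s: "(\<Sum>l<n. wj (wait c) l) \<le> (\<Sum>l<n. wj c l)" "(\<Sum>i<m. wi (wait c) i) \<le> (\<Sum>i<m. wi c i)"
    using 1 2 by (auto intro: sum_mono)
  show "mea (wait c) \<le> mea c" using s 3 unfolding mea_def e(1,2) by linarith
  assume less: "tm c < wtime c"
  have sj: "(\<Sum>l<n. wj (wait c) l) + 1 \<le> (\<Sum>l<n. wj c l)" if "l < n" "wj (wait c) l + 1 \<le> wj c l" for l
    using 1 that by (intro sum_drop) auto
  have si: "(\<Sum>l<m. wi (wait c) l) + 1 \<le> (\<Sum>l<m. wi c l)" if "l < m" "wi (wait c) l + 1 \<le> wi c l" for l
    using 2 that by (intro sum_drop) auto
  have bm: "l < m" if "bl c l \<noteq> 0 \<or> bu c l \<noteq> 0" for l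
    using a(9)[of l] that by (cases "m \<le> l") auto
  from wtime_cases[OF less] consider
      "wtime c = fl (dc c)"
    | l where "fl (dc c) \<le> tm c" "l < n" "wtime c = tm c + bl c l"
    | l where "fl (dc c) \<le> tm c" "l < n" "st c l = 1" "bl c (mc (dc c) l) \<le> 0" "wtime c = tm c + dd c l"
    | l where "wtime c = bu c l"
    | l where "l < n" "wtime c = r l"
    unfolding cset_def by blast
  thus "mea (wait c) < mea c"
  proof cases
    case 1
    thus ?thesis using s less unfolding mea_def e(1,2) by simp
  next
    case 2
    have "(\<Sum>l<m. wi (wait c) l) + 1 \<le> (\<Sum>l<m. wi c l)"
      using 2 less bm[of l] by (intro si[of l]) (auto simp: wi_def e)
    thus ?thesis using s 3 unfolding mea_def e(1,2) by linarith
  next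
    case 3
    have "(\<Sum>l<n. wj (wait c) l) + 1 \<le> (\<Sum>l<n. wj c l)"
      using 3 less by (intro sj[of l]) (auto simp: wj_def e)
    thus ?thesis using s \<open>of_bool _ \<le> _\<close> unfolding mea_def e(1,2) by linarith
  next
    case 4
    have "(\<Sum>l<m. wi (wait c) l) + 1 \<le> (\<Sum>l<m. wi c l)"
      using 4 less bm[of l] a(13) by (intro si[of l]) (auto simp: wi_def e)
    thus ?thesis using s 3 unfolding mea_def e(1,2) by linarith
  next
    case 5
    have "(\<Sum>l<n. wj (wait c) l) + 1 \<le> (\<Sum>l<n. wj c l)"
      using 5 less by (intro sj[of l]) (auto simp: wj_def e)
    thus ?thesis using s 3 unfolding mea_def e(1,2) by linarith
  qed
qed

text \<open>If jobs are left after the round, the wait has moved the clock to an event. Otherwise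
  the round has started a job. Either way the measure falls.\<close>

lemma body_mea:
  assumes "headI R V c" "capacity V" "0 \<le> V" "\<not> allst c"
  shows "mea (body R c) < mea c"
proof -
  note b = body[OF assms(1-3)]
  define c1 where "c1 = ph1 c"
  define c2 where "c2 = ph2 R c1"
  define c3 where "c3 = ph3 c2"
  have inv: "invA R c" using assms(1) by (simp add: headI_def invC_def)
  have 1: "invA R c1 \<and> mea c1 \<le> mea c" unfolding c1_def ph1_def
    by (rule fold_upt_inv) (use inv insj_invA insj_mea in \<open>force+\<close>)
  have 2: "invA R c2 \<and> mea c2 \<le> mea c1" unfolding c2_def ph2_def
    by (rule fold_upt_inv) (use 1 tick_invA tick_mea in \<open>force+\<close>)
  have 3: "invA R c3 \<and> (c3 = c2 \<or> mea c3 < mea c2)" unfolding c3_def ph3_def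
  proof (rule fold_upt_inv)
    show "invA R c2 \<and> (c2 = c2 \<or> mea c2 < mea c2)" using 2 by simp
    fix i c' assume i: "i < m" and h: "invA R c' \<and> (c' = c2 \<or> mea c' < mea c2)"
    thus "invA R (starti i c') \<and> (starti i c' = c2 \<or> mea (starti i c') < mea c2)"
      using starti_invA[of R c' i] starti_mea[of R c' i] by fastforce
  qed
  have bw: "body R c = wait c3" by (simp add: body_ph c1_def c2_def c3_def)
  have w: "mea (wait c3) \<le> mea c3" using wait_mea(1) 3 by blast
  show ?thesis
  proof (cases "allst (body R c)")
    case False
    hence "tm c < wtime c3" using b(5) by (simp add: c1_def c2_def c3_def)
    moreover have "tm c3 = tm c" using b(2) by (simp add: midI_def c1_def c2_def c3_def)
    ultimately have "mea (wait c3) < mea c3" using wait_mea(2)[OF conjunct1[OF 3]] by simp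
    thus ?thesis using 1 2 3 bw by force
  next
    case True
    have "sch c2 = sch c"
    proof -
      have "sch c1 = sch c" using ph1(2)[OF assms(1)] by (simp add: c1_def)
      moreover have "sch (fold (tick R) [0..<n] c1) = sch c1"
        by (rule fold_upt_inv) (auto simp: tick_fields)
      ultimately show ?thesis by (simp add: c2_def ph2_def)
    qed
    hence "\<not> allst c2"
      using assms(4) invAD(15)[OF inv] invAD(15)[OF conjunct1[OF 2]] by (auto simp: allst_def)
    moreover have "allst c3" using True by (simp add: allst_def bw wait_eqs)
    ultimately show ?thesis using 1 2 3 w bw by force
  qed
qed

end


text \<open>\<open>V\<close> stands for the optimum, which enters the analysis through these two
  properties.\<close>

locale flow_opt = flow +
  fixes V :: real
  assumes cap: "capacity V" and P_le: "P \<le> V"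
begin

lemma V_nonneg: "0 \<le> V" using P_nonneg P_le by linarith

definition run :: "(nat \<Rightarrow> nat) \<Rightarrow> nat \<Rightarrow> conf" where "run R i = (body R ^^ i) c0"
definition nrun :: "(nat \<Rightarrow> nat) \<Rightarrow> nat" where "nrun R = (LEAST i. allst (run R i))"
definition fin :: "(nat \<Rightarrow> nat) \<Rightarrow> conf" where "fin R = run R (nrun R)"

lemma run_simps [simp]: "run R 0 = c0" "run R (Suc i) = body R (run R i)"
  by (simp_all add: run_def)

lemma not_allst_c0: "\<not> allst c0"
  using n_pos by (auto simp: allst_def c0_def)

lemma run_head: "(\<And>i'. i' \<le> i \<Longrightarrow> \<not> allst (run R i')) \<Longrightarrow> headI R V (run R i)"
proof (induction i)
  case 0 show ?case using headI_c0 by simp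
next
  case (Suc i)
  hence "headI R V (run R i)" by simp
  moreover have "\<not> allst (body R (run R i))" using Suc.prems[of "Suc i"] by simp
  ultimately show ?case using body(5)[OF _ cap V_nonneg] by simp
qed

lemma mea_nonneg:
  assumes "invA R c" "\<And>l. R l < k"
  shows "0 \<le> mea c"
proof -
  have "qc c l \<le> k" for l
    using invAD(8)[OF assms(1), of l] assms(2)[of l] by linarith
  hence "0 \<le> wj c l" for l by (simp add: wj_def)
  thus ?thesis by (auto simp: mea_def wi_def intro!: add_nonneg_nonneg sum_nonneg)
qed

text \<open>Otherwise \<open>mea\<close> would sink below zero, while \<open>R l < k\<close> keeps
  its countdown terms nonnegative.\<close>

lemma ex_allst:
  assumes "\<And>l. R l < k"
  shows "\<exists>i. allst (run R i)"
proof (rule ccontr)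
  assume no: "\<nexists>i. allst (run R i)"
  have "mea (run R i) \<le> mea c0 - int i" for i
  proof (induction i)
    case (Suc i)
    have "headI R V (run R i)" using run_head no by blast
    from body_mea[OF this cap V_nonneg] show ?case using no Suc by force
  qed simp
  from this[of "nat (mea c0) + 1"] have "mea (run R (nat (mea c0) + 1)) < 0" by linarith
  moreover have "invA R (run R (nat (mea c0) + 1))"
    using run_head[of "nat (mea c0) + 1" R] no unfolding headI_def invC_def by blast
  ultimately show False using mea_nonneg[OF _ assms] by force
qed

lemma nrun_least: "i < nrun R \<Longrightarrow> \<not> allst (run R i)"
  unfolding nrun_def by (rule not_less_Least)

lemma nrun_eq: "allst (run R i) \<Longrightarrow> (\<And>i'. i' < i \<Longrightarrow> \<not> allst (run R i')) \<Longrightarrow> nrun R = i"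
  unfolding nrun_def by (intro Least_equality) (auto simp: not_le[symmetric])

lemma fin_facts:
  assumes "\<And>l. R l < k"
  shows "allst (fin R)" "invC R V (fin R)" "dc (fin R) = dfin" "0 < nrun R"
proof -
  show al: "allst (fin R)" unfolding fin_def nrun_def using ex_allst[OF assms] by (rule LeastI_ex)
  show pos: "0 < nrun R" using al not_allst_c0 by (cases "nrun R") (auto simp: fin_def)
  then obtain i where i: "nrun R = Suc i" using gr0_conv_Suc by blast
  have h: "headI R V (run R i)" using nrun_least[of _ R] i by (intro run_head) simp
  note b = body[OF h cap V_nonneg]
  have "fin R = body R (run R i)" by (simp add: fin_def i)
  thus "invC R V (fin R)" "dc (fin R) = dfin" using b(1,6) al by simp_all
qed

section \<open>Changing the random number of one job\<close>

text \<open>\<open>Zc c + dd c j - qc c j * p j\<close> is the idle time at which the countdown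
  would have begun if it had run without a pause. Pauses only move it to later times, so firing
  comes at \<open>g + R j * p j\<close> at the earliest.\<close>

definition Gi :: "(nat \<Rightarrow> nat) \<Rightarrow> nat \<Rightarrow> real \<Rightarrow> conf \<Rightarrow> bool" where
  "Gi R j g c \<longleftrightarrow> st c j \<noteq> 0 \<and> (st c j = 1 \<longrightarrow> g \<le> Zc c + dd c j - qc c j * p j) \<and>
     (\<forall>\<zeta>. fz c j = Some \<zeta> \<longrightarrow> g + R j * p j \<le> \<zeta>)"

lemma Gi_insj:
  assumes "invA R c" "l < n" "Gi R j g c"
  shows "Gi R j g (insj l c)"
proof (cases "st c l = 0 \<and> r l \<le> tm c")
  case True
  note e = insj_eqs[OF conjunct1[OF True] conjunct2[OF True]]
  have "j \<noteq> l" using assms(3) True by (auto simp: Gi_def)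
  thus ?thesis using assms(3) e(10)[of j] insj_Z[OF assms(1,2)] by (auto simp: Gi_def e)
qed (simp add: insj_id assms)

lemma Gi_tick:
  assumes "invA R c" "Gi R j g c"
  shows "Gi R j g (tick R l c)"
proof (cases "l = j \<and> st c j = 1")
  case True
  have "0 \<le> dd c j" "fz c j = None" using invAD(3,8)[OF assms(1)] True by auto
  thus ?thesis using assms(2) True
    by (auto simp: Gi_def tick_def Zc_def algebra_simps)
next
  case False
  thus ?thesis using assms(2) by (auto simp: Gi_def tick_def Zc_def)
qed

lemma Gi_starti:
  assumes "invA R c" "Gi R j g c"
  shows "Gi R j g (starti i c)"
proof -
  define b where "b = (if pend c i = 0 then best c else pend c i)"
  note e = starti_eqs[where c = c and i = i, folded b_def]
  show ?thesis
  proof (cases "bu c i \<le> tm c \<and> b \<noteq> 0")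
    case True
    hence "st (starti i c) = (st c)(b - 1 := 4)" using e(2) by simp
    thus ?thesis using assms(2) by (auto simp: Gi_def e(3-10))
  qed (use e(1) assms in simp)
qed

lemma Gi_wait: "Gi R j g c \<Longrightarrow> Gi R j g (wait c)"
  using wtime_ge[of c] by (auto simp: Gi_def wait_Z wait_eqs)

lemma upt_split: "j < b \<Longrightarrow> [0..<b] = [0..<j] @ j # [Suc j..<b]"
  using upt_add_eq_append[of 0 j "b - j"] upt_conv_Cons[of j b] by simp

lemma fold_inv: "Q c \<Longrightarrow> (\<And>x c. x \<in> set xs \<Longrightarrow> Q c \<Longrightarrow> Q (f x c)) \<Longrightarrow> Q (fold f xs c)"
  by (induction xs arbitrary: c) auto

lemma Gi_ph3_wait:
  assumes "invA R c" "Gi R j g c"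
  shows "Gi R j g (wait (ph3 c))"
proof -
  have "invA R (fold starti [0..<m] c) \<and> Gi R j g (fold starti [0..<m] c)"
    by (rule fold_inv) (use assms starti_invA Gi_starti in auto)
  thus ?thesis by (simp add: ph3_def Gi_wait)
qed

lemma Gi_body:
  assumes "invA R c" "Gi R j g c"
  shows "Gi R j g (body R c)"
proof -
  have 1: "invA R (ph1 c) \<and> Gi R j g (ph1 c)" unfolding ph1_def
    by (rule fold_inv) (use assms insj_invA Gi_insj in auto)
  have 2: "invA R (ph2 R (ph1 c)) \<and> Gi R j g (ph2 R (ph1 c))" unfolding ph2_def
    by (rule fold_inv) (use 1 tick_invA Gi_tick in auto)
  thus ?thesis using Gi_ph3_wait by (simp add: body_ph)
qed

lemma fz_body: "invA R c \<Longrightarrow> fz c j = Some \<zeta> \<Longrightarrow> fz (body R c) j = Some \<zeta>"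
proof -
  assume a: "invA R c" "fz c j = Some \<zeta>"
  have 1: "invA R (ph1 c) \<and> fz (ph1 c) j = Some \<zeta>" unfolding ph1_def
    by (rule fold_inv) (use a insj_invA in \<open>auto simp: insj_def Let_def\<close>)
  have 2: "invA R (ph2 R (ph1 c)) \<and> fz (ph2 R (ph1 c)) j = Some \<zeta>" unfolding ph2_def
  proof (rule fold_inv)
    fix l c assume "l \<in> set [0..<n]" "invA R c \<and> fz c j = Some \<zeta>"
    thus "invA R (tick R l c) \<and> fz (tick R l c) j = Some \<zeta>"
      using tick_invA[of R c l] invAD(3)[of R c l] by (auto simp: tick_def)
  qed (use 1 in simp)
  have "fz (fold starti [0..<m] (ph2 R (ph1 c))) j = Some \<zeta>"
    by (rule fold_inv) (use 2 in \<open>auto simp: starti_def Let_def\<close>)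
  thus ?thesis by (simp add: body_ph ph3_def wait_eqs)
qed

lemma tick_cong: "l \<noteq> j \<Longrightarrow> tick (R(j := v)) l c = tick R l c"
  by (simp add: tick_def)

lemma fold_tick_cong: "j \<notin> set xs \<Longrightarrow> fold (tick (R(j := v))) xs c = fold (tick R) xs c"
  by (induction xs arbitrary: c) (auto simp: tick_cong)

lemma tick_fz_other: "l \<noteq> j \<Longrightarrow> fz (tick R l c) j = fz c j"
  by (simp add: tick_def)

text \<open>The two runs differ first at the tick of \<open>j\<close> with \<open>qc = v\<close>:
  one fires, the other begins a further period. This tick raises \<open>dd\<close> and
  \<open>qc * p j\<close> alike, so in the other run \<open>Zc + dd - qc * p j\<close> is still
  \<open>\<zeta> - v * p j\<close>.\<close>

lemma body_coupling:
  fixes v v' :: nat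
  assumes R: "invA R c" "R j = v" "v < v'" and j: "j < n" and f: "fz c j = None"
    and inv': "invA (R(j := v')) c"
  shows "fz (body R c) j = None \<Longrightarrow> body (R(j := v')) c = body R c"
    "fz (body R c) j = Some \<zeta> \<Longrightarrow> Gi (R(j := v')) j (\<zeta> - v * p j) (body (R(j := v')) c)"
proof -
  let ?R = "R(j := v')"
  \<comment> \<open>The state just before the tick of \<open>j\<close>, common to both runs. After
    this tick only \<open>Gi\<close> is followed.\<close>
  define c2 where "c2 = fold (tick R) [0..<j] (ph1 c)"
  have sp: "[0..<n] = [0..<j] @ j # [Suc j..<n]" using upt_split[OF j] .
  have p2: "ph2 R (ph1 c) = fold (tick R) [Suc j..<n] (tick R j c2)"
    unfolding ph2_def sp by (simp add: c2_def)
  have p2': "ph2 ?R (ph1 c) = fold (tick R) [Suc j..<n] (tick ?R j c2)"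
    unfolding ph2_def sp by (simp add: c2_def fold_tick_cong)
  have i1: "invA R (ph1 c) \<and> fz (ph1 c) j = None" unfolding ph1_def
    by (rule fold_inv) (use R(1) f insj_invA in \<open>auto simp: insj_def Let_def\<close>)
  have i2: "invA R c2 \<and> fz c2 j = None" unfolding c2_def
    by (rule fold_inv) (use i1 tick_invA j tick_fz_other in auto)
  have i1': "invA ?R (ph1 c)" unfolding ph1_def
    by (rule fold_inv[where Q = "invA ?R", OF inv'], rule insj_invA) simp_all
  have i2': "invA ?R c2"
  proof -
    have "invA ?R (fold (tick ?R) [0..<j] (ph1 c))"
      by (rule fold_inv[where Q = "invA ?R", OF i1'], rule tick_invA) (use j in simp_all)
    thus ?thesis by (simp add: c2_def fold_tick_cong)
  qed
  have fz_body: "fz (body R c) j = fz (tick R j c2) j"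
  proof -
    have "fz (fold (tick R) [Suc j..<n] (tick R j c2)) j = fz (tick R j c2) j"
      by (rule fold_inv[where Q = "\<lambda>c. fz c j = fz (tick R j c2) j"]) (auto simp: tick_fz_other)
    moreover have "fz (fold starti [0..<m] (ph2 R (ph1 c))) j = fz (ph2 R (ph1 c)) j"
      by (rule fold_inv[where Q = "\<lambda>c'. fz c' j = fz (ph2 R (ph1 c)) j"])
        (auto simp: starti_def Let_def)
    ultimately show ?thesis by (simp add: body_ph ph3_def wait_eqs p2)
  qed
  have q: "qc c2 j \<le> v" using invAD(8)[OF conjunct1[OF i2], of j] R(2) by simp
  show "body ?R c = body R c" if "fz (body R c) j = None"
  proof -
    have "tick ?R j c2 = tick R j c2"
      using that fz_body q R(2,3) by (auto simp: tick_def split: if_splits)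
    thus ?thesis by (simp add: body_ph p2 p2')
  qed
  show "Gi ?R j (\<zeta> - v * p j) (body ?R c)" if fs: "fz (body R c) j = Some \<zeta>"
  proof -
    have act: "st c2 j = 1 \<and> fl (dc c2) \<le> tm c2 \<and> bl c2 (mc (dc c2) j) \<le> 0 \<and> dd c2 j \<le> 0"
      "qc c2 j = v" "\<zeta> = Zc c2"
      using fs fz_body i2 R(2) by (auto simp: tick_def split: if_splits)
    have "Gi ?R j (\<zeta> - v * p j) (tick ?R j c2)"
      using act i2 R(3) by (auto simp: Gi_def tick_def Zc_def algebra_simps)
    moreover have "invA ?R (tick ?R j c2)" using tick_invA[OF i2' j] .
    ultimately have "invA ?R (fold (tick ?R) [Suc j..<n] (tick ?R j c2)) \<and>
        Gi ?R j (\<zeta> - v * p j) (fold (tick ?R) [Suc j..<n] (tick ?R j c2))"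
      by (intro fold_inv[where Q = "\<lambda>c. invA ?R c \<and> Gi ?R j (\<zeta> - v * p j) c"] conjI)
        (simp_all add: tick_invA Gi_tick del: fun_upd_apply)
    hence "invA ?R (ph2 ?R (ph1 c)) \<and> Gi ?R j (\<zeta> - v * p j) (ph2 ?R (ph1 c))"
      by (simp add: p2' fold_tick_cong)
    thus ?thesis using Gi_ph3_wait by (simp add: body_ph)
  qed
qed

text \<open>Two runs agree until the job fires in one of them; then the other run has to wait for the
  remaining ticks.\<close>

lemma coupling:
  assumes R: "\<And>l. R l < k" and v: "v < v'" "v' < k" and j: "j < n"
    and f: "fz (fin (R(j := v))) j = Some \<zeta>" and f': "fz (fin (R(j := v'))) j = Some \<zeta>'"
  shows "\<zeta> + (real v' - real v) * p j \<le> \<zeta>'"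
proof -
  define R1 R2 where "R1 = R(j := v)" and "R2 = R(j := v')"
  have R2: "R1(j := v') = R2" and R1j: "R1 j = v" and R2j: "R2 j = v'"
    by (simp_all add: \<open>R1 = _\<close> \<open>R2 = _\<close>)
  have k: "\<And>l. R1 l < k" "\<And>l. R2 l < k" using R v by (auto simp: \<open>R1 = _\<close> \<open>R2 = _\<close>)
  note f = f[folded \<open>R1 = _\<close>] and f' = f'[folded \<open>R2 = _\<close>]
  define N where "N = nrun R1"
  have ex: "\<exists>i. fz (run R1 (Suc i)) j \<noteq> None"
    using f fin_facts(4)[where R = R1, OF k(1)] unfolding fin_def
    by (metis Suc_pred option.distinct(1))
  \<comment> \<open>The job fires in round \<open>i0\<close> of the first run, so the states at the
    heads of rounds \<open>0\<close> to \<open>i0\<close> agree in both runs.\<close>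
  define i0 where "i0 = (LEAST i. fz (run R1 (Suc i)) j \<noteq> None)"
  have i0: "fz (run R1 (Suc i0)) j \<noteq> None" unfolding i0_def using ex by (rule LeastI_ex)
  have before: "fz (run R1 i) j = None" if "i \<le> i0" for i
  proof (cases i)
    case 0 thus ?thesis by (simp add: c0_def)
  next
    case (Suc i')
    hence "i' < i0" using that by simp
    thus ?thesis using not_less_Least unfolding i0_def Suc by blast
  qed
  have iN: "i0 < N"
  proof -
    have "\<not> N \<le> i0" using before[of N] f by (auto simp: fin_def N_def)
    thus ?thesis by simp
  qed
  have hd: "headI R1 V (run R1 i)" if "i \<le> i0" for i
    using that iN nrun_least[of _ R1] by (intro run_head) (auto simp: N_def)
  have inv: "invA R1 (run R1 i)" if "i \<le> i0" for i
    using hd[OF that] by (simp add: headI_def invC_def)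
  have eq: "run R2 i = run R1 i \<and> headI R2 V (run R2 i)" if "i \<le> i0" for i
    using that
  proof (induction i)
    case 0 show ?case using headI_c0 by simp
  next
    case (Suc i)
    hence "i \<le> i0" by simp
    with Suc.IH have i: "run R2 i = run R1 i" "headI R2 V (run R2 i)" "i \<le> i0" by blast+
    have i': "invA (R2) (run R1 i)" using i by (simp add: headI_def invC_def)
    have "fz (body R1 (run R1 i)) j = None" using before[OF Suc.prems] by simp
    from body_coupling(1)[of R1 _ j v v', unfolded R2, OF inv[OF i(3)] R1j v(1) j before[OF i(3)] i' this]
    have e: "run R2 (Suc i) = run R1 (Suc i)" using i by simp
    have "\<not> allst (run R1 (Suc i))" using nrun_least Suc.prems iN by (simp add: N_def del: run_simps)
    hence "\<not> allst (body R2 (run R2 i))" using e by simp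
    hence h: "headI R2 V (body R2 (run R2 i))" using body(5)[OF i(2) cap V_nonneg] by blast
    show ?case by (rule conjI, rule e, simp only: run_simps, rule h)
  qed
  obtain \<zeta>0 where z0: "fz (body R1 (run R1 i0)) j = Some \<zeta>0" using i0 by auto
  have e0: "run R2 i0 = run R1 i0" and "invA R2 (run R2 i0)"
    using eq[of i0] unfolding headI_def invC_def by blast+
  hence inv': "invA (R2) (run R1 i0)" by simp
  have G: "Gi R2 j (\<zeta>0 - v * p j) (run R2 (Suc i0))"
    using body_coupling(2)[of R1 _ j v v', unfolded R2, OF inv[OF order.refl] R1j v(1) j before[OF order.refl] inv' z0] e0
    by simp
  have late: "fz (run R1 (Suc i0 + d)) j = Some \<zeta>0" if "Suc i0 + d \<le> N" for d
    using that
  proof (induction d)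
    case (Suc d)
    have "headI R1 V (run R1 (Suc i0 + d))"
      using nrun_least[of _ R1] Suc.prems by (intro run_head) (simp add: N_def)
    hence "invA R1 (run R1 (Suc i0 + d))" by (simp add: headI_def invC_def)
    from fz_body[OF this] show ?case using Suc by simp
  qed (use z0 in simp)
  have zz: "\<zeta>0 = \<zeta>" using late[of "N - Suc i0"] iN f by (simp add: fin_def N_def)
  define N' where "N' = nrun R2"
  \<comment> \<open>If the second run had ended by round \<open>i0\<close>, so would have the first
    one, which agrees with it up to there.\<close>
  have iN': "i0 < N'"
  proof (rule ccontr)
    assume "\<not> i0 < N'"
    hence "run R2 N' = run R1 N'" "N' < N" using eq[of N'] iN by auto
    moreover have "allst (run R2 N')" using fin_facts(1)[where R = R2, OF k(2)] by (simp add: fin_def N'_def)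
    ultimately show False using nrun_least[of N' R1] by (simp add: N_def)
  qed
  have lateG: "Gi R2 j (\<zeta>0 - v * p j) (run R2 (Suc i0 + d))" if "Suc i0 + d \<le> N'" for d
    using that
  proof (induction d)
    case (Suc d)
    have "headI R2 V (run R2 (Suc i0 + d))"
      using nrun_least[of _ R2] Suc.prems by (intro run_head) (simp add: N'_def)
    hence "invA R2 (run R2 (Suc i0 + d))" by (simp add: headI_def invC_def)
    from Gi_body[OF this] show ?case using Suc by simp
  qed (use G in simp)
  have "Gi R2 j (\<zeta>0 - v * p j) (fin R2)"
    using lateG[of "N' - Suc i0"] iN' by (simp add: fin_def N'_def)
  hence "\<zeta>0 - v * p j + v' * p j \<le> \<zeta>'" using f' R2j by (simp add: Gi_def)
  thus ?thesis by (simp add: zz algebra_simps)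
qed

text \<open>The firing times for two values are at least their difference times \<open>p j\<close>
  apart, and the window of \<open>hit\<close> is open and has length \<open>12 * p j\<close>. It
  stays in place when \<open>v\<close> varies, since \<open>Zd\<close> does not depend on the random
  numbers.\<close>

lemma hits_le:
  assumes "\<And>l. R l < k" "j < n"
  shows "card {v. v < k \<and> hit (fz (fin (R(j := v)))) \<kappa> j} \<le> 12"
proof -
  let ?H = "{v. v < k \<and> hit (fz (fin (R(j := v)))) \<kappa> j}"
  show ?thesis
  proof (cases "?H = {}")
    case True
    show ?thesis unfolding True by simp
  next
    case False
    define a where "a = Min ?H"
    have fin: "finite ?H" by simp
    have a: "a \<in> ?H" unfolding a_def using Min_in[OF fin False] .
    have "?H \<subseteq> {a..<a + 12}"
    proof
      fix v assume v: "v \<in> ?H"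
      have "a \<le> v" unfolding a_def using Min_le[OF fin v] .
      moreover have "v < a + 12"
      proof (cases "a = v")
        case False
        hence av: "a < v" using \<open>a \<le> v\<close> by simp
        obtain \<zeta> where z: "fz (fin (R(j := a))) j = Some \<zeta>" "Zd \<kappa> - 4 * p j < \<zeta>"
          using a by (auto simp: hit_def)
        obtain \<zeta>' where z': "fz (fin (R(j := v))) j = Some \<zeta>'" "\<zeta>' < Zd \<kappa> + 8 * p j"
          using v by (auto simp: hit_def)
        have "\<zeta> + (real v - real a) * p j \<le> \<zeta>'"
          using coupling[OF assms(1) av _ assms(2) z(1) z'(1)] v by simp
        hence "(real v - real a) * p j < 12 * p j" using z(2) z'(2) by linarith
        hence "real v - real a < 12" using p_pos[OF assms(2)] by simp
        thus ?thesis by linarith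
      qed simp
      ultimately show "v \<in> {a..<a + 12}" by simp
    qed
    hence "card ?H \<le> card {a..<a + 12}" by (intro card_mono) auto
    thus ?thesis by simp
  qed
qed

section \<open>The total flow time of one run\<close>

lemma fin_schedule:
  assumes "\<And>l. R l < k"
  shows "nonpreemptive_schedule J (sch (fin R))"
proof -
  have inv: "invA R (fin R)" using fin_facts(2)[where R = R, OF assms] by (simp add: invC_def)
  note a = invAD[OF inv]
  have "dom (sch (fin R)) = {..<n}"
  proof (intro set_eqI iffI)
    fix l assume "l \<in> dom (sch (fin R))"
    hence "st (fin R) l = 4" using a(15)[of l] by auto
    thus "l \<in> {..<n}" using seen_less[OF inv, of l] by simp
  next
    fix l assume "l \<in> {..<n}"
    hence "st (fin R) l = 4" using fin_facts(1)[where R = R, OF assms] by (simp add: allst_def)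
    thus "l \<in> dom (sch (fin R))" using a(15)[of l] by auto
  qed
  moreover have "i < num_machines J \<and> r l \<le> s" if "sch (fin R) l = Some (i, s)" for l i s
    using a(16)[OF that] by (simp add: m_def)
  ultimately show ?thesis using a(17) unfolding nonpreemptive_schedule_def by blast
qed

text \<open>After its time in the slot, a fired job takes at most \<open>2 * p l\<close> more, an
  evicted one at most \<open>(k + 2) * p l\<close> plus its lateness \<open>Y l\<close>. The slot
  times sum up to \<open>7 * k * P\<close>: the countdowns contribute \<open>k\<close>, the busy
  fluid \<open>2 * k\<close> by \<open>m < 2 * hm\<close>, and the blockings
  \<open>4 * k\<close>.\<close>

lemma fin_flow:
  assumes R: "\<And>l. R l < k"
  shows "nonpreemptive_flow J (sch (fin R)) \<le> (8 * k + 2) * P + 4 * n / (m * k) * (P + V) +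
    8 / m * (\<Sum>x<n. \<Sum>l<n. if hit (fz (fin R)) (ky dfin x) l then p l else 0)"
proof -
  define c where "c = fin R"
  note F = fin_facts[where R = R, OF R, folded c_def]
  have inv: "invA R c" and W: "invW c" and B: "invB V c" using F(2) by (auto simp: invC_def)
  note a = invAD[OF inv]
  define H where "H x = (\<Sum>l<n. if hit (fz c) (ky dfin x) l then p l else 0)" for x
  have Hn: "0 \<le> H x" for x unfolding H_def using p_pos by (intro sum_nonneg) (auto simp: less_imp_le)
  have mp: "0 < real m" using m_pos by simp
  define Y where "Y x = 4 / m * ((P + V) / k + 2 * H x)" for x
  have Yn: "0 \<le> Y x" for x using Hn[of x] P_nonneg V_nonneg by (simp add: Y_def)
  have one: "snd (the (sch c l)) + p l - r l \<le> wl c l + (k + 2) * p l + Y l" if l: "l < n" for l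
  proof -
    have s4: "st c l = 4" using F(1) l by (simp add: allst_def)
    then obtain i s where s: "sch c l = Some (i, s)" using a(15)[of l] by auto
    have wl: "wl c l = xt c l - r l" using s4 by (simp add: wl_def)
    have pl: "0 < p l" using p_pos l by simp
    hence kp: "0 \<le> k * p l" by simp
    have s': "snd (the (sch c l)) = s" using s by simp
    have k2: "real (k + 2) * p l = k * p l + 2 * p l" by (simp add: algebra_simps)
    show ?thesis
    proof (cases "fz c l = None")
      case False
      hence "s \<le> xt c l + p l" using a(16)[OF s] by blast
      thus ?thesis unfolding s' k2 using wl pl kp Yn[of l] by linarith
    next
      case True
      have "m * (s - ky dfin l) \<le> 4 * ((P + V) / k + 2 * H l)"
        using B[unfolded invB_def, rule_format, OF s True] unfolding H_def F(3) .
      hence "(s - ky dfin l) \<le> 4 * ((P + V) / k + 2 * H l) / m"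
        using mp by (simp add: pos_le_divide_eq mult.commute)
      hence "s \<le> ky dfin l + Y l" by (simp add: Y_def)
      moreover have "ky dfin l \<le> xt c l + k * p l" using a(18)[of l] s4 True F(3) by simp
      ultimately show ?thesis unfolding s' k2 using wl pl by linarith
    qed
  qed
  have "nonpreemptive_flow J (sch c) \<le> (\<Sum>l<n. wl c l + (k + 2) * p l + Y l)"
    unfolding nonpreemptive_flow_def using one by (intro sum_mono) auto
  also have "\<dots> = (\<Sum>l<n. wl c l) + (k + 2) * P + (\<Sum>l<n. Y l)"
    by (simp add: sum.distrib P_def sum_distrib_left)
  finally have 1: "nonpreemptive_flow J (sch c) \<le> (\<Sum>l<n. wl c l) + (k + 2) * P + (\<Sum>l<n. Y l)" .
  have "(\<Sum>l<n. Y l) = 4 * n / (m * k) * (P + V) + 8 / m * (\<Sum>x<n. H x)"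
  proof -
    have "Y l = 4 / m * ((P + V) / k) + 8 / m * H l" for l by (simp add: Y_def algebra_simps)
    hence "(\<Sum>l<n. Y l) = n * (4 / m * ((P + V) / k)) + 8 / m * (\<Sum>l<n. H l)"
      by (simp add: sum.distrib flip: sum_distrib_left sum_divide_distrib)
    thus ?thesis by simp
  qed
  moreover have "(\<Sum>l<n. wl c l) \<le> 7 * k * P"
  proof -
    have "(\<Sum>l<n. qc c l * p l - dd c l) \<le> (\<Sum>l<n. k * p l)"
    proof (rule sum_mono)
      fix l assume l: "l \<in> {..<n}"
      have "qc c l \<le> k" "0 \<le> dd c l" using a(8)[of l] R[of l] by linarith+
      moreover have "real (qc c l) * p l \<le> k * p l"
        using calculation p_pos[of l] l by (intro mult_right_mono) auto
      ultimately show "qc c l * p l - dd c l \<le> k * p l" by simp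
    qed
    also have "\<dots> = k * P" by (simp add: P_def sum_distrib_left)
    finally have w1: "(\<Sum>l<n. qc c l * p l - dd c l) \<le> k * P" .
    have "sm (dc c) = (\<Sum>j<n. esd j)"
      using dinvD(14)[OF dinv_dfin] F(3) by (simp add: esd_def)
    hence smP: "sm (dc c) \<le> P" using esd_le by (auto simp: P_def intro: sum_mono)
    have "tm c - Zc c \<le> sm (dc c) / hm" by (simp add: Zc_def)
    also have "\<dots> \<le> P / hm" using smP by (intro divide_right_mono) auto
    finally have "m * k * (tm c - Zc c) \<le> m * k * (P / hm)" by (intro mult_left_mono) auto
    also have "\<dots> \<le> 2 * hm * k * (P / hm)"
      using m_less P_nonneg by (intro mult_right_mono) (simp_all flip: of_nat_mult)
    also have "\<dots> = 2 * k * P" using hm_pos by simp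
    finally have w2: "m * k * (tm c - Zc c) \<le> 2 * k * P" .
    have "(\<Sum>l<n. if fz c l = None then 0 else 4 * p l) \<le> (\<Sum>l<n. 4 * p l)"
      using p_pos by (intro sum_mono) (auto simp: less_imp_le)
    also have "\<dots> = 4 * P" by (simp add: P_def sum_distrib_left)
    finally have "(\<Sum>l<n. if fz c l = None then 0 else 4 * p l) - (\<Sum>i<m. bl c i) \<le> 4 * P"
      using a(9) sum_nonneg[of "{..<m}" "bl c"] by simp
    hence "k * ((\<Sum>l<n. if fz c l = None then 0 else 4 * p l) - (\<Sum>i<m. bl c i)) \<le> k * (4 * P)"
      by (intro mult_left_mono) auto
    thus ?thesis using W w1 w2 unfolding invW_def by linarith
  qed
  ultimately show ?thesis using 1 unfolding c_def[symmetric] H_def by (simp add: algebra_simps)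
qed

end


section \<open>Lower bounds on the optimum\<close>

text \<open>The clipped lengths are Lebesgue measures of disjoint subsets of the interval; half-open
  pieces are disjoint even where they touch.\<close>

lemma clipped_sum:
  fixes T :: "('a \<times> real \<times> real) set"
  assumes "finite T" "u \<le> v"
    and disj: "\<And>j a b l c d. (j, a, b) \<in> T \<Longrightarrow> (l, c, d) \<in> T \<Longrightarrow> (j, a, b) \<noteq> (l, c, d) \<Longrightarrow>
      b \<le> c \<or> d \<le> a"
  shows "(\<Sum>(j, a, b)\<in>T. max 0 (min b v - max a u)) \<le> v - u"
proof -
  define I where "I = (\<lambda>(j :: 'a, a, b). {max a u..<min b v})"
  have m: "measure lborel (I x) = (case x of (j, a, b) \<Rightarrow> max 0 (min b v - max a u))" for x
  proof (cases x)
    case (fields j a b)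
    show ?thesis
    proof (cases "max a u \<le> min b v")
      case False
      hence e: "{max a u..<min b v} = {}" by auto
      have "min b v - max a u \<le> 0" using False by linarith
      thus ?thesis unfolding fields I_def prod.case e by (simp only: measure_empty max_absorb1)
    qed (simp add: fields I_def measure_def)
  qed
  have "disjoint_family_on I T"
    unfolding disjoint_family_on_def I_def using disj by fastforce
  hence "measure lborel (\<Union>x\<in>T. I x) = (\<Sum>x\<in>T. measure lborel (I x))"
    using assms(1)
  proof (intro measure_finite_Union)
    fix x assume "x \<in> T"
    obtain j a b where x: "x = (j, a, b)" by (cases x)
    show "emeasure lborel (I x) \<noteq> \<infinity>"
    proof (cases "max a u \<le> min b v")
      case False
      hence e: "{max a u..<min b v} = {}" by auto
      show ?thesis unfolding x I_def prod.case e by simp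
    qed (simp add: x I_def)
  qed (auto simp: I_def split: prod.splits)
  moreover have "measure lborel (\<Union>x\<in>T. I x) \<le> measure lborel {u..v}"
    using assms(1,2) by (intro measure_mono_fmeasurable)
      (auto simp: I_def fmeasurable_def emeasure_lborel_Icc split: prod.splits)
  ultimately show ?thesis using assms(2) by (simp add: m case_prod_unfold)
qed

section \<open>An arbitrary preemptive schedule\<close>

locale preemptive =
  fixes J :: problem and M :: "nat \<Rightarrow> nat" and Q :: "nat \<Rightarrow> (real \<times> real) set"
  assumes valid: "valid_problem J" and sched: "preemptive_schedule J M Q"
begin

definition C :: "nat \<Rightarrow> real" where "C j = Max (snd ` Q j)"
text \<open>The work done on \<open>j\<close> between \<open>u\<close> and \<open>v\<close>.\<close>

definition wk :: "real \<Rightarrow> real \<Rightarrow> nat \<Rightarrow> real" where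
  "wk u v j = (\<Sum>(a, b)\<in>Q j. max 0 (min b v - max a u))"

lemma Q:
  assumes "j < num_jobs J"
  shows "M j < num_machines J" "finite (Q j)" "Q j \<noteq> {}" "(\<Sum>(a, b)\<in>Q j. b - a) = proc J j"
    "(a, b) \<in> Q j \<Longrightarrow> release J j \<le> a \<and> a < b \<and> b \<le> C j"
proof -
  have s: "M j < num_machines J" "finite (Q j)" "\<forall>(a, b)\<in>Q j. release J j \<le> a \<and> a < b"
    "(\<Sum>(a, b)\<in>Q j. b - a) = proc J j"
    using sched assms unfolding preemptive_schedule_def by blast+
  thus "M j < num_machines J" "finite (Q j)" "(\<Sum>(a, b)\<in>Q j. b - a) = proc J j" by auto
  show "Q j \<noteq> {}" using s(4) valid assms by (auto simp: valid_problem_def)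
  show "release J j \<le> a \<and> a < b \<and> b \<le> C j" if "(a, b) \<in> Q j"
    using s that by (auto simp: C_def intro!: Max_ge image_eqI[of _ snd "(a, b)"])
qed

lemma disj:
  assumes "j < num_jobs J" "l < num_jobs J" "M j = M l" "(a, b) \<in> Q j" "(c, d) \<in> Q l"
    "(j, a, b) \<noteq> (l, c, d)"
  shows "b \<le> c \<or> d \<le> a"
proof -
  have "\<forall>(a, b)\<in>Q j. \<forall>(c, d)\<in>Q l. M j = M l \<and> (j, a, b) \<noteq> (l, c, d) \<longrightarrow> b \<le> c \<or> d \<le> a"
    using sched assms(1,2) by (simp add: preemptive_schedule_def)
  from bspec[OF this assms(4)]
  have "\<forall>(c, d)\<in>Q l. M j = M l \<and> (j, a, b) \<noteq> (l, c, d) \<longrightarrow> b \<le> c \<or> d \<le> a" by simp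
  from bspec[OF this assms(5)] show ?thesis using assms(3,6) by simp
qed

lemma wk_nonneg: "0 \<le> wk u v j"
  unfolding wk_def by (intro sum_nonneg) auto

lemma wk_le:
  assumes "u \<le> v" "S \<subseteq> {..<num_jobs J}" "\<And>j l. j \<in> S \<Longrightarrow> l \<in> S \<Longrightarrow> M j = M l"
  shows "(\<Sum>j\<in>S. wk u v j) \<le> v - u"
proof -
  have fS: "finite S" using assms(2) finite_subset by blast
  have fQ: "\<forall>j\<in>S. finite (Q j)" using assms(2) Q(2) by auto
  have "(\<Sum>j\<in>S. wk u v j) = (\<Sum>(j, a, b)\<in>Sigma S Q. max 0 (min b v - max a u))"
    unfolding wk_def using sum.Sigma[OF fS fQ] by (simp add: case_prod_unfold)
  also have "\<dots> \<le> v - u"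
  proof (rule clipped_sum)
    show "finite (Sigma S Q)" using fS fQ by auto
    fix j a b l c d
    assume "(j, a, b) \<in> Sigma S Q" "(l, c, d) \<in> Sigma S Q" "(j, a, b) \<noteq> (l, c, d)"
    thus "b \<le> c \<or> d \<le> a" using disj[of j l a b c d] assms by auto
  qed (rule assms(1))
  finally show ?thesis .
qed

text \<open>Besides the number of machines, the number of jobs limits the speed, as a job never runs
  in parallel with itself. This matches the cap of \<open>m\<close> at \<open>n\<close>.\<close>

lemma wk_total:
  fixes u v :: real
  assumes "u \<le> v"
  shows "(\<Sum>j<num_jobs J. wk u v j) \<le> min (num_jobs J) (num_machines J) * (v - u)"
proof -
  have "(\<Sum>j<num_jobs J. wk u v j) \<le> (\<Sum>j<num_jobs J. v - u)"
    using wk_le[OF assms, of "{j}" for j] by (intro sum_mono) auto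
  hence 1: "(\<Sum>j<num_jobs J. wk u v j) \<le> num_jobs J * (v - u)" by simp
  have "(\<Sum>j<num_jobs J. wk u v j) =
      (\<Sum>i<num_machines J. \<Sum>j\<in>{x \<in> {..<num_jobs J}. M x = i}. wk u v j)"
    using Q(1) by (intro sum.group[symmetric]) auto
  also have "\<dots> \<le> (\<Sum>i<num_machines J. v - u)"
    by (intro sum_mono wk_le[OF assms]) auto
  finally have 2: "(\<Sum>j<num_jobs J. wk u v j) \<le> num_machines J * (v - u)" by simp
  show ?thesis using 1 2 by (simp add: min_def)
qed

lemma wk_complete:
  assumes "j < num_jobs J" "u \<le> release J j" "C j \<le> v"
  shows "wk u v j = proc J j"
proof -
  have "wk u v j = (\<Sum>(a, b)\<in>Q j. b - a)"
    unfolding wk_def using Q(5)[OF assms(1)] assms(2,3) by (intro sum.cong) fastforce+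
  thus ?thesis using Q(4)[OF assms(1)] by simp
qed

lemma C_ge: assumes "j < num_jobs J" shows "release J j + proc J j \<le> C j"
proof -
  obtain a b where "(a, b) \<in> Q j" using Q(3)[OF assms] by auto
  hence "release J j \<le> C j" using Q(5)[OF assms] by fastforce
  hence "wk (release J j) (C j) j \<le> C j - release J j"
    using wk_le[of "release J j" "C j" "{j}"] assms by simp
  thus ?thesis using wk_complete[OF assms order.refl order.refl] by simp
qed

lemma flow_eq: "preemptive_flow J Q = (\<Sum>j<num_jobs J. C j - release J j)"
  by (simp add: preemptive_flow_def C_def)

lemma proc_le_flow: "(\<Sum>j<num_jobs J. proc J j) \<le> preemptive_flow J Q"
  unfolding flow_eq by (rule sum_mono) (use C_ge in \<open>fastforce\<close>)

text \<open>A job whose part is due by \<open>v\<close> either completes by \<open>v\<close>, so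
  that its whole size was processed between \<open>u\<close> and \<open>v\<close>, or its flow time
  exceeds \<open>k * e j\<close>.\<close>

lemma due_volume:
  fixes u v :: real and k :: nat and e :: "nat \<Rightarrow> real"
  assumes "0 < k" "u \<le> v" "\<And>j. j < num_jobs J \<Longrightarrow> 0 \<le> e j \<and> e j \<le> proc J j"
  shows "(\<Sum>j<num_jobs J. if u \<le> release J j \<and> release J j + k * e j \<le> v then e j else 0) \<le>
    min (num_jobs J) (num_machines J) * (v - u) + preemptive_flow J Q / k"
proof -
  have "(\<Sum>j<num_jobs J. if u \<le> release J j \<and> release J j + k * e j \<le> v then e j else 0) \<le>
      (\<Sum>j<num_jobs J. wk u v j + (C j - release J j) / k)"
  proof (rule sum_mono)
    fix j assume "j \<in> {..<num_jobs J}"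
    hence j: "j < num_jobs J" by simp
    have p: "0 \<le> proc J j" using assms(3)[OF j] by simp
    hence f: "0 \<le> (C j - release J j) / k" using C_ge[OF j] by simp
    show "(if u \<le> release J j \<and> release J j + k * e j \<le> v then e j else 0) \<le>
        wk u v j + (C j - release J j) / k"
    proof (cases "u \<le> release J j \<and> release J j + k * e j \<le> v")
      case c: True
      show ?thesis
      proof (cases "C j \<le> v")
        case True
        thus ?thesis using c wk_complete[OF j] assms(3)[OF j] f by simp
      next
        case False
        hence "k * e j \<le> C j - release J j" using c by simp
        hence "e j \<le> (C j - release J j) / k" using assms(1) by (simp add: field_simps)
        thus ?thesis using c wk_nonneg[of u v j] by simp
      qed
    next
      case False
      thus ?thesis unfolding if_not_P[OF False] using f wk_nonneg[of u v j] by simp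
    qed
  qed
  also have "\<dots> = (\<Sum>j<num_jobs J. wk u v j) + preemptive_flow J Q / k"
    by (simp add: flow_eq sum.distrib sum_divide_distrib)
  finally show ?thesis using wk_total[OF assms(2)] by linarith
qed

end

text \<open>The infimum in \<open>OPT\<close> is meaningful only over a nonempty set. The witness
  runs all jobs one by one on machine 0, beginning at the sum of the release times, which no release
  time exceeds.\<close>

lemma preemptive_schedule_exists:
  assumes "valid_problem J"
  shows "\<exists>M Q. preemptive_schedule J M Q"
proof -
  let ?n = "num_jobs J"
  have pos: "\<And>j. j < ?n \<Longrightarrow> 0 \<le> release J j" "\<And>j. j < ?n \<Longrightarrow> 0 < proc J j"
    using assms by (auto simp: valid_problem_def)
  define t where "t j = (\<Sum>l<?n. release J l) + (\<Sum>l<j. proc J l)" for j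
  have step: "t (Suc j) = t j + proc J j" for j by (simp add: t_def)
  have mono: "t i \<le> t j" if "i \<le> j" "j \<le> ?n" for i j
    using that pos(2) by (auto simp: t_def less_imp_le intro!: sum_mono2)
  have "release J j \<le> t j" if "j < ?n" for j
  proof -
    have "release J j \<le> (\<Sum>l<?n. release J l)" using that pos(1) by (intro member_le_sum) auto
    moreover have "0 \<le> (\<Sum>l<j. proc J l)" using that pos(2) by (intro sum_nonneg) (auto simp: less_imp_le)
    ultimately show ?thesis by (simp add: t_def)
  qed
  moreover have "t (Suc j) \<le> t l \<or> t (Suc l) \<le> t j" if "j \<noteq> l" "j < ?n" "l < ?n" for j l
    using that mono[of "Suc j" l] mono[of "Suc l" j] by linarith
  moreover have "0 < num_machines J" using assms by (simp add: valid_problem_def)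
  ultimately have "preemptive_schedule J (\<lambda>_. 0) (\<lambda>j. {(t j, t (Suc j))})"
    using pos(2) unfolding preemptive_schedule_def by (auto simp: step) metis
  thus ?thesis by blast
qed

lemma OPT_greatest:
  assumes "valid_problem J" "\<And>M Q. preemptive_schedule J M Q \<Longrightarrow> x \<le> preemptive_flow J Q"
  shows "x \<le> OPT J"
  unfolding OPT_def using assms preemptive_schedule_exists[OF assms(1)]
  by (intro cInf_greatest) blast+

lemma sum_proc_le_OPT: "valid_problem J \<Longrightarrow> (\<Sum>j<num_jobs J. proc J j) \<le> OPT J"
  by (rule OPT_greatest) (auto intro!: preemptive.proc_le_flow simp: preemptive_def)

text \<open>The optimum is an infimum, so a bound has to be brought into the form
  \<open>x \<le> OPT J\<close> with \<open>x\<close> independent of the schedule; this is why the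
  inequality is multiplied by \<open>k\<close>.\<close>

lemma (in flow) flow_opt_OPT: "flow_opt J k hm (OPT J)"
proof unfold_locales
  show "P \<le> OPT J" using sum_proc_le_OPT[OF valid] by (simp add: P_def)
  show "capacity (OPT J)"
    unfolding capacity_def
  proof (intro allI impI)
    fix u \<kappa> :: real and e :: "nat \<Rightarrow> real"
    assume h: "0 \<le> u" "u \<le> \<kappa>" "\<forall>j<n. 0 \<le> e j \<and> e j \<le> p j"
    let ?S = "\<Sum>j<n. if u \<le> r j \<and> r j + k * e j \<le> \<kappa> then e j else 0"
    have "k * (?S - m * (\<kappa> - u)) \<le> OPT J"
    proof (rule OPT_greatest[OF valid])
      fix M Q assume "preemptive_schedule J M Q"
      hence "preemptive J M Q" using valid by (simp add: preemptive_def)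
      from preemptive.due_volume[OF this k_pos h(2), of e]
      have "?S - m * (\<kappa> - u) \<le> preemptive_flow J Q / k" using h(3) by (simp add: m_def)
      thus "k * (?S - m * (\<kappa> - u)) \<le> preemptive_flow J Q"
        using k_pos by (simp add: pos_le_divide_eq mult.commute)
    qed
    hence "?S - m * (\<kappa> - u) \<le> OPT J / k" using k_pos by (simp add: pos_le_divide_eq mult.commute)
    thus "?S \<le> m * (\<kappa> - u) + OPT J / k" by simp
  qed
qed


section \<open>The program\<close>

text \<open>The arrays \<open>''in''\<close>, \<open>''q''\<close>, \<open>''d''\<close> and
  \<open>''pe''\<close> hold the fields \<open>ins\<close>, \<open>qc\<close>, \<open>dd\<close> and
  \<open>pend\<close>, the first as 0 or 1; \<open>''ns''\<close> counts the started jobs. The names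
  \<open>''w''\<close>, \<open>''y''\<close>, \<open>''b''\<close>, \<open>''t''\<close> and
  \<open>''nx''\<close> are scratch space.\<close>

abbreviation "Vl \<equiv> iscal ''l''"
abbreviation "Vi \<equiv> iscal ''i''"
abbreviation "Vy \<equiv> iscal ''y''"
abbreviation "Vb \<equiv> iscal ''b''"
abbreviation "St x \<equiv> IVar ''st'' x"
abbreviation "R0 \<equiv> RNat (IConst 0)"

definition argmin_com :: com where
  "argmin_com = For ''i'' NumJobs
     (Cond (BAnd (IEq (IVar ''in'' Vi) (IConst 1)) (RLess (Proc Vi) (Proc Vy))) (iset ''y'' Vi) Skip)"

text \<open>Division by \<open>hm = 2 ^ f\<close>; in the same way \<open>double_com\<close>
  multiplies by \<open>k = 2 ^ e\<close>.\<close>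

definition halve_com :: com where
  "halve_com = For ''i'' (iscal ''f'') (rset ''w'' (RHalf (rscal ''w'')))"

definition double_com :: com where
  "double_com = For ''i'' (iscal ''e'') (rset ''w'' (RAdd (rscal ''w'') (rscal ''w'')))"

definition free_com :: com where
  "free_com =
     Seq (IAssign ''in'' Vl (IConst 1))
    (Seq (IAssign ''mc'' Vl (iscal ''um''))
    (Seq (iset ''um'' (IAdd (iscal ''um'') (IConst 1)))
         (Cond (IEq (iscal ''um'') (iscal ''m''))
           (Seq (iset ''um'' (IConst 0)) (iset ''ur'' (IAdd (iscal ''ur'') (IConst 1))))
           Skip)))"

definition swap_com :: com where
  "swap_com =
     Seq (IAssign ''mc'' Vl (IVar ''mc'' Vy))
    (Seq (IAssign ''in'' Vl (IConst 1))
         (IAssign ''in'' Vy (IConst 0)))"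

definition fluid_com :: com where
  "fluid_com =
     Seq (rset ''w'' (Proc Vy))
    (Seq halve_com
    (Seq (Cond (RLess (rscal ''fl'') (Release Vl)) (rset ''fl'' (Release Vl)) Skip)
         (rset ''fl'' (RAdd (rscal ''fl'') (rscal ''w'')))))"

definition deadline_com :: com where
  "deadline_com =
     Seq (rset ''w'' (Proc Vy))
    (Seq double_com
    (Seq (RAssign ''ky'' Vy (RAdd (Release Vl) (rscal ''w'')))
         (Cond (IEq (St Vy) (IConst 1)) (IAssign ''st'' Vy (IConst 3)) Skip)))"

definition evict_com :: com where
  "evict_com =
     Seq (iset ''y'' Vl) (Seq argmin_com (Seq swap_com (Seq fluid_com deadline_com)))"

definition insert_com :: com where
  "insert_com =
     Cond (BAnd (IEq (St Vl) (IConst 0)) (Released Vl))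
       (Seq (IAssign ''st'' Vl (IConst 1))
         (Cond (ILess (iscal ''ur'') (iscal ''k'')) free_com evict_com))
       Skip"

definition fire_com :: com where
  "fire_com =
     Seq (IAssign ''st'' Vl (IConst 2))
    (Seq (rset ''w'' (RAdd (Proc Vl) (Proc Vl)))
    (Seq (RAssign ''bl'' (IVar ''mc'' Vl) (RAdd (rscal ''w'') (rscal ''w'')))
         (IAssign ''pe'' (IVar ''mc'' Vl) (IAdd Vl (IConst 1)))))"

definition step_com :: com where
  "step_com =
     Seq (IAssign ''q'' Vl (IAdd (IVar ''q'' Vl) (IConst 1))) (RAssign ''d'' Vl (Proc Vl))"

definition tick_com :: com where
  "tick_com =
     Cond (BAnd (BAnd (IEq (St Vl) (IConst 1)) (RLe (rscal ''fl'') Clock))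
            (BAnd (RLe (RVar ''bl'' (IVar ''mc'' Vl)) R0) (RLe (RVar ''d'' Vl) R0)))
       (Cond (IEq (IVar ''q'' Vl) (IVar ''R'' Vl)) fire_com step_com)
       Skip"

definition best_com :: com where
  "best_com = For ''l'' NumJobs
     (Cond (BAnd (IEq (St Vl) (IConst 3))
         (BNot (BAnd (BNot (IEq Vb (IConst 0)))
           (BNot (RLess (RVar ''ky'' Vl) (RVar ''ky'' (ISub Vb (IConst 1))))))))
       (iset ''b'' (IAdd Vl (IConst 1))) Skip)"

definition launch_com :: com where
  "launch_com =
     Seq (IAssign ''pe'' Vi (IConst 0))
    (Seq (IAssign ''st'' Vb (IConst 4))
    (Seq (RAssign ''bu'' Vi (RAdd Clock (Proc Vb)))
    (Seq (Start Vb Vi)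
         (iset ''ns'' (IAdd (iscal ''ns'') (IConst 1))))))"

definition choose_com :: com where
  "choose_com = Cond (IEq Vb (IConst 0)) Skip (Seq (iset ''b'' (ISub Vb (IConst 1))) launch_com)"

definition start_com :: com where
  "start_com =
     Cond (RLe (RVar ''bu'' Vi) Clock)
       (Seq (iset ''b'' (IVar ''pe'' Vi))
       (Seq (Cond (IEq Vb (IConst 0)) best_com Skip) choose_com))
       Skip"

text \<open>The value \<open>''nx'' = Clock\<close> stands for no candidate so far; hence the guard
  asks whether \<open>''nx''\<close> is later than the clock before comparing with it.\<close>

definition cand_com :: "rexp \<Rightarrow> com" where
  "cand_com x = Cond (BAnd (RLess Clock x)
       (BNot (BAnd (RLess Clock (rscal ''nx'')) (BNot (RLess x (rscal ''nx''))))))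
     (rset ''nx'' x) Skip"

definition running_b :: bexp where
  "running_b = BAnd (IEq (St Vl) (IConst 1)) (RLe (RVar ''bl'' (IVar ''mc'' Vl)) R0)"

definition scan_com :: com where
  "scan_com =
     Seq (cand_com (RVar ''bu'' Vl))
         (Cond (RLe (rscal ''fl'') Clock)
           (Seq (cand_com (RAdd Clock (RVar ''bl'' Vl)))
             (Cond running_b (cand_com (RAdd Clock (RVar ''d'' Vl))) Skip))
           Skip)"

definition next_com :: com where
  "next_com =
     Seq (rset ''nx'' Clock)
    (Seq (cand_com (rscal ''fl''))
         (For ''l'' NumJobs scan_com))"

definition count_com :: com where
  "count_com =
     Cond running_b (RAssign ''d'' Vl (RSub (RVar ''d'' Vl) (rscal ''w''))) Skip"

definition unblock_com :: com where
  "unblock_com =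
     Cond (RLess R0 (RVar ''bl'' Vl)) (RAssign ''bl'' Vl (RSub (RVar ''bl'' Vl) (rscal ''w''))) Skip"

definition upd_com :: com where
  "upd_com =
     Cond (RLe (rscal ''fl'') (rscal ''t''))
       (Seq (rset ''w'' (RSub Clock (rscal ''t'')))
       (Seq (For ''l'' NumJobs count_com) (For ''l'' (iscal ''m'') unblock_com)))
       Skip"

text \<open>The old time is saved in \<open>''t''\<close>: the update needs the length of the wait,
  and whether the fluid was idle when it began.\<close>

definition wait_com :: com where
  "wait_com =
     Seq next_com
    (Seq (rset ''t'' Clock)
    (Seq (Cond (RLess Clock (rscal ''nx'')) (WaitUntil (rscal ''nx'')) WaitRelease)
         upd_com))"

definition body_com :: com where
  "body_com =
     Seq (For ''l'' NumJobs insert_com)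
    (Seq (For ''l'' NumJobs tick_com)
    (Seq (For ''i'' (iscal ''m'') start_com) wait_com))"

section \<open>The program implements the state machine\<close>

definition same :: "string set \<Rightarrow> state \<Rightarrow> state \<Rightarrow> bool" where
  "same X s s' \<longleftrightarrow> (\<forall>x. x \<notin> X \<longrightarrow> ivar s' x = ivar s x \<and> rvar s' x = rvar s x) \<and>
     clock s' = clock s \<and> started s' = started s \<and> coins s' = coins s"

lemma same_refl: "same X s s"
  by (simp add: same_def)

lemma same_trans: "same X s s' \<Longrightarrow> same X s' s'' \<Longrightarrow> same X s s''"
  by (simp add: same_def)

lemma same_set: "x \<in> X \<Longrightarrow> same X s (set_ivar x i v s)" "x \<in> X \<Longrightarrow> same X s (set_rvar x i a s)"
  by (auto simp: same_def)

lemma same_get: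
  assumes "same X s s'"
  shows "x \<notin> X \<Longrightarrow> ivar s' x = ivar s x" "x \<notin> X \<Longrightarrow> rvar s' x = rvar s x"
    "clock s' = clock s" "started s' = started s" "coins s' = coins s"
  using assms by (simp_all add: same_def)

text \<open>The frame condition is carried by the rule, so \<open>I\<close> has to mention only what
  the loop computes.\<close>

lemma tri_For_same:
  assumes b: "b \<le> N" "ival J e s = b" "x \<in> X"
    and bound: "\<And>s'. same X s s' \<Longrightarrow> ival J e s' = ival J e s"
    and init: "I 0 (set_ivar x 0 0 s)"
    and step: "\<And>i s'. same X s s' \<Longrightarrow> I i s' \<Longrightarrow> ivar s' x 0 = i \<Longrightarrow> i < b \<Longrightarrow>
      tri J N c s' (\<lambda>s''. same X s' s'' \<and> ivar s'' x 0 = i \<and> I (Suc i) (set_ivar x 0 (Suc i) s''))"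
    and fin: "\<And>s'. same X s s' \<Longrightarrow> I b s' \<Longrightarrow> Q s'"
  shows "tri J N (For x e c) s Q"
proof (rule tri_For[where I = "\<lambda>i s'. same X s s' \<and> I i s'" and b = b])
  show "b \<le> N" by (rule b)
  show "same X s (set_ivar x 0 0 s) \<and> I 0 (set_ivar x 0 0 s)" using same_set(1) b(3) init by blast
  fix i s' assume *: "same X s s' \<and> I i s'"
  show "ival J e s' = b" using bound * b(2) by simp
  assume **: "ivar s' x 0 = i" "i < b"
  show "tri J N c s' (\<lambda>s''. ivar s'' x 0 = i \<and> same X s (set_ivar x 0 (Suc i) s'') \<and>
      I (Suc i) (set_ivar x 0 (Suc i) s''))"
    by (rule tri_mono[OF step[of s' i]])
      (use * ** in \<open>blast intro: same_trans same_set(1)[OF b(3)]\<close>)+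
qed (use fin in blast)

lemma halve_tri:
  assumes "ivar s ''f'' 0 = f" "f \<le> N"
    and Q: "\<And>s'. same {''i'', ''w''} s s' \<Longrightarrow> rvar s' ''w'' 0 = rvar s ''w'' 0 / 2 ^ f \<Longrightarrow> Q s'"
  shows "tri J N halve_com s Q"
  unfolding halve_com_def
proof (rule tri_For_same[where X = "{''i'', ''w''}" and b = f and
        I = "\<lambda>i s'. rvar s' ''w'' 0 = rvar s ''w'' 0 / 2 ^ i"])
  fix i and s' :: state assume "rvar s' ''w'' 0 = rvar s ''w'' 0 / 2 ^ i" "ivar s' ''i'' 0 = i"
  thus "tri J N (rset ''w'' (RHalf (rscal ''w''))) s' (\<lambda>s''. same {''i'', ''w''} s' s'' \<and>
      ivar s'' ''i'' 0 = i \<and> rvar (set_ivar ''i'' 0 (Suc i) s'') ''w'' 0 = rvar s ''w'' 0 / 2 ^ Suc i)"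
    by (intro tri_RAssign) (simp add: same_set)
qed (use assms(1,2) Q in \<open>simp_all add: same_get\<close>)

lemma double_tri:
  assumes "ivar s ''e'' 0 = e" "e \<le> N"
    and Q: "\<And>s'. same {''i'', ''w''} s s' \<Longrightarrow> rvar s' ''w'' 0 = 2 ^ e * rvar s ''w'' 0 \<Longrightarrow> Q s'"
  shows "tri J N double_com s Q"
  unfolding double_com_def
proof (rule tri_For_same[where X = "{''i'', ''w''}" and b = e and
        I = "\<lambda>i s'. rvar s' ''w'' 0 = 2 ^ i * rvar s ''w'' 0"])
  fix i and s' :: state assume "rvar s' ''w'' 0 = 2 ^ i * rvar s ''w'' 0" "ivar s' ''i'' 0 = i"
  thus "tri J N (rset ''w'' (RAdd (rscal ''w'') (rscal ''w''))) s' (\<lambda>s''. same {''i'', ''w''} s' s'' \<and>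
      ivar s'' ''i'' 0 = i \<and> rvar (set_ivar ''i'' 0 (Suc i) s'') ''w'' 0 = 2 ^ Suc i * rvar s ''w'' 0)"
    by (intro tri_RAssign) (simp add: same_set)
qed (use assms(1,2) Q in \<open>simp_all add: same_get\<close>)

locale flow_prog = flow_opt +
  fixes e f N :: nat and R :: "nat \<Rightarrow> nat"
  assumes k_eq: "k = 2 ^ e" and hm_eq: "hm = 2 ^ f"
    and N: "n \<le> N" "e \<le> N" "f \<le> N"
    and R: "\<And>l. R l < k"
begin

lemma m_N: "m \<le> N" using m_le_n N by simp

text \<open>The simulation relation. The fields \<open>sm\<close>, \<open>en\<close>,
  \<open>fz\<close> and \<open>xt\<close> belong to the analysis and have no counterpart in the
  program.\<close>

definition rel :: "conf \<Rightarrow> state \<Rightarrow> bool" where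
  "rel c s \<longleftrightarrow>
     ivar s ''in'' = (\<lambda>l. of_bool (l \<in> ins (dc c))) \<and> ivar s ''mc'' = mc (dc c) \<and>
     ivar s ''ur'' 0 = ur (dc c) \<and> ivar s ''um'' 0 = um (dc c) \<and>
     rvar s ''fl'' 0 = fl (dc c) \<and> rvar s ''ky'' = ky (dc c) \<and>
     ivar s ''st'' = st c \<and> ivar s ''q'' = qc c \<and> rvar s ''d'' = dd c \<and> rvar s ''bl'' = bl c \<and>
     ivar s ''pe'' = pend c \<and> rvar s ''bu'' = bu c \<and> clock s = tm c \<and> started s = sch c \<and>
     ivar s ''m'' 0 = m \<and> ivar s ''k'' 0 = k \<and> ivar s ''e'' 0 = e \<and> ivar s ''f'' 0 = f \<and>
     ivar s ''R'' = R \<and> ivar s ''ns'' 0 = card {l. l < n \<and> st c l = 4}"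

lemma rel_same:
  assumes "rel c s" "same X s s'" "X \<subseteq> {''i'', ''w'', ''y'', ''b'', ''l'', ''t'', ''nx''}"
  shows "rel c s'"
proof -
  have "x \<notin> X" if "x \<notin> {''i'', ''w'', ''y'', ''b'', ''l'', ''t'', ''nx''}" for x
    using assms(3) that by blast
  hence "ivar s' x = ivar s x \<and> rvar s' x = rvar s x" if "x \<notin> {''i'', ''w'', ''y'', ''b'', ''l'', ''t'', ''nx''}" for x
    using same_get(1,2)[OF assms(2)] that by blast
  thus ?thesis using assms(1) same_get(3,4)[OF assms(2)] unfolding rel_def by simp
qed

text \<open>\<open>Proc\<close> reads 0 for an invisible job, so the invariant must keep the current
  minimum visible for the comparison to be faithful.\<close>

lemma argmin_tri:
  assumes s: "ivar s ''in'' = (\<lambda>l. of_bool (l \<in> ins d))" "ivar s ''y'' 0 = j" "visible J (clock s) j"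
    "\<And>l. l \<in> ins d \<Longrightarrow> visible J (clock s) l"
    and Q: "\<And>s'. same {''i'', ''y''} s s' \<Longrightarrow> ivar s' ''y'' 0 = dmin d j \<Longrightarrow> Q s'"
  shows "tri J N argmin_com s Q"
  unfolding argmin_com_def
proof (rule tri_For_same[where X = "{''i'', ''y''}" and b = n and
      I = "\<lambda>i s'. ivar s' ''y'' 0 = fold (\<lambda>l y. if l \<in> ins d \<and> p l < p y then l else y) [0..<i] j \<and>
        visible J (clock s) (ivar s' ''y'' 0)"])
  fix i s' assume *: "same {''i'', ''y''} s s'" "ivar s' ''i'' 0 = i" "i < n"
    "ivar s' ''y'' 0 = fold (\<lambda>l y. if l \<in> ins d \<and> p l < p y then l else y) [0..<i] j \<and>
        visible J (clock s) (ivar s' ''y'' 0)"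
  let ?g = "\<lambda>l y. if l \<in> ins d \<and> p l < p y then l else y"
  let ?b = "BAnd (IEq (IVar ''in'' Vi) (IConst 1)) (RLess (Proc Vi) (Proc Vy))"
  let ?R = "\<lambda>s''. same {''i'', ''y''} s' s'' \<and> ivar s'' ''i'' 0 = i \<and>
    (ivar (set_ivar ''i'' 0 (Suc i) s'') ''y'' 0 = fold ?g [0..<Suc i] j \<and>
    visible J (clock s) (ivar (set_ivar ''i'' 0 (Suc i) s'') ''y'' 0))"
  have st: "clock s' = clock s" "ivar s' ''in'' = (\<lambda>l. of_bool (l \<in> ins d))"
    using *(1) s(1) by (auto simp: same_def)
  have b: "bval J ?b s' \<longleftrightarrow>
      i \<in> ins d \<and> p i < p (ivar s' ''y'' 0)"
    using s(4)[of i] conjunct2[OF *(4)] by (cases "i \<in> ins d") (simp_all add: st *(2))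
  show "tri J N (Cond ?b
      (iset ''y'' Vi) Skip) s' ?R"
  proof (rule tri_Cond)
    assume "bval J ?b s'"
    thus "tri J N (iset ''y'' Vi) s' ?R"
      unfolding b using * s(4)[of i] by (intro tri_IAssign) (simp add: same_set)
  next
    assume "\<not> bval J ?b s'"
    thus "tri J N Skip s' ?R"
      unfolding b using * by (intro tri_Skip) (auto simp: same_refl)
  qed
qed (use N s(2,3) Q in \<open>simp_all add: same_get dmin_def\<close>)

lemma insj_st4: "invA R c \<Longrightarrow> (st (insj j c) l = 4) = (st c l = 4)"
  by (auto simp: insj_def Let_def)

lemma swap_tri:
  assumes "rel c s" "ivar s ''l'' 0 = j" "ivar s ''y'' 0 = y"
  shows "tri J N swap_com s (\<lambda>s'. ivar s' ''l'' 0 = j \<and> ivar s' ''y'' 0 = y \<and>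
    rel (c\<lparr>dc := (dc c)\<lparr>ins := insert j (ins (dc c)) - {y}, mc := (mc (dc c))(j := mc (dc c) y)\<rparr>\<rparr>) s')"
  unfolding swap_com_def using assms
  by (intro tri_Seq tri_IAssign) (auto simp: rel_def fun_eq_iff)

lemma fluid_tri:
  assumes "rel c s" "ivar s ''l'' 0 = j" "ivar s ''y'' 0 = y" "visible J (tm c) j" "visible J (tm c) y"
  shows "tri J N fluid_com s (\<lambda>s'. ivar s' ''l'' 0 = j \<and> ivar s' ''y'' 0 = y \<and>
    rel (c\<lparr>dc := (dc c)\<lparr>fl := max (fl (dc c)) (r j) + p y / hm\<rparr>\<rparr>) s')"
  unfolding fluid_com_def
proof (rule tri_Seq, rule tri_RAssign, rule tri_Seq, rule halve_tri)
  let ?s = "set_rvar ''w'' (ival J (IConst 0) s) (rval J (Proc Vy) s) s"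
  have s: "rel c ?s" "ivar ?s ''l'' 0 = j" "ivar ?s ''y'' 0 = y" "rvar ?s ''w'' 0 = p y"
    using assms by (simp_all add: rel_def)
  show "ivar ?s ''f'' 0 = f" using s by (simp add: rel_def)
  show "f \<le> N" by (rule N)
  fix s' assume S: "same {''i'', ''w''} ?s s'" "rvar s' ''w'' 0 = rvar ?s ''w'' 0 / 2 ^ f"
  have s': "rel c s'" "ivar s' ''l'' 0 = j" "ivar s' ''y'' 0 = y" "rvar s' ''w'' 0 = p y / hm"
    using rel_same[OF s(1) S(1)] same_get(1)[OF S(1)] s S(2) by (simp_all add: hm_eq)
  thus "tri J N (Seq (Cond (RLess (rscal ''fl'') (Release Vl)) (rset ''fl'' (Release Vl)) Skip)
         (rset ''fl'' (RAdd (rscal ''fl'') (rscal ''w'')))) s' (\<lambda>s'. ivar s' ''l'' 0 = j \<and>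
      ivar s' ''y'' 0 = y \<and> rel (c\<lparr>dc := (dc c)\<lparr>fl := max (fl (dc c)) (r j) + p y / hm\<rparr>\<rparr>) s')"
    using assms(4)
    by (intro tri_Seq tri_Cond tri_RAssign tri_Skip) (auto simp: rel_def max_def)
qed

text \<open>Changes of \<open>sm\<close>, \<open>en\<close>, \<open>fz\<close> and \<open>xt\<close>
  are silent for the program.\<close>

lemma rel_cong:
  assumes "rel c s" "ins (dc c') = ins (dc c)" "mc (dc c') = mc (dc c)" "ur (dc c') = ur (dc c)"
    "um (dc c') = um (dc c)" "fl (dc c') = fl (dc c)" "ky (dc c') = ky (dc c)" "st c' = st c"
    "qc c' = qc c" "dd c' = dd c" "bl c' = bl c" "pend c' = pend c" "bu c' = bu c" "tm c' = tm c"
    "sch c' = sch c"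
  shows "rel c' s"
  using assms unfolding rel_def by simp

lemma deadline_tri:
  assumes "rel c s" "ivar s ''l'' 0 = j" "ivar s ''y'' 0 = y" "visible J (tm c) j" "visible J (tm c) y"
  shows "tri J N deadline_com s (\<lambda>s'. ivar s' ''l'' 0 = j \<and>
    rel (c\<lparr>dc := (dc c)\<lparr>ky := (ky (dc c))(y := r j + k * p y)\<rparr>,
      st := if st c y = 1 then (st c)(y := 3) else st c\<rparr>) s')"
  unfolding deadline_com_def
proof (rule tri_Seq, rule tri_RAssign, rule tri_Seq, rule double_tri)
  let ?s = "set_rvar ''w'' (ival J (IConst 0) s) (rval J (Proc Vy) s) s"
  have s: "rel c ?s" "ivar ?s ''l'' 0 = j" "ivar ?s ''y'' 0 = y" "rvar ?s ''w'' 0 = p y"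
    using assms by (simp_all add: rel_def)
  show "ivar ?s ''e'' 0 = e" using s by (simp add: rel_def)
  show "e \<le> N" by (rule N)
  fix s' assume S: "same {''i'', ''w''} ?s s'" "rvar s' ''w'' 0 = 2 ^ e * rvar ?s ''w'' 0"
  have s': "rel c s'" "ivar s' ''l'' 0 = j" "ivar s' ''y'' 0 = y" "rvar s' ''w'' 0 = k * p y"
    using rel_same[OF s(1) S(1)] same_get(1)[OF S(1)] s S(2) by (simp_all add: k_eq)
  have ns: "{l. l < n \<and> ((st c)(y := 3)) l = 4} = {l. l < n \<and> st c l = 4}" if "st c y = 1"
    using that by auto
  show "tri J N (Seq (RAssign ''ky'' Vy (RAdd (Release Vl) (rscal ''w'')))
         (Cond (IEq (St Vy) (IConst 1)) (IAssign ''st'' Vy (IConst 3)) Skip)) s'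
    (\<lambda>s'. ivar s' ''l'' 0 = j \<and> rel (c\<lparr>dc := (dc c)\<lparr>ky := (ky (dc c))(y := r j + k * p y)\<rparr>,
      st := if st c y = 1 then (st c)(y := 3) else st c\<rparr>) s')"
  proof (rule tri_Seq, rule tri_RAssign)
    let ?s = "set_rvar ''ky'' (ival J Vy s') (rval J (RAdd (Release Vl) (rscal ''w'')) s') s'"
    let ?c = "c\<lparr>dc := (dc c)\<lparr>ky := (ky (dc c))(y := r j + k * p y)\<rparr>\<rparr>"
    let ?Q = "\<lambda>s'. ivar s' ''l'' 0 = j \<and>
      rel (c\<lparr>dc := (dc c)\<lparr>ky := (ky (dc c))(y := r j + k * p y)\<rparr>,
        st := if st c y = 1 then (st c)(y := 3) else st c\<rparr>) s'"
    have t: "clock s' = tm c" using s'(1) by (simp add: rel_def)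
    have ky: "rval J (RAdd (Release Vl) (rscal ''w'')) s' = r j + k * p y" "ival J Vy s' = y"
      using s' assms(4) t by simp_all
    have rel: "rel ?c ?s" using s'(1) unfolding rel_def ky by simp
    have "tri J N (Cond (IEq (St Vy) (IConst 1)) (IAssign ''st'' Vy (IConst 3)) Skip) s9 ?Q"
      if s9: "rel ?c s9" "ivar s9 ''l'' 0 = j" "ivar s9 ''y'' 0 = y" for s9
    proof (rule tri_Cond)
      have st: "ivar s9 ''st'' = st c" using s9(1) by (simp add: rel_def)
      {
        assume "bval J (IEq (St Vy) (IConst 1)) s9"
        hence y1: "st c y = 1" using s9(3) st by auto
        have "rel (c\<lparr>dc := (dc c)\<lparr>ky := (ky (dc c))(y := r j + k * p y)\<rparr>, st := (st c)(y := 3)\<rparr>)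
            (set_ivar ''st'' y 3 s9)"
          using s9(1) ns[OF y1] unfolding rel_def by simp
        thus "tri J N (IAssign ''st'' Vy (IConst 3)) s9 ?Q"
          unfolding if_P[OF y1] using s9 by (intro tri_IAssign) simp
      next
        assume "\<not> bval J (IEq (St Vy) (IConst 1)) s9"
        hence y1: "st c y \<noteq> 1" using s9(3) st by auto
        show "tri J N Skip s9 ?Q"
          unfolding if_not_P[OF y1]
          by (intro tri_Skip conjI s9(2), rule rel_cong[OF s9(1)]) simp_all
      }
    qed
    from this[OF rel] s' show "tri J N (Cond (IEq (St Vy) (IConst 1)) (IAssign ''st'' Vy (IConst 3)) Skip) ?s ?Q"
      by simp
  qed
qed

lemma insert_tri:
  assumes "rel c s" "invA R c" "ivar s ''l'' 0 = j" "j < n"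
  shows "tri J N insert_com s (\<lambda>s'. ivar s' ''l'' 0 = j \<and> rel (insj j c) s')"
proof -
  note a = invAD[OF assms(2)]
  note r = assms(1)[unfolded rel_def]
  have vis: "visible J (clock s) l \<longleftrightarrow> r l \<le> tm c" if "l < n" for l
    using r that by (simp add: visible_def)
  have b: "bval J (BAnd (IEq (St Vl) (IConst 0)) (Released Vl)) s \<longleftrightarrow> st c j = 0 \<and> r j \<le> tm c"
    using r assms(3) vis[OF assms(4)] by auto
  have ns: "{l. l < n \<and> st (insj j c) l = 4} = {l. l < n \<and> st c l = 4}"
    using insj_st4[OF assms(2)] by simp
  show ?thesis unfolding insert_com_def
  proof (rule tri_Cond, unfold b)
    assume "\<not> (st c j = 0 \<and> r j \<le> tm c)"
    thus "tri J N Skip s (\<lambda>s'. ivar s' ''l'' 0 = j \<and> rel (insj j c) s')"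
      using assms insj_id by (intro tri_Skip) simp
  next
    assume act: "st c j = 0 \<and> r j \<le> tm c"
    define s1 where "s1 = set_ivar ''st'' j 1 s"
    have s1: "ivar s1 ''l'' 0 = j" using assms(3) by (simp add: s1_def)
    show "tri J N (Seq (IAssign ''st'' Vl (IConst 1))
         (Cond (ILess (iscal ''ur'') (iscal ''k'')) free_com evict_com)) s
       (\<lambda>s'. ivar s' ''l'' 0 = j \<and> rel (insj j c) s')"
    proof (rule tri_Seq, rule tri_IAssign, simp only: ival.simps assms(3) s1_def[symmetric], rule tri_Cond)
      assume "bval J (ILess (iscal ''ur'') (iscal ''k'')) s1"
      hence u: "ur (dc c) < k" using r by (simp add: s1_def)
      have eq: "insj j c = c\<lparr>dc := dins j (dc c), st := (st c)(j := 1)\<rparr>"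
        using act u by (simp add: insj_def)
      show "tri J N free_com s1 (\<lambda>s'. ivar s' ''l'' 0 = j \<and> rel (insj j c) s')"
        unfolding free_com_def
        apply (intro tri_Seq tri_IAssign tri_Cond tri_Skip)
        subgoal using r u assms(3) ns unfolding rel_def eq by (auto simp: s1_def dins_def fun_eq_iff)
        subgoal using r u assms(3) ns unfolding rel_def eq by (auto simp: s1_def dins_def fun_eq_iff)
        done
    next
      assume "\<not> bval J (ILess (iscal ''ur'') (iscal ''k'')) s1"
      hence u: "\<not> ur (dc c) < k" using r by (simp add: s1_def)
      define y where "y = dmin (dc c) j"
      note D = dinvD[OF a(1)]
      have yn: "y < n" "r y \<le> tm c"
        using dmin(1)[OF D(4), of j] D(1,4) a(12)[of y] assms(4) act unfolding y_def[symmetric] by auto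
      have eq: "insj j c = (if ((st c)(j := 1)) y = 1
         then c\<lparr>dc := dins j (dc c), st := (st c)(j := 1, y := 3), xt := (xt c)(y := tm c)\<rparr>
         else c\<lparr>dc := dins j (dc c), st := (st c)(j := 1)\<rparr>)"
        using act u by (simp add: insj_def Let_def y_def)
      have deq: "dins j (dc c) = (dc c)\<lparr>ins := insert j (ins (dc c)) - {y},
         mc := (mc (dc c))(j := mc (dc c) y), fl := max (fl (dc c)) (r j) + p y / hm,
         sm := sm (dc c) + p y, en := (en (dc c))(j := Some y), ky := (ky (dc c))(y := r j + k * p y)\<rparr>"
        using u by (simp add: dins_def y_def Let_def)
      have vj: "visible J (tm c) j" and vy: "visible J (tm c) y"
        using act yn assms(4) by (simp_all add: visible_def)
      define c1 where "c1 = c\<lparr>st := (st c)(j := 1)\<rparr>"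
      define s2 where "s2 = set_ivar ''y'' 0 j s1"
      have "{l. l < n \<and> ((st c)(j := 1)) l = 4} = {l. l < n \<and> st c l = 4}" using act by auto
      hence rel2: "rel c1 s2" using r unfolding rel_def by (simp add: s2_def s1_def c1_def)
      have l2: "ivar s2 ''l'' 0 = j" using s1 by (simp add: s2_def)
      show "tri J N evict_com s1 (\<lambda>s'. ivar s' ''l'' 0 = j \<and> rel (insj j c) s')"
        unfolding evict_com_def
      proof (rule tri_Seq, rule tri_IAssign, simp only: ival.simps s1 s2_def[symmetric],
          rule tri_Seq, rule argmin_tri[where d = "dc c" and j = j])
        show "ivar s2 ''in'' = (\<lambda>l. of_bool (l \<in> ins (dc c)))" "ivar s2 ''y'' 0 = j"
          "visible J (clock s2) j"
          using r act vis assms(4) by (auto simp: s2_def s1_def)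
        show "visible J (clock s2) l" if "l \<in> ins (dc c)" for l
        proof -
          have l: "l < n" "st c l \<noteq> 0" using that D(1,4) by auto
          thus ?thesis using r vis[OF l(1)] a(12)[OF l(2)] by (simp add: s2_def s1_def)
        qed
        fix s3 assume S3: "same {''i'', ''y''} s2 s3" "ivar s3 ''y'' 0 = dmin (dc c) j"
        have rel3: "rel c1 s3" using rel_same[OF rel2 S3(1)] by simp
        have l3: "ivar s3 ''l'' 0 = j" "ivar s3 ''y'' 0 = y"
          using same_get(1)[OF S3(1)] S3(2) l2 by (simp_all add: y_def)
        show "tri J N (Seq swap_com (Seq fluid_com deadline_com)) s3
          (\<lambda>s'. ivar s' ''l'' 0 = j \<and> rel (insj j c) s')"
          \<comment> \<open>Each triple describes a partial update of \<open>c1\<close>. Together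
            they yield \<open>insj j c\<close> up to \<open>sm\<close>, \<open>en\<close> and
            \<open>xt\<close>, which \<open>rel_cong\<close> supplies.\<close>
          apply (rule tri_Seq, rule tri_mono[OF swap_tri[OF rel3 l3]])
          apply (rule tri_Seq, rule tri_mono[OF fluid_tri[where j = j and y = y]])
               apply (erule conjunct2[THEN conjunct2])
              apply (erule conjunct1)
             apply (erule conjunct2[THEN conjunct1])
            apply (simp add: c1_def vj)
           apply (simp add: c1_def vy)
          apply (rule tri_mono[OF deadline_tri[where j = j and y = y]])
               apply (erule conjunct2[THEN conjunct2])
              apply (erule conjunct1)
             apply (erule conjunct2[THEN conjunct1])
            apply (simp add: c1_def vj)
           apply (simp add: c1_def vy)
          apply (erule conjE, rule conjI, assumption)
          apply (erule rel_cong; simp add: c1_def eq deq)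
          done
      qed
    qed
  qed
qed

end


context flow_prog
begin

lemma tick_tri:
  assumes "rel c s" "invA R c" "ivar s ''l'' 0 = j" "j < n"
  shows "tri J N tick_com s (\<lambda>s'. ivar s' ''l'' 0 = j \<and> rel (tick R j c) s')"
proof -
  note r = assms(1)[unfolded rel_def]
  note a = invAD[OF assms(2)]
  let ?Q = "\<lambda>s'. ivar s' ''l'' 0 = j \<and> rel (tick R j c) s'"
  let ?i = "mc (dc c) j"
  let ?act = "st c j = 1 \<and> fl (dc c) \<le> tm c \<and> bl c ?i \<le> 0 \<and> dd c j \<le> 0"
  let ?b = "BAnd (BAnd (IEq (St Vl) (IConst 1)) (RLe (rscal ''fl'') Clock))
            (BAnd (RLe (RVar ''bl'' (IVar ''mc'' Vl)) R0) (RLe (RVar ''d'' Vl) R0))"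
  have b: "bval J ?b s \<longleftrightarrow> ?act" using r assms(3) by auto
  show ?thesis unfolding tick_com_def
  proof (rule tri_Cond)
    assume "\<not> bval J ?b s"
    hence "tick R j c = c" unfolding b by (auto simp: tick_def)
    thus "tri J N Skip s ?Q"
      using assms by (intro tri_Skip) simp
  next
    assume "bval J ?b s"
    hence act: ?act unfolding b .
    have v: "visible J (tm c) j" using a(12)[of j] act assms(4) by (simp add: visible_def)
    have qb: "bval J (IEq (IVar ''q'' Vl) (IVar ''R'' Vl)) s \<longleftrightarrow> qc c j = R j" using r assms(3) by auto
    show "tri J N (Cond (IEq (IVar ''q'' Vl) (IVar ''R'' Vl)) fire_com step_com) s ?Q"
    proof (rule tri_Cond)
      assume "bval J (IEq (IVar ''q'' Vl) (IVar ''R'' Vl)) s"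
      hence "qc c j = R j" unfolding qb .
      hence eq: "tick R j c = c\<lparr>st := (st c)(j := 2), bl := (bl c)(?i := 4 * p j),
              pend := (pend c)(?i := Suc j), fz := (fz c)(j := Some (Zc c)),
              xt := (xt c)(j := tm c)\<rparr>" using act by (simp add: tick_def)
      have ns: "{l. l < n \<and> (if l = j then 2 else st c l) = 4} = {l. l < n \<and> st c l = 4}"
        using act by auto
      show "tri J N fire_com s
         ?Q"
        unfolding eq fire_com_def using r assms(3) v ns
        by (intro tri_Seq tri_IAssign tri_RAssign) (simp add: rel_def)
    next
      assume "\<not> bval J (IEq (IVar ''q'' Vl) (IVar ''R'' Vl)) s"
      hence "qc c j \<noteq> R j" unfolding qb .
      hence eq: "tick R j c = c\<lparr>qc := (qc c)(j := Suc (qc c j)), dd := (dd c)(j := p j)\<rparr>"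
        using act by (simp add: tick_def)
      show "tri J N step_com s ?Q"
        unfolding eq step_com_def using r assms(3) v
        by (intro tri_Seq tri_IAssign tri_RAssign) (simp add: rel_def)
    qed
  qed
qed

lemma best_tri:
  assumes "rel c s" "ivar s ''b'' 0 = 0"
    and Q: "\<And>s'. same {''l'', ''b''} s s' \<Longrightarrow> ivar s' ''b'' 0 = best c \<Longrightarrow> Q s'"
  shows "tri J N best_com s Q"
  unfolding best_com_def
proof (rule tri_For_same[where X = "{''l'', ''b''}" and b = n and
      I = "\<lambda>i s'. ivar s' ''b'' 0 = fold (\<lambda>l b. if st c l = 3 \<and> (b = 0 \<or> ky (dc c) l < ky (dc c) (b - 1)) then Suc l else b) [0..<i] 0"])
  let ?g = "\<lambda>l b. if st c l = 3 \<and> (b = 0 \<or> ky (dc c) l < ky (dc c) (b - 1)) then Suc l else b"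
  fix i s' assume *: "same {''l'', ''b''} s s'" "ivar s' ''l'' 0 = i" "ivar s' ''b'' 0 = fold ?g [0..<i] 0"
  have rel: "rel c s'" using rel_same[OF assms(1) *(1)] by simp
  have r: "ivar s' ''st'' = st c" "rvar s' ''ky'' = ky (dc c)" using rel by (simp_all add: rel_def)
  define x where "x = fold ?g [0..<i] 0"
  let ?b = "BAnd (IEq (St Vl) (IConst 3))
         (BNot (BAnd (BNot (IEq Vb (IConst 0)))
           (BNot (RLess (RVar ''ky'' Vl) (RVar ''ky'' (ISub Vb (IConst 1)))))))"
  have b: "bval J ?b s' \<longleftrightarrow> st c i = 3 \<and> (x = 0 \<or> ky (dc c) i < ky (dc c) (x - 1))"
    using r *(2,3) unfolding x_def[symmetric] by auto
  let ?R = "\<lambda>s''. same {''l'', ''b''} s' s'' \<and> ivar s'' ''l'' 0 = i \<and>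
     ivar (set_ivar ''l'' 0 (Suc i) s'') ''b'' 0 = fold ?g [0..<Suc i] 0"
  show "tri J N (Cond ?b (iset ''b'' (IAdd Vl (IConst 1))) Skip) s' ?R"
  proof (rule tri_Cond)
    assume "bval J ?b s'"
    thus "tri J N (iset ''b'' (IAdd Vl (IConst 1))) s' ?R"
      unfolding b x_def using *(2) by (intro tri_IAssign) (simp add: same_set)
  next
    assume "\<not> bval J ?b s'"
    hence nb: "?g i x = x" unfolding b by (rule if_not_P)
    have "fold g [0..<Suc i] 0 = g i (fold g [0..<i] 0)" for g :: "nat \<Rightarrow> nat \<Rightarrow> nat" by simp
    from this[of ?g] have "fold ?g [0..<Suc i] 0 = ?g i x" unfolding x_def .
    also note nb
    finally have fx: "fold ?g [0..<Suc i] 0 = x" .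
    have "ivar s' ''b'' 0 = x" using *(3) by (simp add: x_def)
    thus "tri J N Skip s' ?R"
      unfolding fx using *(2) by (intro tri_Skip) (simp add: same_refl)
  qed
qed (use N assms(2) Q in \<open>simp_all add: best_def\<close>)

lemma start_tri:
  assumes "rel c s" "invA R c" "ivar s ''i'' 0 = i" "i < m"
  shows "tri J N start_com s (\<lambda>s'. ivar s' ''i'' 0 = i \<and> rel (starti i c) s')"
proof -
  note r = assms(1)[unfolded rel_def]
  note a = invAD[OF assms(2)]
  define b where "b = (if pend c i = 0 then best c else pend c i)"
  note e = starti_eqs[where c = c and i = i, folded b_def]
  let ?Q = "\<lambda>s'. ivar s' ''i'' 0 = i \<and> rel (starti i c) s'"
  have fin: "tri J N choose_com s1 ?Q"
    if s1: "rel c s1" "ivar s1 ''i'' 0 = i" "ivar s1 ''b'' 0 = b" and bu: "bu c i \<le> tm c" for s1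
    unfolding choose_com_def
  proof (rule tri_Cond)
    assume "bval J (IEq Vb (IConst 0)) s1"
    hence "b = 0" using s1(3) by simp
    thus "tri J N Skip s1 ?Q" using e(1) s1 by (intro tri_Skip) simp
  next
    assume "\<not> bval J (IEq Vb (IConst 0)) s1"
    hence b0: "b \<noteq> 0" using s1(3) by simp
    note j = starti_job[where i = i, OF assms(2), folded b_def, OF b0]
    define x where "x = b - 1"
    have eq: "starti i c = c\<lparr>st := (st c)(x := 4), bu := (bu c)(i := tm c + p x),
        pend := (pend c)(i := 0), sch := (sch c)(x \<mapsto> (i, tm c))\<rparr>" using e(2) bu b0 by (simp add: x_def)
    have x: "x < n" "st c x \<noteq> 0" "st c x \<noteq> 4" using j by (auto simp: x_def)
    have v: "visible J (tm c) x" using a(12)[OF x(2)] x(1) by (simp add: visible_def)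
    have nos: "sch c x = None" using a(15)[of x] x(3) by simp
    define st' where "st' = (st c)(x := 4)"
    have "{l. l < n \<and> st' l = 4} = insert x {l. l < n \<and> st c l = 4}" using x by (auto simp: st'_def)
    hence ns: "card {l. l < n \<and> st' l = 4} = Suc (card {l. l < n \<and> st c l = 4})"
      using x(3) by (simp add: card_insert_if)
    have rest: "tri J N launch_com s2 ?Q"
      if s2: "rel c s2" "ivar s2 ''i'' 0 = i" "ivar s2 ''b'' 0 = x" for s2
    proof -
      note r2 = s2(1)[unfolded rel_def]
      show ?thesis unfolding eq launch_com_def st'_def[symmetric]
        apply (intro tri_Seq tri_IAssign tri_RAssign tri_Start)
        subgoal using r2 s2(3) nos by simp
        subgoal using r2 s2(2,3) v ns st'_def[symmetric] unfolding rel_def by simp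
        done
    qed
    have relb: "rel c (set_ivar ''b'' (ival J (IConst 0) s1) (ival J (ISub Vb (IConst 1)) s1) s1)"
      by (rule rel_same[OF s1(1) same_set(1)[of _ "{''b''}"]]) simp_all
    show "tri J N (Seq (iset ''b'' (ISub Vb (IConst 1))) launch_com) s1 ?Q"
      by (rule tri_Seq, rule tri_IAssign, rule rest[OF relb]) (use s1(2,3) in \<open>simp_all add: x_def\<close>)
  qed
  have bub: "bval J (RLe (RVar ''bu'' Vi) Clock) s \<longleftrightarrow> bu c i \<le> tm c" using r assms(3) by auto
  show ?thesis unfolding start_com_def
  proof (rule tri_Cond)
    assume "\<not> bval J (RLe (RVar ''bu'' Vi) Clock) s"
    thus "tri J N Skip s ?Q" unfolding bub using e(1) assms by (intro tri_Skip) simp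
  next
    assume "bval J (RLe (RVar ''bu'' Vi) Clock) s"
    hence bu: "bu c i \<le> tm c" unfolding bub .
    let ?s = "set_ivar ''b'' (ival J (IConst 0) s) (ival J (IVar ''pe'' Vi) s) s"
    have "same {''b''} s ?s" by (rule same_set) simp
    hence s1: "rel c ?s" using rel_same[OF assms(1)] by simp
    have bi: "ivar ?s ''b'' 0 = pend c i" "ivar ?s ''i'' 0 = i" using r assms(3) by simp_all
    show "tri J N (Seq (iset ''b'' (IVar ''pe'' Vi))
       (Seq (Cond (IEq Vb (IConst 0)) best_com Skip) choose_com)) s ?Q"
    proof (rule tri_Seq, rule tri_IAssign, rule tri_Seq, rule tri_Cond)
      assume "bval J (IEq Vb (IConst 0)) ?s"
      hence p0: "pend c i = 0" using bi by simp
      show "tri J N best_com ?s (\<lambda>s'. tri J N choose_com s' ?Q)"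
      proof (rule best_tri[OF s1])
        show "ivar ?s ''b'' 0 = 0" using bi p0 by simp
        fix s' assume S: "same {''l'', ''b''} ?s s'" "ivar s' ''b'' 0 = best c"
        show "tri J N choose_com s' ?Q"
        proof (rule fin[OF _ _ _ bu])
          show "rel c s'" using rel_same[OF s1 S(1)] by simp
          show "ivar s' ''i'' 0 = i" using same_get(1)[OF S(1), of "''i''"] bi by simp
          show "ivar s' ''b'' 0 = b" using S(2) p0 by (simp add: b_def)
        qed
      qed
    next
      assume "\<not> bval J (IEq Vb (IConst 0)) ?s"
      hence p0: "pend c i \<noteq> 0" using bi by simp
      have "ivar ?s ''b'' 0 = b" using bi p0 by (simp add: b_def)
      thus "tri J N Skip ?s (\<lambda>s'. tri J N choose_com s' ?Q)"
        by (intro tri_Skip fin[OF s1 bi(2) _ bu])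
    qed
  qed
qed

text \<open>\<open>v\<close> is the least element of \<open>S\<close> above \<open>t\<close>, where
  \<open>t\<close> itself stands for there being none.\<close>

definition nxok :: "real \<Rightarrow> real set \<Rightarrow> real \<Rightarrow> bool" where
  "nxok t S v \<longleftrightarrow> (\<forall>x\<in>S. t < x \<longrightarrow> t < v \<and> v \<le> x) \<and> (v = t \<or> v \<in> S \<and> t < v)"

lemma cand_tri:
  assumes "clock s = t" "nxok t S (rvar s ''nx'' 0)" "rval J x s = a"
    and Q: "\<And>s'. same {''nx''} s s' \<Longrightarrow> nxok t (insert a S) (rvar s' ''nx'' 0) \<Longrightarrow> Q s'"
  shows "tri J N (cand_com x) s Q"
proof -
  define v where "v = rvar s ''nx'' 0"
  let ?b = "BAnd (RLess Clock x) (BNot (BAnd (RLess Clock (rscal ''nx'')) (BNot (RLess x (rscal ''nx'')))))"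
  have b: "bval J ?b s \<longleftrightarrow> t < a \<and> \<not> (t < v \<and> \<not> a < v)" using assms(1,3) by (simp add: v_def)
  have ok: "nxok t S v" using assms(2) by (simp add: v_def)
  show ?thesis unfolding cand_com_def
  proof (rule tri_Cond)
    assume "bval J ?b s"
    hence "nxok t (insert a S) a" using ok unfolding b nxok_def by fastforce
    thus "tri J N (rset ''nx'' x) s Q"
      using assms(3) by (intro tri_RAssign Q) (simp_all add: same_set)
  next
    assume "\<not> bval J ?b s"
    hence "nxok t (insert a S) v" using ok unfolding b nxok_def by fastforce
    thus "tri J N Skip s Q" by (intro tri_Skip Q) (simp_all add: same_refl v_def)
  qed
qed

text \<open>Groups \<open>cset\<close> by index, since the program finds all candidates in one scan
  that takes an index as job and as machine.\<close>

definition CL :: "conf \<Rightarrow> nat \<Rightarrow> real set" where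
  "CL c l = insert (bu c l) (if fl (dc c) \<le> tm c
     then insert (tm c + bl c l) (if st c l = 1 \<and> bl c (mc (dc c) l) \<le> 0 then {tm c + dd c l} else {})
     else {})"

lemma cset_CL: "cset c = {x \<in> insert (fl (dc c)) (\<Union>l<n. CL c l). tm c < x}"
  by (auto simp: cset_def CL_def split: if_splits)

lemma running_b:
  assumes "rel c s" "ivar s ''l'' 0 = l"
  shows "bval J running_b s \<longleftrightarrow> st c l = 1 \<and> bl c (mc (dc c) l) \<le> 0"
  using assms by (auto simp: rel_def running_b_def)

lemma CL_tri:
  assumes rel: "rel c s" and l: "ivar s ''l'' 0 = l" and ok: "nxok (tm c) S (rvar s ''nx'' 0)"
    and Q: "\<And>s'. same {''nx''} s s' \<Longrightarrow> nxok (tm c) (S \<union> CL c l) (rvar s' ''nx'' 0) \<Longrightarrow> Q s'"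
  shows "tri J N scan_com s Q"
  unfolding scan_com_def
proof (rule tri_Seq, rule cand_tri[OF _ ok])
  show "clock s = tm c" "rval J (RVar ''bu'' Vl) s = bu c l" using rel l by (simp_all add: rel_def)
  fix s1 assume S1: "same {''nx''} s s1" "nxok (tm c) (insert (bu c l) S) (rvar s1 ''nx'' 0)"
  have r1: "rel c s1" "ivar s1 ''l'' 0 = l"
    using rel_same[OF rel S1(1)] same_get(1)[OF S1(1)] l by simp_all
  have b1: "bval J (RLe (rscal ''fl'') Clock) s1 \<longleftrightarrow> fl (dc c) \<le> tm c" using r1 by (auto simp: rel_def)
  show "tri J N (Cond (RLe (rscal ''fl'') Clock)
               (Seq (cand_com (RAdd Clock (RVar ''bl'' Vl)))
                 (Cond running_b (cand_com (RAdd Clock (RVar ''d'' Vl))) Skip))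
               Skip) s1 Q"
  proof (rule tri_Cond)
    assume "\<not> bval J (RLe (rscal ''fl'') Clock) s1"
    thus "tri J N Skip s1 Q" unfolding b1 using S1 by (intro tri_Skip Q) (simp_all add: CL_def)
  next
    assume "bval J (RLe (rscal ''fl'') Clock) s1"
    hence f: "fl (dc c) \<le> tm c" unfolding b1 .
    show "tri J N (Seq (cand_com (RAdd Clock (RVar ''bl'' Vl)))
                 (Cond running_b (cand_com (RAdd Clock (RVar ''d'' Vl))) Skip)) s1 Q"
    proof (rule tri_Seq, rule cand_tri[OF _ S1(2)])
      show "clock s1 = tm c" "rval J (RAdd Clock (RVar ''bl'' Vl)) s1 = tm c + bl c l"
        using r1 by (simp_all add: rel_def)
      fix s2 assume S2: "same {''nx''} s1 s2"
        "nxok (tm c) (insert (tm c + bl c l) (insert (bu c l) S)) (rvar s2 ''nx'' 0)"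
      have r2: "rel c s2" "ivar s2 ''l'' 0 = l"
        using rel_same[OF r1(1) S2(1)] same_get(1)[OF S2(1)] r1 by simp_all
      note s02 = same_trans[OF S1(1) S2(1)]
      show "tri J N (Cond running_b (cand_com (RAdd Clock (RVar ''d'' Vl))) Skip) s2 Q"
      proof (rule tri_Cond, unfold running_b[OF r2])
        assume "\<not> (st c l = 1 \<and> bl c (mc (dc c) l) \<le> 0)"
        hence "S \<union> CL c l = insert (tm c + bl c l) (insert (bu c l) S)"
          using f by (auto simp: CL_def)
        thus "tri J N Skip s2 Q" using S2 s02 by (intro tri_Skip Q) simp_all
      next
        assume run: "st c l = 1 \<and> bl c (mc (dc c) l) \<le> 0"
        show "tri J N (cand_com (RAdd Clock (RVar ''d'' Vl))) s2 Q"
        proof (rule cand_tri[OF _ S2(2)])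
          show "clock s2 = tm c" "rval J (RAdd Clock (RVar ''d'' Vl)) s2 = tm c + dd c l"
            using r2 by (simp_all add: rel_def)
          fix s3 assume S3: "same {''nx''} s2 s3" "nxok (tm c) (insert (tm c + dd c l)
            (insert (tm c + bl c l) (insert (bu c l) S))) (rvar s3 ''nx'' 0)"
          have "S \<union> CL c l = insert (tm c + dd c l) (insert (tm c + bl c l) (insert (bu c l) S))"
            using f run by (auto simp: CL_def)
          thus "Q s3" using S3 same_trans[OF s02 S3(1)] by (intro Q) simp_all
        qed
      qed
    qed
  qed
qed

lemma next_tri:
  assumes rel: "rel c s"
    and Q: "\<And>s'. same {''l'', ''nx''} s s' \<Longrightarrow>
      nxok (tm c) (insert (fl (dc c)) (\<Union>l<n. CL c l)) (rvar s' ''nx'' 0) \<Longrightarrow> Q s'"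
  shows "tri J N next_com s Q"
  unfolding next_com_def
proof (rule tri_Seq, rule tri_RAssign, rule tri_Seq)
  let ?s = "set_rvar ''nx'' (ival J (IConst 0) s) (rval J Clock s) s"
  have S0: "same {''l'', ''nx''} s ?s" by (rule same_set) simp
  have r0: "rel c ?s" using rel_same[OF rel S0] by simp
  show "tri J N (cand_com (rscal ''fl'')) ?s (\<lambda>s'. tri J N (For ''l'' NumJobs scan_com) s' Q)"
  proof (rule cand_tri[where S = "{}"])
    show "clock ?s = tm c" "rval J (rscal ''fl'') ?s = fl (dc c)" using r0 by (simp_all add: rel_def)
    show "nxok (tm c) {} (rvar ?s ''nx'' 0)" using rel by (simp add: nxok_def rel_def)
    fix s1 assume S1: "same {''nx''} ?s s1" "nxok (tm c) {fl (dc c)} (rvar s1 ''nx'' 0)"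
    have S01: "same {''l'', ''nx''} s s1" using same_trans[OF S0] S1(1) by (auto simp: same_def)
    have r1: "rel c s1" using rel_same[OF r0 S1(1)] by simp
    show "tri J N (For ''l'' NumJobs scan_com) s1 Q"
    proof (rule tri_For_same[where X = "{''l'', ''nx''}" and b = n and
        I = "\<lambda>i s'. nxok (tm c) (insert (fl (dc c)) (\<Union>l<i. CL c l)) (rvar s' ''nx'' 0)"])
      fix i s2 assume S2: "same {''l'', ''nx''} s1 s2" "ivar s2 ''l'' 0 = i"
        "nxok (tm c) (insert (fl (dc c)) (\<Union>l<i. CL c l)) (rvar s2 ''nx'' 0)"
      have r2: "rel c s2" using rel_same[OF r1 S2(1)] by simp
      show "tri J N scan_com s2 (\<lambda>s''. same {''l'', ''nx''} s2 s'' \<and> ivar s'' ''l'' 0 = i \<and>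
           nxok (tm c) (insert (fl (dc c)) (\<Union>l<Suc i. CL c l)) (rvar (set_ivar ''l'' 0 (Suc i) s'') ''nx'' 0))"
      proof (rule CL_tri[OF r2 S2(2,3)])
        fix s3 assume S3: "same {''nx''} s2 s3"
          "nxok (tm c) (insert (fl (dc c)) (\<Union>l<i. CL c l) \<union> CL c i) (rvar s3 ''nx'' 0)"
        have "same {''l'', ''nx''} s2 s3" using S3(1) by (auto simp: same_def)
        moreover have "insert (fl (dc c)) (\<Union>l<i. CL c l) \<union> CL c i = insert (fl (dc c)) (\<Union>l<Suc i. CL c l)"
          by (auto simp: less_Suc_eq)
        ultimately show "same {''l'', ''nx''} s2 s3 \<and> ivar s3 ''l'' 0 = i \<and>
           nxok (tm c) (insert (fl (dc c)) (\<Union>l<Suc i. CL c l)) (rvar (set_ivar ''l'' 0 (Suc i) s3) ''nx'' 0)"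
          using S3 S2(2) same_get(1)[OF S3(1)] by simp
      qed
    next
      fix s2 assume "same {''l'', ''nx''} s1 s2"
        "nxok (tm c) (insert (fl (dc c)) (\<Union>l<n. CL c l)) (rvar s2 ''nx'' 0)"
      thus "Q s2" using Q same_trans[OF S01] by blast
    qed (use N S1 in simp_all)
  qed
qed

lemma wait_tri:
  assumes "rel c s" "invA R c"
  shows "tri J N wait_com s (rel (wait c))"
  unfolding wait_com_def
proof (rule tri_Seq, rule next_tri[OF assms(1)], rule tri_Seq, rule tri_RAssign, rule tri_Seq)
  fix s1 assume S1: "same {''l'', ''nx''} s s1"
    "nxok (tm c) (insert (fl (dc c)) (\<Union>l<n. CL c l)) (rvar s1 ''nx'' 0)"
  note a = invAD[OF assms(2)]
  have r1: "rel c s1" using rel_same[OF assms(1) S1(1)] by simp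
  let ?s2 = "set_rvar ''t'' (ival J (IConst 0) s1) (rval J Clock s1) s1"
  define v where "v = rvar s1 ''nx'' 0"
  have r2: "rel c ?s2" by (rule rel_same[OF r1 same_set(2)[of _ "{''t''}"]]) simp_all
  have t2: "rvar ?s2 ''t'' 0 = tm c" "rvar ?s2 ''nx'' 0 = v" "clock ?s2 = tm c"
    using r1 by (simp_all add: rel_def v_def)
  have v: "v = tm c \<and> cset c = {} \<or> tm c < v \<and> cset c \<noteq> {} \<and> v = Min (cset c)"
  proof -
    have ok: "nxok (tm c) (insert (fl (dc c)) (\<Union>l<n. CL c l)) v" using S1(2) by (simp add: v_def)
    hence le: "\<forall>x\<in>cset c. tm c < v \<and> v \<le> x" unfolding nxok_def cset_CL by blast
    from ok consider "v = tm c" | "v \<in> cset c" "tm c < v" unfolding nxok_def cset_CL by blast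
    thus ?thesis
    proof cases
      case 1 thus ?thesis using le by fastforce
    next
      case 2
      hence "Min (cset c) = v" using le finite_cset by (intro Min_eqI) auto
      thus ?thesis using 2 by auto
    qed
  qed
  define c1 where "c1 = c\<lparr>tm := wtime c\<rparr>"
  define dt where "dt = wtime c - tm c"
  have upd: "tri J N upd_com s3 (rel (wait c))"
    if s3: "rel c1 s3" "rvar s3 ''t'' 0 = tm c" for s3
    unfolding upd_com_def
  proof (rule tri_Cond)
    have b3: "bval J (RLe (rscal ''fl'') (rscal ''t'')) s3 \<longleftrightarrow> fl (dc c) \<le> tm c"
      using s3 by (auto simp: rel_def c1_def)
    {
      assume "\<not> bval J (RLe (rscal ''fl'') (rscal ''t'')) s3"
      hence "wait c = c1" unfolding b3 by (simp add: wait_def c1_def Let_def)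
      thus "tri J N Skip s3 (rel (wait c))" using s3 by (intro tri_Skip) simp
    next
      assume "bval J (RLe (rscal ''fl'') (rscal ''t'')) s3"
      hence f: "fl (dc c) \<le> tm c" unfolding b3 .
      let ?s4 = "set_rvar ''w'' (ival J (IConst 0) s3) (rval J (RSub Clock (rscal ''t'')) s3) s3"
      have r4: "rel c1 ?s4" by (rule rel_same[OF s3(1) same_set(2)[of _ "{''w''}"]]) simp_all
      have w4: "rvar ?s4 ''w'' 0 = dt" using s3 by (simp add: rel_def c1_def dt_def)
      \<comment> \<open>With the clock already moved, \<open>D i\<close> has the first
        \<open>i\<close> countdowns reduced, and \<open>E i\<close> has all countdowns and the first
        \<open>i\<close> blockings reduced.\<close>
      define D where "D i = c1\<lparr>dd := (\<lambda>l. if l < i \<and> st c l = 1 \<and> bl c (mc (dc c) l) \<le> 0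
        then dd c l - dt else dd c l)\<rparr>" for i
      define E where "E i = (D n)\<lparr>bl := (\<lambda>l. if l < i \<and> 0 < bl c l then bl c l - dt else bl c l)\<rparr>" for i
      have Ds: "dc (D i) = dc c" "st (D i) = st c" "qc (D i) = qc c" "bl (D i) = bl c" "pend (D i) = pend c"
        "bu (D i) = bu c" "tm (D i) = wtime c" "sch (D i) = sch c" for i
        by (simp_all add: D_def c1_def)
      have Es: "dc (E i) = dc c" "st (E i) = st c" "qc (E i) = qc c" "dd (E i) = dd (D n)" "pend (E i) = pend c"
        "bu (E i) = bu c" "tm (E i) = wtime c" "sch (E i) = sch c" for i
        by (simp_all add: E_def Ds)
      have loop2: "tri J N (For ''l'' (iscal ''m'') unblock_com) s5 (rel (wait c))"
        if s5: "rel (D n) s5" "rvar s5 ''w'' 0 = dt" for s5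
      proof (rule tri_For[where I = "\<lambda>i s. rel (E i) s \<and> rvar s ''w'' 0 = dt" and b = m])
        show "m \<le> N" by (rule m_N)
        show "ival J (iscal ''m'') s = m" if "rel (E i) s \<and> rvar s ''w'' 0 = dt" for i s
          using that by (simp add: rel_def)
        have "E 0 = D n" by (simp add: E_def D_def c1_def)
        hence "rel (E 0) s5" using s5(1) by simp
        thus "rel (E 0) (set_ivar ''l'' 0 0 s5) \<and> rvar (set_ivar ''l'' 0 0 s5) ''w'' 0 = dt"
          using s5(2) rel_same[OF _ same_set(1)[of "''l''" "{''l''}"]] by simp
        fix i s assume I: "rel (E i) s \<and> rvar s ''w'' 0 = dt" "ivar s ''l'' 0 = i" "i < m"
        have b: "bval J (RLess R0 (RVar ''bl'' Vl)) s \<longleftrightarrow> 0 < bl c i"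
          using I by (simp add: rel_def E_def)
        have fin: "ivar s' ''l'' 0 = i \<and> rel (E (Suc i)) (set_ivar ''l'' 0 (Suc i) s') \<and>
            rvar (set_ivar ''l'' 0 (Suc i) s') ''w'' 0 = dt"
          if "rel (E (Suc i)) s'" "ivar s' ''l'' 0 = i" "rvar s' ''w'' 0 = dt" for s'
          using that rel_same[OF that(1) same_set(1)[of "''l''" "{''l''}"]] by simp
        let ?Q = "\<lambda>s'. ivar s' ''l'' 0 = i \<and> rel (E (Suc i)) (set_ivar ''l'' 0 (Suc i) s') \<and>
              rvar (set_ivar ''l'' 0 (Suc i) s') ''w'' 0 = dt"
        show "tri J N unblock_com s ?Q"
          unfolding unblock_com_def
        proof (rule tri_Cond, unfold b)
          assume pos: "0 < bl c i"
          have "bl (E (Suc i)) = (bl (E i))(i := bl c i - dt)"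
            using pos by (auto simp: E_def fun_eq_iff less_Suc_eq)
          hence 1: "rel (E (Suc i)) (set_rvar ''bl'' i (bl c i - dt) s)"
            using conjunct1[OF I(1)] unfolding rel_def by (simp add: E_def)
          have 2: "ival J Vl s = i" "rval J (RSub (RVar ''bl'' Vl) (rscal ''w'')) s = bl c i - dt"
            using I by (simp_all add: rel_def E_def)
          show "tri J N (RAssign ''bl'' Vl (RSub (RVar ''bl'' Vl) (rscal ''w''))) s ?Q"
            by (rule tri_RAssign, unfold 2, rule fin[OF 1]) (use I(1,2) in simp_all)
        next
          assume np: "\<not> 0 < bl c i"
          have 3: "bl (E (Suc i)) = bl (E i)" using np by (auto simp: E_def fun_eq_iff less_Suc_eq)
          have "rel (E (Suc i)) s" by (rule rel_cong[OF conjunct1[OF I(1)]]) (simp_all only: Es 3)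
          thus "tri J N Skip s ?Q"
            using I(1,2) by (intro tri_Skip fin) simp_all
        qed
      next
        fix s assume I: "rel (E m) s \<and> rvar s ''w'' 0 = dt"
        \<comment> \<open>The loop ends at \<open>m\<close>; from there on \<open>bl\<close> is 0
          and waiting does not change it.\<close>
        have "l < m" if "0 < bl c l" for l
          using a(9)[of l] that by (cases "m \<le> l") auto
        hence 1: "bl (wait c) = bl (E m)" using f by (auto simp: E_def wait_eqs dt_def fun_eq_iff)
        have "l < n" if "st c l = 1" for l using seen_less[OF assms(2), of l] that by simp
        hence 2: "dd (wait c) = dd (E m)" using f by (auto simp: E_def D_def wait_eqs dt_def fun_eq_iff)
        show "rel (wait c) s"
          by (rule rel_cong[OF conjunct1[OF I]]) (simp_all add: 1 2 wait_eqs(1-4,7-9) E_def D_def c1_def)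
      qed
      have loop1: "tri J N (For ''l'' NumJobs count_com) ?s4
         (\<lambda>s. rel (D n) s \<and> rvar s ''w'' 0 = dt)"
      proof (rule tri_For[where I = "\<lambda>i s. rel (D i) s \<and> rvar s ''w'' 0 = dt" and b = n])
        show "n \<le> N" by (rule N)
        show "ival J NumJobs s = n" for s by simp
        have "rel (D 0) ?s4" using r4 by (rule rel_cong) (simp_all add: D_def c1_def)
        thus "rel (D 0) (set_ivar ''l'' 0 0 ?s4) \<and> rvar (set_ivar ''l'' 0 0 ?s4) ''w'' 0 = dt"
          using w4 rel_same[OF _ same_set(1)[of "''l''" "{''l''}"]] by simp
        fix i s assume I: "rel (D i) s \<and> rvar s ''w'' 0 = dt" "ivar s ''l'' 0 = i" "i < n"
        have b: "bval J running_b s \<longleftrightarrow> st c i = 1 \<and> bl c (mc (dc c) i) \<le> 0"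
          using running_b[OF conjunct1[OF I(1)] I(2)] by (simp add: D_def c1_def)
        have fin: "ivar s' ''l'' 0 = i \<and> rel (D (Suc i)) (set_ivar ''l'' 0 (Suc i) s') \<and>
            rvar (set_ivar ''l'' 0 (Suc i) s') ''w'' 0 = dt"
          if "rel (D (Suc i)) s'" "ivar s' ''l'' 0 = i" "rvar s' ''w'' 0 = dt" for s'
          using that rel_same[OF that(1) same_set(1)[of "''l''" "{''l''}"]] by simp
        let ?Q = "\<lambda>s'. ivar s' ''l'' 0 = i \<and> rel (D (Suc i)) (set_ivar ''l'' 0 (Suc i) s') \<and>
              rvar (set_ivar ''l'' 0 (Suc i) s') ''w'' 0 = dt"
        show "tri J N count_com s ?Q"
          unfolding count_com_def
        proof (rule tri_Cond, unfold b)
          assume pos: "st c i = 1 \<and> bl c (mc (dc c) i) \<le> 0"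
          have "dd (D (Suc i)) = (dd (D i))(i := dd c i - dt)"
            using pos by (auto simp: D_def fun_eq_iff less_Suc_eq)
          hence 1: "rel (D (Suc i)) (set_rvar ''d'' i (dd c i - dt) s)"
            using conjunct1[OF I(1)] unfolding rel_def by (simp add: D_def)
          have 2: "ival J Vl s = i" "rval J (RSub (RVar ''d'' Vl) (rscal ''w'')) s = dd c i - dt"
            using I by (simp_all add: rel_def D_def c1_def)
          show "tri J N (RAssign ''d'' Vl (RSub (RVar ''d'' Vl) (rscal ''w''))) s ?Q"
            by (rule tri_RAssign, unfold 2, rule fin[OF 1]) (use I(1,2) in simp_all)
        next
          assume np: "\<not> (st c i = 1 \<and> bl c (mc (dc c) i) \<le> 0)"
          have 3: "dd (D (Suc i)) = dd (D i)" using np by (auto simp: D_def fun_eq_iff less_Suc_eq)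
          have "rel (D (Suc i)) s" by (rule rel_cong[OF conjunct1[OF I(1)]]) (simp_all only: Ds 3)
          thus "tri J N Skip s ?Q"
            using I(1,2) by (intro tri_Skip fin) simp_all
        qed
      qed blast
      show "tri J N (Seq (rset ''w'' (RSub Clock (rscal ''t'')))
           (Seq (For ''l'' NumJobs count_com)
                (For ''l'' (iscal ''m'') unblock_com))) s3 (rel (wait c))"
        by (rule tri_Seq, rule tri_RAssign, rule tri_Seq, rule tri_mono[OF loop1], rule loop2) simp_all
    }
  qed
  have clk: "rel c1 (s2\<lparr>clock := wtime c\<rparr>)" if "rel c s2" for s2
    using that unfolding rel_def by (simp add: c1_def)
  have post: "tri J N upd_com (?s2\<lparr>clock := wtime c\<rparr>) (rel (wait c))"
    by (rule upd[OF clk[OF r2]]) (use t2 in simp)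
  show "tri J N (Cond (RLess Clock (rscal ''nx'')) (WaitUntil (rscal ''nx'')) WaitRelease) ?s2
     (\<lambda>s3. tri J N upd_com s3 (rel (wait c)))"
  proof (rule tri_Cond)
    assume "bval J (RLess Clock (rscal ''nx'')) ?s2"
    hence "tm c < v" using t2 by simp
    hence "wtime c = wait_until J (clock ?s2) (rval J (rscal ''nx'') ?s2)"
      using v t2 by (simp add: wtime_def)
    from post[unfolded this] show "tri J N (WaitUntil (rscal ''nx'')) ?s2 (\<lambda>s3. tri J N upd_com s3 (rel (wait c)))"
      by (rule tri_WaitUntil)
  next
    assume "\<not> bval J (RLess Clock (rscal ''nx'')) ?s2"
    hence "\<not> tm c < v" using t2 by simp
    hence "wtime c = next_release J (clock ?s2)"
      using v t2(3) by (auto simp: wtime_def)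
    from post[unfolded this] show "tri J N WaitRelease ?s2 (\<lambda>s3. tri J N upd_com s3 (rel (wait c)))"
      by (rule tri_WaitRelease)
  qed
qed

end


lemma tri_While_ghost:
  assumes "I i s" "i \<le> N"
    and step: "\<And>i s. I i s \<Longrightarrow> bval J b s \<Longrightarrow> tri J N c s (\<lambda>s'. \<exists>i'<i. I i' s')"
    and fin: "\<And>i s. I i s \<Longrightarrow> \<not> bval J b s \<Longrightarrow> Q s"
  shows "tri J N (While b c) s Q"
proof (rule tri_While[where I = "\<lambda>s. \<exists>i. I i s" and \<mu> = "\<lambda>s. LEAST i. I i s"])
  show "\<exists>i. I i s" using assms(1) by blast
  show "(LEAST i. I i s) \<le> N" using Least_le[of "\<lambda>i. I i s", OF assms(1)] assms(2) by simp
next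
  fix s assume ex: "\<exists>i. I i s" and b: "bval J b s"
  have least: "I (LEAST i. I i s) s" using ex by (rule LeastI_ex)
  show "tri J N c s (\<lambda>s'. (\<exists>i. I i s') \<and> (LEAST i. I i s') < (LEAST i. I i s))"
  proof (rule tri_mono[OF step[OF least b]])
    fix s' assume "\<exists>i'<LEAST i. I i s. I i' s'"
    then obtain i' where i': "i' < (LEAST i. I i s)" "I i' s'" by blast
    have "(LEAST i. I i s') \<le> i'" using i'(2) by (rule Least_le)
    thus "(\<exists>i. I i s') \<and> (LEAST i. I i s') < (LEAST i. I i s)" using i' by auto
  qed
qed (use fin in blast)

section \<open>The main loop\<close>

definition loop_com :: com where
  "loop_com = While (ILess (iscal ''ns'') NumJobs) body_com"

context flow_prog
begin

lemma rel_l: "rel c s \<Longrightarrow> rel c (set_ivar ''l'' 0 v s)"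
  by (rule rel_same[OF _ same_set(1)[of _ "{''l''}"]]) simp_all

lemma rel_i: "rel c s \<Longrightarrow> rel c (set_ivar ''i'' 0 v s)"
  by (rule rel_same[OF _ same_set(1)[of _ "{''i''}"]]) simp_all

lemma insert_loop:
  assumes "rel c s" "invA R c"
  shows "tri J N (For ''l'' NumJobs insert_com) s (\<lambda>s'. rel (ph1 c) s' \<and> invA R (ph1 c))"
proof (rule tri_For[where b = n and
      I = "\<lambda>i s. rel (fold insj [0..<i] c) s \<and> invA R (fold insj [0..<i] c)"])
  fix i s assume I: "rel (fold insj [0..<i] c) s \<and> invA R (fold insj [0..<i] c)"
    "ivar s ''l'' 0 = i" "i < n"
  define c1 where "c1 = fold insj [0..<i] c"
  have c1: "rel c1 s" "invA R c1" "fold insj [0..<Suc i] c = insj i c1"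
    using I by (simp_all add: c1_def)
  show "tri J N insert_com s (\<lambda>s'. ivar s' ''l'' 0 = i \<and>
      rel (fold insj [0..<Suc i] c) (set_ivar ''l'' 0 (Suc i) s') \<and> invA R (fold insj [0..<Suc i] c))"
    unfolding c1(3) using rel_l insj_invA[OF c1(2) I(3)]
    by (intro tri_mono[OF insert_tri[OF c1(1,2) I(2,3)]]) simp
qed (use assms rel_l N in \<open>simp_all add: ph1_def\<close>)

lemma tick_loop:
  assumes "rel c s" "invA R c"
  shows "tri J N (For ''l'' NumJobs tick_com) s (\<lambda>s'. rel (ph2 R c) s' \<and> invA R (ph2 R c))"
proof (rule tri_For[where b = n and
      I = "\<lambda>i s. rel (fold (tick R) [0..<i] c) s \<and> invA R (fold (tick R) [0..<i] c)"])
  fix i s assume I: "rel (fold (tick R) [0..<i] c) s \<and> invA R (fold (tick R) [0..<i] c)"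
    "ivar s ''l'' 0 = i" "i < n"
  define c1 where "c1 = fold (tick R) [0..<i] c"
  have c1: "rel c1 s" "invA R c1" "fold (tick R) [0..<Suc i] c = tick R i c1"
    using I by (simp_all add: c1_def)
  show "tri J N tick_com s (\<lambda>s'. ivar s' ''l'' 0 = i \<and>
      rel (fold (tick R) [0..<Suc i] c) (set_ivar ''l'' 0 (Suc i) s') \<and> invA R (fold (tick R) [0..<Suc i] c))"
    unfolding c1(3) using rel_l tick_invA[OF c1(2) I(3)]
    by (intro tri_mono[OF tick_tri[OF c1(1,2) I(2,3)]]) simp
qed (use assms rel_l N in \<open>simp_all add: ph2_def\<close>)

lemma start_loop:
  assumes "rel c s" "invA R c"
  shows "tri J N (For ''i'' (iscal ''m'') start_com) s (\<lambda>s'. rel (ph3 c) s' \<and> invA R (ph3 c))"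
proof (rule tri_For[where b = m and
      I = "\<lambda>i s. rel (fold starti [0..<i] c) s \<and> invA R (fold starti [0..<i] c)"])
  fix i s assume I: "rel (fold starti [0..<i] c) s \<and> invA R (fold starti [0..<i] c)"
    "ivar s ''i'' 0 = i" "i < m"
  define c1 where "c1 = fold starti [0..<i] c"
  have c1: "rel c1 s" "invA R c1" "fold starti [0..<Suc i] c = starti i c1"
    using I by (simp_all add: c1_def)
  show "tri J N start_com s (\<lambda>s'. ivar s' ''i'' 0 = i \<and>
      rel (fold starti [0..<Suc i] c) (set_ivar ''i'' 0 (Suc i) s') \<and> invA R (fold starti [0..<Suc i] c))"
    unfolding c1(3) using rel_i starti_invA[OF c1(2) I(3)]
    by (intro tri_mono[OF start_tri[OF c1(1,2) I(2,3)]]) simp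
next
  fix i s assume "rel (fold starti [0..<i] c) s \<and> invA R (fold starti [0..<i] c)"
  hence "rel (fold starti [0..<i] c) s" by blast
  thus "ival J (iscal ''m'') s = m" unfolding rel_def by simp
qed (use assms rel_i m_N in \<open>simp_all add: ph3_def\<close>)

lemma body_tri:
  assumes "rel c s" "invA R c"
  shows "tri J N body_com s (rel (body R c))"
  unfolding body_com_def body_ph
  by (rule tri_Seq, rule tri_mono[OF insert_loop[OF assms]], rule tri_Seq, erule conjE,
      rule tri_mono[OF tick_loop], assumption+, rule tri_Seq, erule conjE,
      rule tri_mono[OF start_loop], assumption+, erule conjE, rule wait_tri)

text \<open>The states at the loop head represent \<open>run R 0\<close>, \<open>run R 1\<close> and
  so on until all jobs have started; the measure of termination bounds the number of rounds.\<close>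

lemma loop_tri:
  assumes "rel c0 s" "mea c0 \<le> int N"
  shows "tri J N loop_com s (\<lambda>s'. started s' = sch (fin R))"
  unfolding loop_com_def
proof (rule tri_While_ghost[where i = "nat (mea c0)" and I = "\<lambda>u s. \<exists>i. rel (run R i) s \<and>
      (\<forall>i'<i. \<not> allst (run R i')) \<and> u = nat (mea (run R i))"])
  show "\<exists>i. rel (run R i) s \<and> (\<forall>i'<i. \<not> allst (run R i')) \<and> nat (mea c0) = nat (mea (run R i))"
    by (rule exI[of _ 0]) (use assms in simp)
  show "nat (mea c0) \<le> N" using assms(2) by simp
next
  fix u s
  assume "\<exists>i. rel (run R i) s \<and> (\<forall>i'<i. \<not> allst (run R i')) \<and> u = nat (mea (run R i))"
  then obtain i where i: "rel (run R i) s" "\<And>i'. i' < i \<Longrightarrow> \<not> allst (run R i')"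
    "u = nat (mea (run R i))" by blast
  define c where "c = run R i"
  have "allst c \<longleftrightarrow> {l. l < n \<and> st c l = 4} = {..<n}" by (auto simp: allst_def)
  also have "\<dots> \<longleftrightarrow> card {l. l < n \<and> st c l = 4} = card {..<n}"
    by (rule iffI, simp, rule card_subset_eq) auto
  finally have al: "allst c \<longleftrightarrow> card {l. l < n \<and> st c l = 4} = n" by simp
  have le: "card {l. l < n \<and> st c l = 4} \<le> n"
    using card_mono[of "{..<n}" "{l. l < n \<and> st c l = 4}"] by auto
  have "ivar s ''ns'' 0 = card {l. l < n \<and> st c l = 4}" using i(1) by (simp add: rel_def c_def)
  hence b: "bval J (ILess (iscal ''ns'') NumJobs) s \<longleftrightarrow> \<not> allst c" using al le by (simp add: nat_less_le)
  {
    assume "bval J (ILess (iscal ''ns'') NumJobs) s"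
    hence na: "\<not> allst c" unfolding b .
    have h: "headI R V c" unfolding c_def
      by (rule run_head) (use i(2) na c_def in \<open>auto simp: le_less\<close>)
    have inv: "invA R c" using h unfolding headI_def invC_def by blast
    have "invC R V (body R c)" using body(1)[OF h cap V_nonneg] na by simp
    hence "0 \<le> mea (body R c)" using mea_nonneg R unfolding invC_def by blast
    hence lt: "nat (mea (body R c)) < u"
      using body_mea[OF h cap V_nonneg na] i(3) unfolding c_def[symmetric] by simp
    have no: "\<forall>i'<Suc i. \<not> allst (run R i')" using i(2) na c_def by (auto simp: less_Suc_eq)
    show "tri J N body_com s (\<lambda>s'. \<exists>u'<u. \<exists>i. rel (run R i) s' \<and>
        (\<forall>i'<i. \<not> allst (run R i')) \<and> u' = nat (mea (run R i)))"
      by (rule tri_mono[OF body_tri[OF i(1)[folded c_def] inv]], rule exI[of _ "nat (mea (body R c))"],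
          rule conjI[OF lt], rule exI[of _ "Suc i"]) (use no in \<open>simp add: c_def\<close>)
  next
    assume "\<not> bval J (ILess (iscal ''ns'') NumJobs) s"
    hence "nrun R = i" using b i(2) by (intro nrun_eq) (simp_all add: c_def)
    thus "started s = sch (fin R)" using i(1) by (simp add: rel_def fin_def)
  }
qed

text \<open>Per job there is 1 for the release, 2 each for insertion, firing and start, and
  \<open>2 * k\<close> for the ticks.\<close>

lemma mea_c0: "mea c0 \<le> int (n * (2 * k + 7))"
proof -
  have "wj c0 l \<le> 2 * int k + 7" for l by (simp add: wj_def c0_def of_bool_def)
  hence "(\<Sum>l<n. wj c0 l) \<le> (\<Sum>l<n. 2 * int k + 7)" by (intro sum_mono)
  thus ?thesis by (simp add: mea_def wi_def c0_def d0_def algebra_simps)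
qed

end


section \<open>Choosing the parameters and flipping the coins\<close>

definition mach :: "problem \<Rightarrow> nat" where "mach J = min (num_jobs J) (num_machines J)"
text \<open>The parameters are \<open>k = 2 ^ kx J\<close> and \<open>hm = 2 ^ hx J\<close>.\<close>

definition kx :: "problem \<Rightarrow> nat" where "kx J = (LEAST e. num_jobs J \<le> mach J * 4 ^ e)"
definition hx :: "problem \<Rightarrow> nat" where "hx J = (LEAST f. mach J < 2 * 2 ^ f)"

lemma nat_le_pow: "b \<ge> 2 \<Longrightarrow> (i::nat) \<le> b ^ i" for b :: nat
  using less_exp[of i] power_mono[of 2 b i] by linarith

text \<open>The exponent \<open>num_jobs J\<close> is always admissible. This shows that the least
  one exists and bounds it, and with it the number of coins.\<close>

lemma kx:
  assumes "valid_problem J"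
  shows "num_jobs J \<le> mach J * 4 ^ kx J" "i < kx J \<Longrightarrow> mach J * 4 ^ i < num_jobs J"
    "kx J \<le> num_jobs J"
proof -
  have m: "0 < mach J" if "0 < num_jobs J" using assms that by (simp add: mach_def valid_problem_def)
  have *: "num_jobs J \<le> mach J * 4 ^ num_jobs J"
  proof (cases "num_jobs J = 0")
    case False
    have "num_jobs J \<le> 4 ^ num_jobs J" by (rule nat_le_pow) simp
    also have "\<dots> \<le> mach J * 4 ^ num_jobs J" using m False by simp
    finally show ?thesis .
  qed simp
  show "num_jobs J \<le> mach J * 4 ^ kx J" unfolding kx_def using * by (rule LeastI)
  show "kx J \<le> num_jobs J" unfolding kx_def using * by (rule Least_le)
  show "i < kx J \<Longrightarrow> mach J * 4 ^ i < num_jobs J"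
    unfolding kx_def using not_less_Least by fastforce
qed

lemma hx:
  shows "mach J < 2 * 2 ^ hx J" "i < hx J \<Longrightarrow> 2 * 2 ^ i \<le> mach J" "hx J \<le> num_jobs J"
proof -
  have "mach J \<le> 2 ^ mach J" by (rule nat_le_pow) simp
  also have "(2::nat) ^ mach J \<le> 2 ^ num_jobs J" by (intro power_increasing) (simp_all add: mach_def)
  finally have *: "mach J < 2 * 2 ^ num_jobs J"
    using zero_less_power[of "2::nat" "num_jobs J"] by linarith
  show "mach J < 2 * 2 ^ hx J" unfolding hx_def using * by (rule LeastI)
  show "hx J \<le> num_jobs J" unfolding hx_def using * by (rule Least_le)
  show "i < hx J \<Longrightarrow> 2 * 2 ^ i \<le> mach J"
    unfolding hx_def using not_less_Least by fastforce
qed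

text \<open>Binary value with the most significant bit first, the order in which coins
  arrive.\<close>

definition bv :: "bool list \<Rightarrow> nat" where "bv = foldl (\<lambda>a b. a + a + of_bool b) 0"

lemma bv_snoc: "bv (w @ [b]) = bv w + bv w + of_bool b"
  by (simp add: bv_def)

lemma bv_less: "bv w < 2 ^ length w"
proof (induction w rule: rev_induct)
  case (snoc b w) thus ?case by (cases b) (simp_all add: bv_snoc)
qed (simp add: bv_def)

text \<open>Job \<open>l\<close> receives the block of \<open>e\<close> coins with number
  \<open>l\<close>. The value 0 from \<open>n\<close> on agrees with array entries that are never
  assigned.\<close>

definition rnd :: "nat \<Rightarrow> nat \<Rightarrow> bool list \<Rightarrow> nat \<Rightarrow> nat" where
  "rnd n e w l = (if l < n then bv (take e (drop (l * e) w)) else 0)"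

lemma rnd_less: "rnd n e w l < 2 ^ e"
proof -
  have "bv (take e (drop (l * e) w)) < 2 ^ length (take e (drop (l * e) w))" by (rule bv_less)
  also have "\<dots> \<le> 2 ^ e" by (intro power_increasing) simp_all
  finally show ?thesis by (simp add: rnd_def)
qed

abbreviation "Vm \<equiv> iscal ''m''"
abbreviation "Vc \<equiv> iscal ''c''"
abbreviation "Vg \<equiv> iscal ''g''"
abbreviation "Vk \<equiv> iscal ''k''"
abbreviation "inc_com x \<equiv> iset x (IAdd (iscal x) (IConst 1))"
abbreviation "dbl_com x \<equiv> iset x (IAdd (iscal x) (iscal x))"

text \<open>\<open>''c''\<close> is \<open>m * 4 ^ e\<close>, so the loop finds the least power of
  two with \<open>n \<le> m * k ^ 2\<close> by additions alone.\<close>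

definition root_com :: com where
  "root_com = While (ILess Vc NumJobs)
     (Seq (dbl_com ''c'') (Seq (dbl_com ''c'') (Seq (dbl_com ''k'') (inc_com ''e''))))"

definition pow_com :: com where
  "pow_com = While (BNot (ILess Vm (IAdd Vg Vg))) (Seq (dbl_com ''g'') (inc_com ''f''))"

definition flip_com :: com where
  "flip_com = For ''i'' (iscal ''e'')
     (Seq (Flip ''b'' (IConst 0))
          (IAssign ''R'' Vl (IAdd (IAdd (IVar ''R'' Vl) (IVar ''R'' Vl)) Vb)))"

text \<open>With truncated subtraction, \<open>n - (n - M)\<close> is the minimum of
  \<open>n\<close> and \<open>M\<close>.\<close>

definition setup_com :: com where
  "setup_com =
     Seq (iset ''m'' (ISub NumJobs (ISub NumJobs NumMachines)))
    (Seq (iset ''k'' (IConst 1))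
    (Seq (iset ''c'' Vm)
    (Seq root_com
    (Seq (iset ''g'' (IConst 1))
    (Seq pow_com
         (For ''l'' NumJobs flip_com))))))"

text \<open>All that the setup does not write has its initial value, so that the state afterwards
  represents \<open>c0\<close>.\<close>

definition fresh :: "state \<Rightarrow> bool" where
  "fresh s \<longleftrightarrow> rvar s = (\<lambda>_ _. 0) \<and> clock s = 0 \<and> started s = Map.empty \<and>
     (\<forall>x. x \<notin> {''m'', ''k'', ''c'', ''e'', ''g'', ''f'', ''l'', ''i'', ''b'', ''R''} \<longrightarrow> ivar s x = (\<lambda>_. 0))"

lemma fresh_set:
  "fresh s \<Longrightarrow> x \<in> {''m'', ''k'', ''c'', ''e'', ''g'', ''f'', ''l'', ''i'', ''b'', ''R''} \<Longrightarrow>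
    fresh (set_ivar x i v s)"
  unfolding fresh_def by auto

lemma fresh_coins: "fresh s \<Longrightarrow> fresh (s\<lparr>coins := w\<rparr>)"
  by (simp add: fresh_def)

definition pars :: "problem \<Rightarrow> nat \<Rightarrow> nat \<Rightarrow> nat \<Rightarrow> state \<Rightarrow> bool" where
  "pars J k e f s \<longleftrightarrow> fresh s \<and> ivar s ''m'' 0 = mach J \<and> ivar s ''k'' 0 = k \<and> ivar s ''e'' 0 = e \<and>
     ivar s ''f'' 0 = f"

context
  fixes J :: problem and N :: nat
  assumes valid: "valid_problem J" and N: "num_jobs J \<le> N"
begin

lemma root_tri:
  assumes s: "fresh s" "coins s = w" "ivar s ''m'' 0 = mach J" "ivar s ''k'' 0 = 1" "ivar s ''c'' 0 = mach J"
    "ivar s ''e'' 0 = 0" "ivar s ''f'' 0 = 0" "ivar s ''R'' = (\<lambda>_. 0)"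
  shows "tri J N root_com s (\<lambda>s. fresh s \<and> coins s = w \<and> ivar s ''m'' 0 = mach J \<and>
    ivar s ''k'' 0 = 2 ^ kx J \<and> ivar s ''e'' 0 = kx J \<and> ivar s ''f'' 0 = 0 \<and> ivar s ''R'' = (\<lambda>_. 0))"
  unfolding root_com_def
proof (rule tri_While_ghost[where i = "kx J" and I = "\<lambda>u s. fresh s \<and> coins s = w \<and> ivar s ''m'' 0 = mach J \<and>
    ivar s ''f'' 0 = 0 \<and> ivar s ''R'' = (\<lambda>_. 0) \<and> ivar s ''k'' 0 = 2 ^ ivar s ''e'' 0 \<and>
    ivar s ''c'' 0 = mach J * 4 ^ ivar s ''e'' 0 \<and> u + ivar s ''e'' 0 = kx J"])
  show "kx J \<le> N" using kx(3)[OF valid] N by simp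
  let ?I = "\<lambda>u s. fresh s \<and> coins s = w \<and> ivar s ''m'' 0 = mach J \<and>
    ivar s ''f'' 0 = 0 \<and> ivar s ''R'' = (\<lambda>_. 0) \<and> ivar s ''k'' 0 = 2 ^ ivar s ''e'' 0 \<and>
    ivar s ''c'' 0 = mach J * 4 ^ ivar s ''e'' 0 \<and> u + ivar s ''e'' 0 = kx J"
  fix u s assume I: "?I u s"
  have b: "bval J (ILess Vc NumJobs) s \<longleftrightarrow> ivar s ''e'' 0 < kx J"
  proof (cases "ivar s ''e'' 0 < kx J")
    case True thus ?thesis using kx(2)[OF valid True] I by simp
  next
    case False
    hence "ivar s ''e'' 0 = kx J" using I by linarith
    thus ?thesis using kx(1)[OF valid] I by simp
  qed
  {
    assume "bval J (ILess Vc NumJobs) s"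
    hence "ivar s ''e'' 0 < kx J" unfolding b .
    then obtain u' where u': "u = Suc u'" using I by (cases u) auto
    show "tri J N (Seq (dbl_com ''c'') (Seq (dbl_com ''c'') (Seq (dbl_com ''k'') (inc_com ''e'')))) s
      (\<lambda>s. \<exists>u'<u. ?I u' s)"
      by (intro tri_Seq tri_IAssign exI[of _ u']) (use I u' in \<open>simp add: fresh_set\<close>)
  next
    assume "\<not> bval J (ILess Vc NumJobs) s"
    hence "ivar s ''e'' 0 = kx J" unfolding b using I by linarith
    thus "fresh s \<and> coins s = w \<and> ivar s ''m'' 0 = mach J \<and>
    ivar s ''k'' 0 = 2 ^ kx J \<and> ivar s ''e'' 0 = kx J \<and> ivar s ''f'' 0 = 0 \<and> ivar s ''R'' = (\<lambda>_. 0)"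
      using I by simp
  }
qed (use s in simp)

lemma pow_tri:
  assumes s: "fresh s" "coins s = w" "ivar s ''m'' 0 = mach J" "ivar s ''k'' 0 = k" "ivar s ''g'' 0 = 1"
    "ivar s ''e'' 0 = e" "ivar s ''f'' 0 = 0" "ivar s ''R'' = (\<lambda>_. 0)"
  shows "tri J N pow_com s (\<lambda>s. fresh s \<and> coins s = w \<and> ivar s ''m'' 0 = mach J \<and>
    ivar s ''k'' 0 = k \<and> ivar s ''e'' 0 = e \<and> ivar s ''f'' 0 = hx J \<and> ivar s ''R'' = (\<lambda>_. 0))"
  unfolding pow_com_def
proof (rule tri_While_ghost[where i = "hx J" and I = "\<lambda>u s. fresh s \<and> coins s = w \<and> ivar s ''m'' 0 = mach J \<and>
    ivar s ''e'' 0 = e \<and> ivar s ''R'' = (\<lambda>_. 0) \<and> ivar s ''k'' 0 = k \<and>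
    ivar s ''g'' 0 = 2 ^ ivar s ''f'' 0 \<and> u + ivar s ''f'' 0 = hx J"])
  show "hx J \<le> N" using hx(3)[of J] N by simp
  let ?I = "\<lambda>u s. fresh s \<and> coins s = w \<and> ivar s ''m'' 0 = mach J \<and>
    ivar s ''e'' 0 = e \<and> ivar s ''R'' = (\<lambda>_. 0) \<and> ivar s ''k'' 0 = k \<and>
    ivar s ''g'' 0 = 2 ^ ivar s ''f'' 0 \<and> u + ivar s ''f'' 0 = hx J"
  fix u s assume I: "?I u s"
  have b: "bval J (BNot (ILess Vm (IAdd Vg Vg))) s \<longleftrightarrow> ivar s ''f'' 0 < hx J"
  proof (cases "ivar s ''f'' 0 < hx J")
    case True thus ?thesis using hx(2)[OF True] I by simp
  next
    case False
    hence "ivar s ''f'' 0 = hx J" using I by linarith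
    thus ?thesis using hx(1)[of J] I by simp
  qed
  {
    assume "bval J (BNot (ILess Vm (IAdd Vg Vg))) s"
    hence "ivar s ''f'' 0 < hx J" unfolding b .
    then obtain u' where u': "u = Suc u'" using I by (cases u) auto
    show "tri J N (Seq (dbl_com ''g'') (inc_com ''f'')) s
      (\<lambda>s. \<exists>u'<u. ?I u' s)"
      by (intro tri_Seq tri_IAssign exI[of _ u']) (use I u' in \<open>simp add: fresh_set\<close>)
  next
    assume "\<not> bval J (BNot (ILess Vm (IAdd Vg Vg))) s"
    hence "ivar s ''f'' 0 = hx J" unfolding b using I by linarith
    thus "fresh s \<and> coins s = w \<and> ivar s ''m'' 0 = mach J \<and>
    ivar s ''k'' 0 = k \<and> ivar s ''e'' 0 = e \<and> ivar s ''f'' 0 = hx J \<and> ivar s ''R'' = (\<lambda>_. 0)"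
      using I by simp
  }
qed (use s in simp)

lemma flip_tri:
  assumes s: "pars J k e f s" "ivar s ''l'' 0 = j" "coins s = drop d w" "d + e \<le> length w"
    "ivar s ''R'' = T" "T j = 0" "e \<le> N"
  shows "tri J N flip_com s (\<lambda>s. pars J k e f s \<and> ivar s ''l'' 0 = j \<and> coins s = drop (d + e) w \<and>
    ivar s ''R'' = T(j := bv (take e (drop d w))))"
  unfolding flip_com_def
proof (rule tri_For[where b = e and I = "\<lambda>i s. pars J k e f s \<and> ivar s ''l'' 0 = j \<and>
    coins s = drop (d + i) w \<and> ivar s ''R'' = T(j := bv (take i (drop d w)))"])
  fix i s assume I: "pars J k e f s \<and> ivar s ''l'' 0 = j \<and>
    coins s = drop (d + i) w \<and> ivar s ''R'' = T(j := bv (take i (drop d w)))" "ivar s ''i'' 0 = i" "i < e"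
  have len: "d + i < length w" using I(3) s(4) by simp
  have c: "coins s = w ! (d + i) # drop (Suc (d + i)) w" using I len by (simp add: Cons_nth_drop_Suc)
  have t: "take (Suc i) (drop d w) = take i (drop d w) @ [w ! (d + i)]"
    using len by (simp add: take_Suc_conv_app_nth)
  let ?s = "set_ivar ''b'' (ival J (IConst 0) s) (of_bool (w ! (d + i))) (s\<lparr>coins := drop (Suc (d + i)) w\<rparr>)"
  have f: "fresh ?s" using I(1) by (intro fresh_set fresh_coins) (simp_all add: pars_def)
  show "tri J N (Seq (Flip ''b'' (IConst 0))
          (IAssign ''R'' Vl (IAdd (IAdd (IVar ''R'' Vl) (IVar ''R'' Vl)) Vb))) s
     (\<lambda>s'. ivar s' ''i'' 0 = i \<and> pars J k e f (set_ivar ''i'' 0 (Suc i) s') \<and>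
       ivar (set_ivar ''i'' 0 (Suc i) s') ''l'' 0 = j \<and>
       coins (set_ivar ''i'' 0 (Suc i) s') = drop (d + Suc i) w \<and>
       ivar (set_ivar ''i'' 0 (Suc i) s') ''R'' = T(j := bv (take (Suc i) (drop d w))))"
    unfolding t bv_snoc
    by (rule tri_Seq, rule tri_Flip[OF c], rule tri_IAssign)
      (use f I(1,2) in \<open>simp add: pars_def fresh_set\<close>)
next
  show "pars J k e f (set_ivar ''i'' 0 0 s) \<and> ivar (set_ivar ''i'' 0 0 s) ''l'' 0 = j \<and>
    coins (set_ivar ''i'' 0 0 s) = drop (d + 0) w \<and>
    ivar (set_ivar ''i'' 0 0 s) ''R'' = T(j := bv (take 0 (drop d w)))"
    using s by (auto simp: pars_def fresh_set bv_def fun_eq_iff)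
qed (use s(7) in \<open>simp_all add: pars_def\<close>)

lemma flips_tri:
  assumes s: "pars J k e f s" "coins s = w" "num_jobs J * e \<le> length w" "ivar s ''R'' = (\<lambda>_. 0)" "e \<le> N"
  shows "tri J N (For ''l'' NumJobs flip_com) s
    (\<lambda>s. pars J k e f s \<and> ivar s ''R'' = rnd (num_jobs J) e w)"
proof (rule tri_For[where b = "num_jobs J" and I = "\<lambda>i s. pars J k e f s \<and> coins s = drop (i * e) w \<and>
    ivar s ''R'' = rnd i e w"])
  fix i s assume I: "pars J k e f s \<and> coins s = drop (i * e) w \<and> ivar s ''R'' = rnd i e w"
    "ivar s ''l'' 0 = i" "i < num_jobs J"
  have "Suc i * e \<le> num_jobs J * e" using I(3) by (intro mult_right_mono) auto
  hence len: "i * e + e \<le> length w" using s(3) by simp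
  have eq: "(rnd i e w)(i := bv (take e (drop (i * e) w))) = rnd (Suc i) e w"
    by (auto simp: rnd_def fun_eq_iff)
  show "tri J N flip_com s (\<lambda>s'. ivar s' ''l'' 0 = i \<and> pars J k e f (set_ivar ''l'' 0 (Suc i) s') \<and>
      coins (set_ivar ''l'' 0 (Suc i) s') = drop (Suc i * e) w \<and>
      ivar (set_ivar ''l'' 0 (Suc i) s') ''R'' = rnd (Suc i) e w)"
    by (rule tri_mono[OF flip_tri[where T = "rnd i e w" and d = "i * e" and w = w and k = k and e = e and f = f and j = i]])
      (use I len s(5) in \<open>simp_all add: eq pars_def fresh_set add.commute, simp add: rnd_def\<close>)
qed (use s N in \<open>auto simp: pars_def fresh_set rnd_def\<close>)

lemma setup_tri:
  assumes w: "num_jobs J * kx J \<le> length w"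
  shows "tri J N setup_com (init w)
    (\<lambda>s. pars J (2 ^ kx J) (kx J) (hx J) s \<and> ivar s ''R'' = rnd (num_jobs J) (kx J) w)"
proof -
  let ?Q = "\<lambda>s. pars J (2 ^ kx J) (kx J) (hx J) s \<and> ivar s ''R'' = rnd (num_jobs J) (kx J) w"
  have 3: "tri J N (For ''l'' NumJobs flip_com) s ?Q"
    if "fresh s \<and> coins s = w \<and> ivar s ''m'' 0 = mach J \<and> ivar s ''k'' 0 = 2 ^ kx J \<and>
      ivar s ''e'' 0 = kx J \<and> ivar s ''f'' 0 = hx J \<and> ivar s ''R'' = (\<lambda>_. 0)" for s
    by (rule flips_tri) (use that w kx(3)[OF valid] N in \<open>auto simp: pars_def\<close>)
  have 2: "tri J N (Seq (iset ''g'' (IConst 1)) (Seq pow_com (For ''l'' NumJobs flip_com))) s ?Q"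
    if "fresh s \<and> coins s = w \<and> ivar s ''m'' 0 = mach J \<and> ivar s ''k'' 0 = 2 ^ kx J \<and>
      ivar s ''e'' 0 = kx J \<and> ivar s ''f'' 0 = 0 \<and> ivar s ''R'' = (\<lambda>_. 0)" for s
    by (rule tri_Seq, rule tri_IAssign, rule tri_Seq, rule tri_mono[OF pow_tri 3])
      (use that in \<open>simp_all add: fresh_set\<close>)
  have "fresh (init w)" by (simp add: fresh_def init_def)
  thus ?thesis unfolding setup_com_def
    by (intro tri_Seq tri_IAssign, intro tri_mono[OF root_tri 2])
      (simp_all add: fresh_set mach_def init_def)
qed

end


section \<open>Running time and number of coins\<close>

definition flow_com :: com where "flow_com = Seq setup_com loop_com"

lemma schedule_of_tri:
  assumes "tri J N A (init w) (\<lambda>s. started s = S)"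
  shows "schedule_of A J w = S"
proof -
  obtain t s where s: "big_step J A (init w) t s" "started s = S"
    using assms unfolding tri_def by blast
  have "(THE s. \<exists>t. big_step J A (init w) t s) = s"
    by (rule the_equality) (use s(1) big_step_deterministic in blast)+
  thus ?thesis using s(2) by (simp add: schedule_of_def)
qed

text \<open>Large enough for \<open>n * (2 * k + 7)\<close> rounds with
  \<open>k \<le> 2 * n\<close>, and for every inner loop.\<close>

definition bound :: "nat \<Rightarrow> nat" where "bound x = 7 * ((x + 1) * (x + 1))"
definition bound_poly :: "nat poly" where "bound_poly = [:7:] * ([:1, 1:] * [:1, 1:])"
definition time_poly :: "nat poly" where "time_poly = pcompose (cost_poly flow_com) bound_poly"

lemma time_poly: "poly time_poly x = cost (bound x) flow_com"
  by (simp add: time_poly_def poly_pcompose poly_cost_poly bound_def bound_poly_def algebra_simps)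

text \<open>The time bound also fixes the number of coins supplied, so it must be at least the
  number of coins flipped. The nested flipping loops alone are charged \<open>N * N\<close>.\<close>

lemma square_le_cost: "N * N \<le> cost N flow_com"
proof -
  have "N \<le> cost N flip_com" by (simp add: flip_com_def For_def)
  hence "N * N \<le> N * cost N flip_com" by simp
  also have "\<dots> \<le> cost N flow_com"
    by (simp add: flow_com_def setup_com_def For_def[of "''l''" NumJobs flip_com] algebra_simps)
  finally show ?thesis .
qed

lemma bound_ge: "x \<le> bound x" "x * x \<le> cost (bound x) flow_com"
proof -
  show x: "x \<le> bound x" by (simp add: bound_def algebra_simps)
  have "x * x \<le> bound x * bound x" using x by (intro mult_mono) simp_all
  thus "x * x \<le> cost (bound x) flow_com" using square_le_cost order.trans by blast
qed

lemma coins_suffice: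
  assumes "valid_problem J"
  shows "num_jobs J * kx J \<le> poly time_poly (num_jobs J)"
proof -
  have "num_jobs J * kx J \<le> num_jobs J * num_jobs J" using kx(3)[OF assms] by (rule mult_left_mono) simp
  also have "\<dots> \<le> poly time_poly (num_jobs J)" using bound_ge(2)[of "num_jobs J"] by (simp only: time_poly)
  finally show ?thesis .
qed

section \<open>Averaging over the coins\<close>

lemma card_bits: "card {w :: bool list. length w = a} = 2 ^ a"
  using card_lists_length_eq[of "UNIV :: bool set" a] by simp

lemma finite_bits: "finite {w :: bool list. length w = a}"
  using finite_lists_length_eq[of "UNIV :: bool set" a] by simp

text \<open>Conditioning on all bits outside one block, in the form of counting.\<close>

lemma card_middle:
  assumes "\<And>x y. length x = a \<Longrightarrow> length y = b \<Longrightarrow>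
    card {u :: bool list. length u = e \<and> Pr (x @ u @ y)} \<le> c"
  shows "card {w. length w = a + e + b \<and> Pr w} \<le> c * 2 ^ (a + b)"
proof -
  let ?X = "{x :: bool list. length x = a}" let ?Y = "{y :: bool list. length y = b}"
  let ?U = "\<lambda>(x, y). {u :: bool list. length u = e \<and> Pr (x @ u @ y)}"
  have fU: "finite (?U z)" for z
    using finite_subset[OF _ finite_bits[of e], of "?U z"] by (auto split: prod.splits)
  have "{w. length w = a + e + b \<and> Pr w} \<subseteq> (\<lambda>(z, u). fst z @ u @ snd z) ` Sigma (?X \<times> ?Y) ?U"
  proof
    fix w assume w: "w \<in> {w. length w = a + e + b \<and> Pr w}"
    let ?x = "take a w" let ?u = "take e (drop a w)" let ?y = "drop e (drop a w)"
    have eq: "?x @ ?u @ ?y = w" by (simp only: append_take_drop_id)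
    have "((?x, ?y), ?u) \<in> Sigma (?X \<times> ?Y) ?U" using w eq by auto
    thus "w \<in> (\<lambda>(z, u). fst z @ u @ snd z) ` Sigma (?X \<times> ?Y) ?U"
      by (rule rev_image_eqI) (use eq in simp)
  qed
  hence "card {w. length w = a + e + b \<and> Pr w} \<le> card (Sigma (?X \<times> ?Y) ?U)"
    using surj_card_le[of "Sigma (?X \<times> ?Y) ?U"] finite_bits fU by blast
  also have "\<dots> = (\<Sum>z\<in>?X \<times> ?Y. card (?U z))"
    using finite_bits fU by (intro card_SigmaI) auto
  also have "\<dots> \<le> (\<Sum>z\<in>?X \<times> ?Y. c)" using assms by (intro sum_mono) auto
  also have "\<dots> = c * 2 ^ (a + b)" by (simp add: card_cartesian_product card_bits power_add)
  finally show ?thesis .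
qed

lemma bv_inj: "length u = length v \<Longrightarrow> bv u = bv v \<Longrightarrow> u = v"
proof (induction u arbitrary: v rule: rev_induct)
  case (snoc x u)
  obtain v' y where v: "v = v' @ [y]" using snoc.prems(1) by (cases v rule: rev_cases) auto
  have *: "bv u + bv u + of_bool x = bv v' + bv v' + of_bool y"
    using snoc.prems(2) by (simp add: v bv_snoc)
  hence "x = y" by (cases x; cases y) (simp_all, presburger+)
  moreover from this * have "bv u = bv v'" by simp
  ultimately show ?case using snoc.IH[of v'] snoc.prems(1) v by simp
qed simp

text \<open>Translates a change of one block of coins into the update of one random number, the form
  required by \<open>hits_le\<close>.\<close>

lemma rnd_middle:
  assumes "length x = l * e" "length u = e" "length u' = e" "l < n"
  shows "rnd n e (x @ u @ y) = (rnd n e (x @ u' @ y))(l := bv u)"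
proof
  fix i
  consider "i < l" | "i = l" | "l < i" by linarith
  thus "rnd n e (x @ u @ y) i = ((rnd n e (x @ u' @ y))(l := bv u)) i"
  proof cases
    case 1
    hence "Suc i * e \<le> l * e" by (intro mult_right_mono) auto
    hence "e + i * e \<le> l * e" by simp
    thus ?thesis using 1 assms by (simp add: rnd_def)
  next
    case 3
    hence "Suc l * e \<le> i * e" by (intro mult_right_mono) auto
    hence "e + l * e \<le> i * e" by simp
    thus ?thesis using 3 assms by (simp add: rnd_def)
  qed (use assms in \<open>simp add: rnd_def\<close>)
qed

section \<open>The expected flow time on one instance\<close>

locale flow_instance =
  fixes J :: problem
  assumes valid_J: "valid_problem J" and jobs: "0 < num_jobs J"
begin

lemma hx_le: "2 ^ hx J \<le> mach J"
proof (cases "hx J")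
  case 0
  thus ?thesis using valid_J jobs by (simp add: mach_def valid_problem_def)
next
  case (Suc i)
  thus ?thesis using hx(2)[of i J] by simp
qed

sublocale flow J "2 ^ kx J" "2 ^ hx J"
  using valid_J jobs hx_le hx(1)[of J] by unfold_locales (simp_all add: mach_def)

sublocale flow_opt J "2 ^ kx J" "2 ^ hx J" "OPT J"
  by (rule flow_opt_OPT)

lemma mach_m: "mach J = m"
  by (simp add: mach_def m_def)

lemma kx_cases: "kx J = 0 \<or> (\<exists>i. kx J = Suc i \<and> m * 4 ^ i < n)"
  using kx(2)[OF valid_J] by (cases "kx J") (simp_all add: mach_m)

lemma k_le_n: "2 ^ kx J \<le> 2 * n"
proof -
  {
    fix i assume i: "kx J = Suc i" "m * 4 ^ i < n"
    have "(2::nat) ^ i \<le> 4 ^ i" by (rule power_mono) simp_all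
    also have "\<dots> \<le> m * 4 ^ i" using m_pos by simp
    finally have ?thesis using i by simp
  }
  thus ?thesis using kx_cases jobs by auto
qed

text \<open>If \<open>k > 1\<close>, minimality of the exponent gives
  \<open>m * (k / 2) ^ 2 < n\<close>. In particular \<open>m < n\<close>, so the cap is inactive and
  \<open>m\<close> is the number of machines. The case \<open>k = 1\<close> accounts for the maximum
  with 1.\<close>

lemma k_le_root: "real (2 ^ kx J) \<le> 2 * max 1 (sqrt (n / num_machines J))"
proof -
  {
    fix i assume i: "kx J = Suc i" "m * 4 ^ i < n"
    have "m * 1 \<le> m * 4 ^ i" by (intro mult_left_mono) simp_all
    hence "m < n" using i(2) by linarith
    hence M: "m = num_machines J" by (simp add: m_def)
    have "real (m * 4 ^ i) \<le> n" using i(2) by (simp only: of_nat_le_iff less_imp_le)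
    hence "real m * 4 ^ i \<le> n" by simp
    hence "(4::real) ^ i \<le> n / m" using m_pos by (simp add: pos_le_divide_eq mult.commute)
    moreover have "((2::real) ^ i)\<^sup>2 = 4 ^ i" by (simp add: power2_eq_square power_mult_distrib[symmetric])
    ultimately have "2 ^ i \<le> sqrt (n / m)" by (intro real_le_rsqrt) simp
    hence ?thesis using i M by simp
  }
  thus ?thesis using kx_cases by (auto simp: le_max_iff_disj)
qed

lemma n_le: "real n \<le> m * real (2 ^ kx J) * real (2 ^ kx J)"
proof -
  have "(4::nat) ^ kx J = 2 ^ kx J * 2 ^ kx J" by (simp add: power_mult_distrib[symmetric])
  hence "n \<le> m * 2 ^ kx J * 2 ^ kx J" using kx(1)[OF valid_J] by (simp add: mach_m mult.assoc)
  hence "real n \<le> real (m * 2 ^ kx J * 2 ^ kx J)" by (simp only: of_nat_le_iff)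
  thus ?thesis by simp
qed

abbreviation "sched w \<equiv> sch (fin (rnd n (kx J) w))"

lemma flow_com_tri:
  assumes w: "n * kx J \<le> length w"
  shows "tri J (bound n) flow_com (init w) (\<lambda>s. started s = sched w)"
proof -
  interpret flow_prog J "2 ^ kx J" "2 ^ hx J" "OPT J" "kx J" "hx J" "bound n" "rnd n (kx J) w"
    using bound_ge(1)[of n] kx(3)[OF valid_J] hx(3)[of J] rnd_less
    by unfold_locales simp_all
  have "n * (2 * 2 ^ kx J + 7) \<le> n * (2 * (2 * n) + 7)"
    by (intro mult_left_mono add_right_mono) (use k_le_n in simp_all)
  also have "\<dots> \<le> bound n" by (simp add: bound_def algebra_simps)
  finally have N: "mea c0 \<le> int (bound n)" using mea_c0 by linarith
  have "rel c0 s" if "pars J (2 ^ kx J) (kx J) (hx J) s \<and> ivar s ''R'' = rnd n (kx J) w" for s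
    using that by (simp add: rel_def pars_def fresh_def c0_def d0_def mach_m)
  thus ?thesis unfolding flow_com_def
    by (intro tri_Seq tri_mono[OF setup_tri[OF valid_J bound_ge(1) w]] loop_tri N)
qed

text \<open>With the other coins fixed, at most 12 of the \<open>2 ^ kx J\<close> values of the
  block of \<open>l\<close> are hits, so a hit has probability at most
  \<open>12 / k\<close>.\<close>

lemma card_hit:
  assumes "l < n" "n * kx J \<le> T"
  shows "card {w. length w = T \<and> hit (fz (fin (rnd n (kx J) w))) \<kappa> l} * 2 ^ kx J \<le> 12 * 2 ^ T"
proof -
  let ?e = "kx J"
  have "Suc l * ?e \<le> n * ?e" using assms(1) by (intro mult_right_mono) auto
  hence T: "T = l * ?e + ?e + (T - l * ?e - ?e)" using assms(2) by simp
  define b where "b = T - l * ?e - ?e"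
  have "card {w. length w = l * ?e + ?e + b \<and> hit (fz (fin (rnd n ?e w))) \<kappa> l} \<le> 12 * 2 ^ (l * ?e + b)"
  proof (rule card_middle)
    fix x y :: "bool list" assume x: "length x = l * ?e" "length y = b"
    define R where "R = rnd n ?e (x @ replicate ?e False @ y)"
    let ?U = "{u. length u = ?e \<and> hit (fz (fin (rnd n ?e (x @ u @ y)))) \<kappa> l}"
    have "bv ` ?U \<subseteq> {v. v < 2 ^ ?e \<and> hit (fz (fin (R(l := v)))) \<kappa> l}"
    proof
      fix v assume "v \<in> bv ` ?U"
      then obtain u where u: "v = bv u" "length u = ?e" "hit (fz (fin (rnd n ?e (x @ u @ y)))) \<kappa> l" by blast
      have "rnd n ?e (x @ u @ y) = R(l := v)"
        unfolding R_def u(1) by (rule rnd_middle) (use x u assms in simp_all)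
      thus "v \<in> {v. v < 2 ^ ?e \<and> hit (fz (fin (R(l := v)))) \<kappa> l}" using u bv_less[of u] by simp
    qed
    hence "card (bv ` ?U) \<le> card {v. v < 2 ^ ?e \<and> hit (fz (fin (R(l := v)))) \<kappa> l}"
      by (intro card_mono) simp_all
    also have "\<dots> \<le> 12" by (rule hits_le) (use rnd_less assms in \<open>simp_all add: R_def\<close>)
    finally show "card ?U \<le> 12"
      using card_image[of bv ?U] bv_inj by (auto simp: inj_on_def)
  qed
  hence *: "card {w. length w = T \<and> hit (fz (fin (rnd n ?e w))) \<kappa> l} \<le> 12 * 2 ^ (l * ?e + b)"
    using T unfolding b_def[symmetric] by simp
  have "2 ^ T = (2::nat) ^ (l * ?e + b) * 2 ^ ?e"
    using T unfolding b_def[symmetric] power_add[symmetric] by (metis add.commute add.left_commute)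
  with mult_right_mono[OF *, of "2 ^ ?e"] show ?thesis by simp
qed

text \<open>The factor \<open>8 * k + 2\<close> is at most \<open>10 * k\<close>. The lateness has
  the factor \<open>n / (m * k)\<close>, at most \<open>k\<close>, times \<open>4 * 2\<close> from
  \<open>P + OPT J\<close> and \<open>8 * 12\<close> from the hits. Together this is
  \<open>114 * k\<close>, and \<open>k_le_root\<close> doubles it to 228.\<close>

lemma average:
  assumes T: "n * kx J \<le> T"
  defines "W \<equiv> {w :: bool list. length w = T}"
  shows "(\<Sum>w\<in>W. nonpreemptive_flow J (sched w)) \<le> 228 * max 1 (sqrt (n / num_machines J)) * OPT J * 2 ^ T"
proof -
  let ?k = "real (2 ^ kx J)"
  define H where "H w x l \<longleftrightarrow> hit (fz (fin (rnd n (kx J) w))) (ky dfin x) l" for w x l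
  define a where "a = (8 * ?k + 2) * P + 4 * n / (m * ?k) * (P + OPT J)"
  have mk: "0 < real m" "0 < ?k" "1 \<le> ?k" using m_pos by simp_all
  have card: "card {w \<in> W. H w x l} \<le> 12 / ?k * 2 ^ T" if "l < n" for x l
  proof -
    have "card {w \<in> W. H w x l} * 2 ^ kx J \<le> 12 * 2 ^ T"
      using card_hit[OF that T] by (simp add: W_def H_def)
    hence "real (card {w \<in> W. H w x l} * 2 ^ kx J) \<le> real (12 * 2 ^ T)" by (simp only: of_nat_le_iff)
    hence "real (card {w \<in> W. H w x l}) * ?k \<le> 12 * 2 ^ T" by simp
    thus ?thesis using mk by (simp add: field_simps)
  qed
  have fW: "finite W" "card W = 2 ^ T" by (simp_all add: W_def finite_bits card_bits)
  have "(\<Sum>w\<in>W. \<Sum>x<n. \<Sum>l<n. if H w x l then p l else 0) =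
      (\<Sum>x<n. \<Sum>w\<in>W. \<Sum>l<n. if H w x l then p l else 0)"
    by (rule sum.swap)
  also have "\<dots> = (\<Sum>x<n. \<Sum>l<n. \<Sum>w\<in>W. if H w x l then p l else 0)"
    by (intro sum.cong refl sum.swap)
  also have "\<dots> = (\<Sum>x<n. \<Sum>l<n. card {w \<in> W. H w x l} * p l)"
    using fW(1) by (simp add: sum.If_cases Int_def)
  also have "\<dots> \<le> (\<Sum>x<n. \<Sum>l<n. 12 / ?k * 2 ^ T * p l)"
    using card p_pos by (intro sum_mono mult_right_mono) (auto intro: less_imp_le)
  also have "\<dots> = n * (12 / ?k * 2 ^ T * P)" by (simp add: P_def sum_distrib_left)
  finally have hits: "(\<Sum>w\<in>W. \<Sum>x<n. \<Sum>l<n. if H w x l then p l else 0) \<le> n * (12 / ?k * 2 ^ T * P)" .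
  have "(\<Sum>w\<in>W. nonpreemptive_flow J (sched w)) \<le>
      (\<Sum>w\<in>W. a + 8 / m * (\<Sum>x<n. \<Sum>l<n. if H w x l then p l else 0))"
  proof (rule sum_mono)
    fix w
    from fin_flow[of "rnd n (kx J) w", OF rnd_less] show "nonpreemptive_flow J (sched w) \<le>
        a + 8 / m * (\<Sum>x<n. \<Sum>l<n. if H w x l then p l else 0)"
      unfolding a_def H_def by (simp add: algebra_simps)
  qed
  also have "\<dots> = 2 ^ T * a + 8 / m * (\<Sum>w\<in>W. \<Sum>x<n. \<Sum>l<n. if H w x l then p l else 0)"
    by (simp add: sum.distrib fW(2) sum_distrib_left)
  also have "\<dots> \<le> 2 ^ T * a + 8 / m * (n * (12 / ?k * 2 ^ T * P))"
    using hits mk by (intro add_left_mono mult_left_mono) simp_all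
  also have "\<dots> = 2 ^ T * ((8 * ?k + 2) * P + n / (m * ?k) * (4 * (P + OPT J) + 96 * P))"
  proof -
    define z where "z = n / (m * ?k)"
    have "4 * n / (m * ?k) = 4 * z" "8 / m * (n * (12 / ?k * 2 ^ T * P)) = 96 * z * 2 ^ T * P"
      by (simp_all add: z_def)
    thus ?thesis unfolding a_def z_def[symmetric] by (simp only: distrib_left distrib_right mult_ac add_ac)
  qed
  also have "\<dots> \<le> 2 ^ T * (10 * ?k * OPT J + ?k * (104 * OPT J))"
  proof (intro mult_left_mono add_mono mult_mono)
    show "real n / (m * ?k) \<le> ?k" using n_le mk by (simp add: divide_le_eq mult_ac)
  qed (use mk P_le P_nonneg in simp_all)
  also have "\<dots> = 114 * ?k * OPT J * 2 ^ T" by simp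
  also have "\<dots> \<le> 114 * (2 * max 1 (sqrt (n / num_machines J))) * OPT J * 2 ^ T"
    using k_le_root V_nonneg by (intro mult_right_mono mult_left_mono) simp_all
  finally show ?thesis by simp
qed

end

text \<open>An instance without jobs lies outside the locale and is treated apart: after the setup
  the main loop is left at once.\<close>

lemma flow_com_cases:
  assumes "valid_problem J" "length w = poly time_poly (num_jobs J)"
  shows "\<exists>S. tri J (bound (num_jobs J)) flow_com (init w) (\<lambda>s. started s = S) \<and> nonpreemptive_schedule J S"
proof -
  let ?n = "num_jobs J"
  have len: "?n * kx J \<le> length w" using coins_suffice[OF assms(1)] assms(2) by simp
  show ?thesis
  proof (cases "?n = 0")
    case True
    have "tri J (bound ?n) loop_com s (\<lambda>s. started s = Map.empty)" if "fresh s" for s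
      unfolding loop_com_def
      by (rule tri_While[where I = "\<lambda>s'. s' = s" and \<mu> = "\<lambda>_. 0"])
        (use that True in \<open>auto simp: fresh_def\<close>)
    hence "tri J (bound ?n) flow_com (init w) (\<lambda>s. started s = Map.empty)"
      unfolding flow_com_def
      by (intro tri_Seq tri_mono[OF setup_tri[OF assms(1) bound_ge(1) len]]) (simp add: pars_def)
    moreover have "nonpreemptive_schedule J Map.empty"
      using True by (simp add: nonpreemptive_schedule_def)
    ultimately show ?thesis by blast
  next
    case False
    then interpret flow_instance J using assms(1) by unfold_locales simp_all
    show ?thesis using flow_com_tri[OF len] fin_schedule[of "rnd n (kx J) w"] rnd_less by blast
  qed
qed

text \<open>The expectation is an average over all bit strings as long as the time bound, of which
  the program reads the first \<open>n * kx J\<close> bits.\<close>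

lemma flow_com_competitive:
  "competitive flow_com (poly time_poly) (\<lambda>n m. 228 * max 1 (sqrt (real n / real m)))"
  unfolding competitive_def
proof (intro allI impI)
  fix J assume valid: "valid_problem J"
  let ?n = "num_jobs J"
  let ?T = "poly time_poly ?n"
  let ?W = "{w :: bool list. length w = ?T}"
  note T = coins_suffice[OF valid]
  have W: "?W \<noteq> {}" using card_bits[of ?T] by (metis card.empty power_not_zero zero_neq_numeral)
  have E: "expected_flow flow_com (poly time_poly) J =
      (\<Sum>w\<in>?W. nonpreemptive_flow J (schedule_of flow_com J w)) / 2 ^ ?T"
    by (simp add: expected_flow_def random_bits_def integral_pmf_of_set[OF W finite_bits] card_bits)
  have opt: "0 \<le> OPT J"
  proof -
    have "0 \<le> (\<Sum>j<?n. proc J j)" using valid by (intro sum_nonneg) (auto simp: valid_problem_def less_imp_le)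
    thus ?thesis using sum_proc_le_OPT[OF valid] by linarith
  qed
  show "expected_flow flow_com (poly time_poly) J \<le>
      228 * max 1 (sqrt (real ?n / real (num_machines J))) * OPT J"
  proof (cases "?n = 0")
    case True
    thus ?thesis using opt by (simp add: E nonpreemptive_flow_def)
  next
    case False
    then interpret flow_instance J using valid by unfold_locales simp_all
    have "schedule_of flow_com J w = sched w" if "w \<in> ?W" for w
      by (rule schedule_of_tri, rule flow_com_tri) (use that T in simp)
    hence "(\<Sum>w\<in>?W. nonpreemptive_flow J (schedule_of flow_com J w)) =
        (\<Sum>w\<in>?W. nonpreemptive_flow J (sched w))"
      by (intro sum.cong) simp_all
    thus ?thesis using average[OF T] unfolding E by (simp add: pos_divide_le_eq)
  qed
qed

theorem mainTheorem2:
  shows "\<exists>(A :: com) (q :: nat poly) (C :: real).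
    runs_in_time A (poly q) \<and>
    nonpreemptive_algorithm A (poly q) \<and>
    competitive A (poly q) (\<lambda>n m. C * max 1 (sqrt (real n / real m)))"
proof (intro exI conjI)
  show "runs_in_time flow_com (poly time_poly)"
    unfolding runs_in_time_def
  proof (intro allI impI, elim conjE)
    fix J and w :: "bool list"
    assume "valid_problem J" "length w = poly time_poly (num_jobs J)"
    from flow_com_cases[OF this] show
      "\<exists>t s. big_step J flow_com (init w) t s \<and> t \<le> poly time_poly (num_jobs J)"
      unfolding tri_def time_poly by blast
  qed
  show "nonpreemptive_algorithm flow_com (poly time_poly)"
    unfolding nonpreemptive_algorithm_def
  proof (intro allI impI, elim conjE)
    fix J and w :: "bool list"
    assume "valid_problem J" "length w = poly time_poly (num_jobs J)"
    from flow_com_cases[OF this] show "nonpreemptive_schedule J (schedule_of flow_com J w)"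
      using schedule_of_tri by blast
  qed
  show "competitive flow_com (poly time_poly) (\<lambda>n m. 228 * max 1 (sqrt (real n / real m)))"
    by (rule flow_com_competitive)
qed

end
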